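(* Let $r$ be a positive integer and $s\in\mu_r$. For every $w\in\mathcal{A}^1_{\mu_r,>0}$, every $w'\in\mathcal{A}^1_{\{1\},>0}$ and every integer $m\ge 0$, $$\sum_{\substack{k+l=m\\ k\ge 0,\ l>0}}\mathcal{L}^{\mathrm{sh}}\Bigl(L_x^{-1}\mathcal{I}\bigl(\mathcal{I}^{-1}L_{x+\delta(s)y_s}\varphi\mathcal{I}M_s(w)\ \dot{\ast}\ y_1^{k+1}\bigr)\Bigr)\,\mathcal{L}^{\mathrm{sh}}\Bigl(L_x^{-1}\bigl(L_x\varphi(w')\ \dot{\ast}\ y_1^{l}\bigr)\Bigr)=\mathcal{L}^{\mathrm{sh}}\Bigl(L_x^{-1}\mathcal{I}\bigl(\mathcal{I}^{-1}L_{x+\delta(s)y_s}\varphi\mathcal{I}M_s(w\ast w')\ \dot{\ast}\ y_1^{m+1}\bigr)\Bigr),$$ where for $m=0$ the left-hand side is $0$.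
   Context: Let $\mu_r$ be the group of $r$-th roots of unity. For a multiplicative group (or multiplicatively closed set) $\Lambda$, $\mathcal{A}_\Lambda=\mathbb{Q}\langle x,y_s\mid s\in\Lambda\rangle$ is the free non-commutative algebra; $\mathcal{A}^1_\Lambda=\mathbb{Q}+\sum_{s\in\Lambda}\mathcal{A}_\Lambda y_s$, $\mathcal{A}^0_\Lambda=\mathbb{Q}+\sum_{s\in\Lambda}x\mathcal{A}_\Lambda y_s+\sum_{s,t\in\Lambda,\,t\ne1}y_t\mathcal{A}_\Lambda y_s$, and $\mathcal{A}^1_{\Lambda,>0}$ is the set of elements of $\mathcal{A}^1_\Lambda$ with no constant term; $\mathcal{A}_{\{1\}}\subset\mathcal{A}_{\mu_r}$. Write $z_{k,s}=x^{k-1}y_s$; every word of positive degree is uniquely $z_{k_1,s_1}\cdots z_{k_n,s_n}x^l$. $\delta(s)=0$ if $s\in\{0,1\}$, $\delta(s)=1$ otherwise. $\varphi$ is the algebra automorphism with $\varphi(x)=x+y_1$, $\varphi(y_s)=\delta(s)y_s-y_1$. $\mathcal{I},\mathcal{I}^{-1},M_s$ are the $\mathbb{Q}$-linear maps on words of positive degree given by $\mathcal{I}(z_{k_1,s_1}\cdots z_{k_n,s_n}x^l)=z_{k_1,s_1}z_{k_2,s_1s_2}\cdots z_{k_n,s_1\cdots s_n}x^l$, $\mathcal{I}^{-1}(z_{k_1,s_1}\cdots z_{k_n,s_n}x^l)=z_{k_1,s_1}z_{k_2,s_2/s_1}\cdots z_{k_n,s_n/s_{n-1}}x^l$, $M_s(z_{k_1,s_1}\cdots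 z_{k_n,s_n}x^l)=z_{k_1,ss_1}z_{k_2,s_2}\cdots z_{k_n,s_n}x^l$. $L_u(v)=uv$, and $L_x^{-1}$ removes a leading letter $x$ (applied to elements of $x\mathcal{A}_{\mu_r}$; the arguments of $\mathcal{L}^{\mathrm{sh}}$ above are elements of $\mathcal{A}^0_{\mu_r}$). The harmonic product $\ast$ on $\mathcal{A}^1_\Lambda$ is $\mathbb{Q}$-bilinear with $1\ast w=w\ast1=w$ and $z_{k,s}w\ast z_{l,t}w'=z_{k,s}(w\ast z_{l,t}w')+z_{l,t}(z_{k,s}w\ast w')+z_{k+l,st}(w\ast w')$; the product $\dot\ast$ is $\mathbb{Q}$-bilinear with $1\,\dot\ast\,w=w\,\dot\ast\,1=w$ and $z_{k,s}w\,\dot\ast\,z_{l,t}w'=z_{k+l,st}(w\ast w')$ (words $w,w'$). $\mathcal{L}^{\mathrm{sh}}:\mathcal{A}^0_{\mu_r}\to\mathbb{C}$ is the $\mathbb{Q}$-linear map with $\mathcal{L}^{\mathrm{sh}}(1)=1$ and $\mathcal{L}^{\mathrm{sh}}(x^{k_1-1}y_{s_1}\cdots x^{k_n-1}y_{s_n})=\lim_{M\to\infty}\sum_{M>m_1>\cdots>m_n>0}\frac{s_1^{m_1-m_2}\cdots s_{n-1}^{m_{n-1}-m_n}s_n^{m_n}}{m_1^{k_1}\cdots m_n^{k_n}}$ (multiple $L$-value of shuffle type). *)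

theory Defs
  imports Complex_Main
begin

text \<open>Letters: X is x, Y s is y_s (s a complex number, in practice a root of unity).
  Words are letter lists; an element of A_Lambda is a finitely supported
  function from words to rationals (its coefficients).\<close>

datatype letter = X | Y complex

type_synonym qpoly = "letter list \<Rightarrow> rat"

definition fsupp :: "qpoly \<Rightarrow> bool" where
  "fsupp P \<longleftrightarrow> finite {w. P w \<noteq> 0}"

definition mon :: "letter list \<Rightarrow> qpoly" where
  "mon w = (\<lambda>u. if u = w then 1 else 0)"

definition padd :: "qpoly \<Rightarrow> qpoly \<Rightarrow> qpoly" where
  "padd P Q = (\<lambda>u. P u + Q u)"

definition psmult :: "rat \<Rightarrow> qpoly \<Rightarrow> qpoly" where
  "psmult c P = (\<lambda>u. c * P u)"

definition lin :: "(letter list \<Rightarrow> qpoly) \<Rightarrow> qpoly \<Rightarrow> qpoly" where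
  "lin f P = (\<lambda>u. \<Sum>w\<in>{w. P w \<noteq> 0}. P w * f w u)"

definition pmul :: "qpoly \<Rightarrow> qpoly \<Rightarrow> qpoly" where
  "pmul P Q = lin (\<lambda>a. lin (\<lambda>b. mon (a @ b)) Q) P"

section \<open>Decomposition of words into z_{k,s} = x^{k-1} y_s\<close>

fun zparse_aux :: "nat \<Rightarrow> letter list \<Rightarrow> (nat \<times> complex) list" where
  "zparse_aux k [] = []"
| "zparse_aux k (X # w) = zparse_aux (Suc k) w"
| "zparse_aux k (Y s # w) = (Suc k, s) # zparse_aux 0 w"

text \<open>The z-part (k_1,s_1),...,(k_n,s_n) of a word z_{k1,s1}...z_{kn,sn} x^l.\<close>
definition zparse :: "letter list \<Rightarrow> (nat \<times> complex) list" where
  "zparse w = zparse_aux 0 w"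

definition tailx :: "letter list \<Rightarrow> nat" where
  "tailx w = length (takeWhile (\<lambda>c. c = X) (rev w))"

fun zword :: "(nat \<times> complex) list \<Rightarrow> letter list" where
  "zword [] = []"
| "zword ((k, s) # r) = replicate (k - 1) X @ [Y s] @ zword r"

fun Iz :: "complex \<Rightarrow> (nat \<times> complex) list \<Rightarrow> (nat \<times> complex) list" where
  "Iz a [] = []"
| "Iz a ((k, s) # r) = (k, a * s) # Iz (a * s) r"

fun Iinvz :: "complex \<Rightarrow> (nat \<times> complex) list \<Rightarrow> (nat \<times> complex) list" where
  "Iinvz a [] = []"
| "Iinvz a ((k, s) # r) = (k, s / a) # Iinvz s r"

fun Mz :: "complex \<Rightarrow> (nat \<times> complex) list \<Rightarrow> (nat \<times> complex) list" where
  "Mz c [] = []"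
| "Mz c ((k, s) # r) = (k, c * s) # r"

definition Iop :: "qpoly \<Rightarrow> qpoly" where
  "Iop = lin (\<lambda>w. mon (zword (Iz 1 (zparse w)) @ replicate (tailx w) X))"

definition Iinv :: "qpoly \<Rightarrow> qpoly" where
  "Iinv = lin (\<lambda>w. mon (zword (Iinvz 1 (zparse w)) @ replicate (tailx w) X))"

definition Mop :: "complex \<Rightarrow> qpoly \<Rightarrow> qpoly" where
  "Mop c = lin (\<lambda>w. mon (zword (Mz c (zparse w)) @ replicate (tailx w) X))"

text \<open>L_x^{-1}: removes a leading x (words not starting with x are sent to 0;
  it is only applied to elements of x A).\<close>
definition Lxinv :: "qpoly \<Rightarrow> qpoly" where
  "Lxinv = lin (\<lambda>w. case w of X # v \<Rightarrow> mon v | _ \<Rightarrow> (\<lambda>_. 0))"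

definition delta :: "complex \<Rightarrow> rat" where
  "delta s = (if s = 0 \<or> s = 1 then 0 else 1)"

fun phi_letter :: "letter \<Rightarrow> qpoly" where
  "phi_letter X = padd (mon [X]) (mon [Y 1])"
| "phi_letter (Y s) = padd (psmult (delta s) (mon [Y s])) (psmult (-1) (mon [Y 1]))"

fun phi_word :: "letter list \<Rightarrow> qpoly" where
  "phi_word [] = mon []"
| "phi_word (c # w) = pmul (phi_letter c) (phi_word w)"

definition phi :: "qpoly \<Rightarrow> qpoly" where
  "phi = lin phi_word"

fun harmz :: "(nat \<times> complex) list \<Rightarrow> (nat \<times> complex) list \<Rightarrow> qpoly" where
  "harmz [] v = mon (zword v)"
| "harmz u [] = mon (zword u)"
| "harmz ((k, s) # u) ((l, t) # v) =
     padd (pmul (mon (zword [(k, s)])) (harmz u ((l, t) # v)))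
      (padd (pmul (mon (zword [(l, t)])) (harmz ((k, s) # u) v))
            (pmul (mon (zword [(k + l, s * t)])) (harmz u v)))"

fun dstz :: "(nat \<times> complex) list \<Rightarrow> (nat \<times> complex) list \<Rightarrow> qpoly" where
  "dstz [] v = mon (zword v)"
| "dstz u [] = mon (zword u)"
| "dstz ((k, s) # u) ((l, t) # v) = pmul (mon (zword [(k + l, s * t)])) (harmz u v)"

text \<open>The harmonic product * on A^1 (words of A^1 are exactly the zword's).\<close>
definition star :: "qpoly \<Rightarrow> qpoly \<Rightarrow> qpoly" where
  "star P Q = lin (\<lambda>a. lin (\<lambda>b. harmz (zparse a) (zparse b)) Q) P"

definition dotstar :: "qpoly \<Rightarrow> qpoly \<Rightarrow> qpoly" where
  "dotstar P Q = lin (\<lambda>a. lin (\<lambda>b. dstz (zparse a) (zparse b)) Q) P"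

definition mlv_partial :: "(nat \<times> complex) list \<Rightarrow> nat \<Rightarrow> complex" where
  "mlv_partial zs M =
     (\<Sum>ms\<in>{ms. length ms = length zs \<and> sorted_wrt (>) ms \<and> (\<forall>m\<in>set ms. 0 < m \<and> m < M)}.
        \<Prod>i<length zs. (snd (zs ! i)) ^ (ms ! i - (ms @ [0]) ! Suc i)
                        / of_nat (ms ! i) ^ (fst (zs ! i)))"

text \<open>L^sh on words; only words ending in some y_s (A^0) are meaningful.\<close>
definition Lsh_word :: "letter list \<Rightarrow> complex" where
  "Lsh_word w = (if w = [] then 1
     else if tailx w = 0 then lim (\<lambda>M. mlv_partial (zparse w) M) else undefined)"

definition Lsh :: "qpoly \<Rightarrow> complex" where
  "Lsh P = (\<Sum>w\<in>{w. P w \<noteq> 0}. of_rat (P w) * Lsh_word w)"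

definition mu :: "nat \<Rightarrow> complex set" where
  "mu r = {z. z ^ r = 1}"

definition A1pos :: "complex set \<Rightarrow> qpoly \<Rightarrow> bool" where
  "A1pos Lam P \<longleftrightarrow> fsupp P \<and>
     (\<forall>w. P w \<noteq> 0 \<longrightarrow> w \<noteq> [] \<and> (\<exists>s\<in>Lam. last w = Y s) \<and>
          (\<forall>t. Y t \<in> set w \<longrightarrow> t \<in> Lam))"

definition ypow :: "nat \<Rightarrow> qpoly" where
  "ypow n = mon (replicate n (Y 1))"

end

theory Submission
  imports "HOL-Complex_Analysis.Complex_Analysis" Defs
begin

text \<open>
  For \<open>s\<close> and a word \<open>w = z\<^bsub>k\<^sub>1,s\<^sub>1\<^esub> \<dots> z\<^bsub>k\<^sub>n,s\<^sub>n\<^esub>\<close> put \<open>\<beta>\<^sub>i = s s\<^sub>1 \<dots> s\<^sub>i\<close>, replaced by \<open>0\<close> if this product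
  is \<open>1\<close>, and \<open>\<alpha>\<^sub>i = 1 - \<beta>\<^sub>i\<close>. The change of variables \<open>t \<mapsto> t/(t - 1)\<close> turns the letters \<open>x + y\<^sub>1\<close> and
  \<open>y\<^sub>\<beta> - y\<^sub>1\<close> produced by \<open>\<phi>\<close> into \<open>x\<close> and \<open>y\<^bsub>1-\<beta>\<^esub>\<close>. Hence the Newton series whose coefficients are those of the
  iterated integral of \<open>(x + \<delta>(s) y\<^sub>s) \<phi>(I(M\<^sub>s(w)))\<close> interpolates, up to the factor \<open>- N\<close>, the sums over
  \<open>N \<ge> m\<^sub>1 > \<dots> > m\<^sub>n > 0\<close> of \<open>\<alpha>\<^sub>0\<^bsup>N-m\<^sub>1\<^esup> \<alpha>\<^sub>1\<^bsup>m\<^sub>1-m\<^sub>2\<^esup> \<dots> \<alpha>\<^sub>n\<^bsup>m\<^sub>n\<^esup> / (m\<^sub>1\<^bsup>k\<^sub>1\<^esup> \<dots> m\<^sub>n\<^bsup>k\<^sub>n\<^esup>)\<close>.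
  Multiplying such a sum by a harmonic sum without characters only repeats some of the \<open>\<alpha>\<^sub>i\<close>, so at integers
  the interpolating function of \<open>w * w'\<close> is the product of those of \<open>w\<close> and \<open>w'\<close>.

  The identity extends to complex arguments: inductively, the difference \<open>D\<close> of the two sides satisfies
  \<open>D(z) = \<alpha>\<^sub>0 D(z - 1)\<close>, it vanishes at \<open>0\<close>, and it is of exponential type at most \<open>\<pi>\<close> on a vertical
  strip, while \<open>\<alpha>\<^sub>0\<close> has positive real part; so \<open>\<alpha>\<^sub>0\<^bsup>-z\<^esup> D(z)\<close> is periodic of type less than \<open>2\<pi>\<close>, hence
  constant. The \<open>k\<close>-th Taylor coefficient at \<open>0\<close> of the Newton polynomial \<open>\<Prod>\<^bsub>n<m\<^esub> (1 - z/n)\<close> is, up to sign,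
  the harmonic sum of \<open>y\<^sub>1\<^sup>k\<close>, so comparing Taylor coefficients gives the theorem.
\<close>

section \<open>Linear functionals on the free algebra\<close>

definition lext :: "(letter list \<Rightarrow> complex) \<Rightarrow> qpoly \<Rightarrow> complex" where
  "lext f P = (\<Sum>w\<in>{w. P w \<noteq> 0}. of_rat (P w) * f w)"

text \<open>The passage between words and index lists and the convergence statements hold only on
  certain sets of words, so each polynomial is carried along with a set containing its
  support.\<close>

definition supported :: "letter list set \<Rightarrow> qpoly \<Rightarrow> bool" where
  "supported A P \<longleftrightarrow> fsupp P \<and> {w. P w \<noteq> 0} \<subseteq> A"

lemma Lsh_eq_lext: "Lsh = lext Lsh_word"
  by (simp add: fun_eq_iff Lsh_def lext_def)

lemma supported_mono: "supported A P \<Longrightarrow> A \<subseteq> B \<Longrightarrow> supported B P"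
  by (auto simp: supported_def)

lemma supported_imp_fsupp: "supported A P \<Longrightarrow> fsupp P"
  by (simp add: supported_def)

lemma supported_UNIV [simp]: "supported UNIV P \<longleftrightarrow> fsupp P"
  by (simp add: supported_def)

lemma supported_mon [intro]: "w \<in> A \<Longrightarrow> supported A (mon w)"
  by (auto simp: supported_def fsupp_def mon_def split: if_splits)

lemma supported_padd [intro]: "supported A P \<Longrightarrow> supported A Q \<Longrightarrow> supported A (padd P Q)"
proof -
  assume "supported A P" "supported A Q"
  moreover have "{w. padd P Q w \<noteq> 0} \<subseteq> {w. P w \<noteq> 0} \<union> {w. Q w \<noteq> 0}"
    by (auto simp: padd_def)
  ultimately show ?thesis
    unfolding supported_def fsupp_def by (meson Un_least finite_UnI finite_subset order_trans)
qed

lemma supported_psmult [intro]: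
  assumes "c \<noteq> 0 \<Longrightarrow> supported A P"
  shows "supported A (psmult c P)"
  using assms by (cases "c = 0") (auto simp: supported_def fsupp_def psmult_def)

lemma supp_lin_subset: "{u. lin g P u \<noteq> 0} \<subseteq> (\<Union>w\<in>{w. P w \<noteq> 0}. {u. g w u \<noteq> 0})"
proof
  fix u assume "u \<in> {u. lin g P u \<noteq> 0}"
  then have "(\<Sum>w\<in>{w. P w \<noteq> 0}. P w * g w u) \<noteq> 0"
    by (simp add: lin_def)
  then obtain w where "w \<in> {w. P w \<noteq> 0}" "P w * g w u \<noteq> 0"
    by (rule sum.not_neutral_contains_not_neutral)
  then show "u \<in> (\<Union>w\<in>{w. P w \<noteq> 0}. {u. g w u \<noteq> 0})" by auto
qed

lemma supported_lin [intro]: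
  assumes "supported A P" "\<And>w. w \<in> A \<Longrightarrow> supported B (g w)"
  shows "supported B (lin g P)"
proof -
  have "finite (\<Union>w\<in>{w. P w \<noteq> 0}. {u. g w u \<noteq> 0})"
    using assms by (auto simp: supported_def fsupp_def)
  moreover have "(\<Union>w\<in>{w. P w \<noteq> 0}. {u. g w u \<noteq> 0}) \<subseteq> B"
    using assms by (auto simp: supported_def)
  ultimately show ?thesis
    using supp_lin_subset[of g P] unfolding supported_def fsupp_def
    by (meson finite_subset order_trans)
qed

lemma supported_pmul [intro]:
  assumes "supported A P" "supported B Q" "\<And>a b. a \<in> A \<Longrightarrow> b \<in> B \<Longrightarrow> a @ b \<in> C"
  shows "supported C (pmul P Q)"
  unfolding pmul_def using assms by (blast intro: supported_lin supported_mon)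

lemma lext_superset:
  assumes "finite B" "{w. P w \<noteq> 0} \<subseteq> B"
  shows "lext f P = (\<Sum>w\<in>B. of_rat (P w) * f w)"
  unfolding lext_def using assms by (intro sum.mono_neutral_left) auto

lemma lext_cong:
  assumes "supported A P" "\<And>w. w \<in> A \<Longrightarrow> f w = g w"
  shows "lext f P = lext g P"
  unfolding lext_def using assms by (intro sum.cong) (auto simp: supported_def)

lemma lext_mon [simp]: "lext f (mon w) = f w"
  by (subst lext_superset[of "{w}"]) (auto simp: mon_def)

lemma lext_0 [simp]: "lext f (\<lambda>_. 0) = 0"
  by (simp add: lext_def)

lemma lext_const_0 [simp]: "lext (\<lambda>_. 0) P = 0"
  by (simp add: lext_def)

lemma lext_padd:
  assumes "fsupp P" "fsupp Q"
  shows "lext f (padd P Q) = lext f P + lext f Q"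
proof -
  let ?B = "{w. P w \<noteq> 0} \<union> {w. Q w \<noteq> 0}"
  have B: "finite ?B" using assms by (auto simp: fsupp_def)
  have "lext f (padd P Q) = (\<Sum>w\<in>?B. of_rat (padd P Q w) * f w)"
    by (intro lext_superset B) (auto simp: padd_def)
  also have "\<dots> = (\<Sum>w\<in>?B. of_rat (P w) * f w) + (\<Sum>w\<in>?B. of_rat (Q w) * f w)"
    by (simp add: padd_def of_rat_add distrib_right sum.distrib)
  also have "\<dots> = lext f P + lext f Q"
    using lext_superset[OF B, of P f] lext_superset[OF B, of Q f] by simp
  finally show ?thesis .
qed

lemma lext_psmult [simp]: "lext f (psmult c P) = of_rat c * lext f P"
proof (cases "c = 0")
  case False
  then show ?thesis
    by (simp add: lext_def psmult_def of_rat_mult sum_distrib_left mult.assoc)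
qed (simp add: lext_def psmult_def)

text \<open>A functional is pulled back through a linear operator; repeated use reduces the nested
  operators of the theorem to a function on single words. The finite union of the supports of the
  \<open>g w\<close> serves as common index set, so cancellation in \<open>lin g P\<close> does no
  harm and the two sums can be exchanged.\<close>

lemma lext_lin:
  assumes "supported A P" "\<And>w. w \<in> A \<Longrightarrow> fsupp (g w)"
  shows "lext f (lin g P) = lext (\<lambda>w. lext f (g w)) P"
proof -
  let ?S = "{w. P w \<noteq> 0}"
  let ?B = "\<Union>w\<in>?S. {u. g w u \<noteq> 0}"
  have fin: "finite ?S" "finite ?B"
    using assms by (auto simp: supported_def fsupp_def)
  have "lext f (lin g P) = (\<Sum>u\<in>?B. of_rat (lin g P u) * f u)"
    by (intro lext_superset fin supp_lin_subset)
  also have "\<dots> = (\<Sum>u\<in>?B. \<Sum>w\<in>?S. of_rat (P w) * (of_rat (g w u) * f u))"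
    by (simp add: lin_def of_rat_sum of_rat_mult sum_distrib_right mult.assoc)
  also have "\<dots> = (\<Sum>w\<in>?S. \<Sum>u\<in>?B. of_rat (P w) * (of_rat (g w u) * f u))"
    by (rule sum.swap)
  also have "\<dots> = (\<Sum>w\<in>?S. of_rat (P w) * lext f (g w))"
    by (intro sum.cong refl, subst lext_superset[OF fin(2)]) (auto simp: sum_distrib_left)
  finally show ?thesis by (simp add: lext_def)
qed

lemma lext_pmul:
  assumes "fsupp P" "fsupp Q"
  shows "lext f (pmul P Q) = lext (\<lambda>a. lext (\<lambda>b. f (a @ b)) Q) P"
proof -
  have Q: "fsupp (lin (\<lambda>b. mon (a @ b)) Q)" for a
    using supported_lin[of UNIV Q UNIV] assms(2) by (auto simp flip: supported_UNIV)
  show ?thesis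
    unfolding pmul_def using assms Q
    by (subst lext_lin[of UNIV]; simp)
       (subst lext_lin[of UNIV]; auto intro!: supported_imp_fsupp)
qed

lemma lext_sum: "lext (\<lambda>w. \<Sum>i\<in>I. f i w) P = (\<Sum>i\<in>I. lext (f i) P)"
  unfolding lext_def by (simp add: sum_distrib_left) (rule sum.swap)

lemma lext_cmult: "lext (\<lambda>w. c * f w) P = c * lext f P"
  by (simp add: lext_def sum_distrib_left mult.left_commute)

lemma lext_cmult_right: "lext (\<lambda>w. f w * c) P = lext f P * c"
  by (simp add: lext_def sum_distrib_right mult.assoc)

lemma lext_cdivide: "lext (\<lambda>w. f w / c) P = lext f P / c"
  using lext_cmult_right[of f "1 / c" P] by simp

lemma lext_add: "lext (\<lambda>w. f w + g w) P = lext f P + lext g P"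
  by (simp add: lext_def distrib_left sum.distrib)

lemma tendsto_lext:
  assumes "supported A P" "\<And>w. w \<in> A \<Longrightarrow> (\<lambda>M. f M w) \<longlonglongrightarrow> g w"
  shows "(\<lambda>M. lext (f M) P) \<longlonglongrightarrow> lext g P"
  unfolding lext_def using assms
  by (intro tendsto_sum tendsto_mult tendsto_const) (auto simp: supported_def)

section \<open>Words and lists of indices\<close>

text \<open>The analysis uses only the absolute value of the characters, so the unit circle replaces
  the roots of unity. The bound \<open>1 \<le> k\<close> makes \<open>zword\<close> injective:
  truncated subtraction sends the indices 0 and 1 to the same word.\<close>

definition zlists :: "(nat \<times> complex) list set" where
  "zlists = {zs. \<forall>(k, c) \<in> set zs. 1 \<le> k \<and> norm c = 1}"

definition ywords :: "letter list set" where
  "ywords = {u. (u = [] \<or> last u \<noteq> X) \<and> (\<forall>c. Y c \<in> set u \<longrightarrow> norm c = 1)}"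

lemma zlists_simps [simp]:
  "[] \<in> zlists"
  "(k, c) # zs \<in> zlists \<longleftrightarrow> 1 \<le> k \<and> norm c = 1 \<and> zs \<in> zlists"
  by (auto simp: zlists_def)

lemma ywords_Nil [simp]: "[] \<in> ywords"
  by (simp add: ywords_def)

lemma ywords_Y [simp]: "Y c # u \<in> ywords \<longleftrightarrow> norm c = 1 \<and> u \<in> ywords"
  by (auto simp: ywords_def)

lemma ywords_X [simp]: "X # u \<in> ywords \<longleftrightarrow> u \<noteq> [] \<and> u \<in> ywords"
  by (auto simp: ywords_def)

lemma ywords_induct [consumes 1, case_names Nil X Y]:
  assumes "u \<in> ywords" "P []"
    and "\<And>u. u \<in> ywords \<Longrightarrow> u \<noteq> [] \<Longrightarrow> P u \<Longrightarrow> P (X # u)"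
    and "\<And>c u. u \<in> ywords \<Longrightarrow> norm c = 1 \<Longrightarrow> P u \<Longrightarrow> P (Y c # u)"
  shows "P u"
  using assms(1)
proof (induction u)
  case (Cons a u)
  then show ?case by (cases a) (use assms in auto)
qed (simp add: assms)

lemma zparse_aux_replicate: "zparse_aux k (replicate n X @ w) = zparse_aux (k + n) w"
  by (induction n arbitrary: k) auto

lemma zparse_zword [simp]: "zs \<in> zlists \<Longrightarrow> zparse (zword zs) = zs"
proof (induction zs)
  case (Cons p zs)
  then show ?case
    by (cases p) (auto simp: zparse_def zparse_aux_replicate)
qed (simp add: zparse_def)

lemma zparse_aux_in_zlists: "u \<in> ywords \<Longrightarrow> zparse_aux k u \<in> zlists"
  by (induction arbitrary: k rule: ywords_induct) auto

lemma zparse_in_zlists [simp]: "u \<in> ywords \<Longrightarrow> zparse u \<in> zlists"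
  by (simp add: zparse_def zparse_aux_in_zlists)

text \<open>The accumulator counts letters \<open>X\<close> already read. They reappear only when
  some \<open>Y c\<close> closes the block, whence the restriction to nonempty words.\<close>

lemma zword_zparse_aux:
  "u \<in> ywords \<Longrightarrow> u \<noteq> [] \<Longrightarrow> zword (zparse_aux k u) = replicate k X @ u"
proof (induction arbitrary: k rule: ywords_induct)
  case (X u)
  then show ?case by (simp add: replicate_append_same flip: replicate_Suc)
next
  case (Y c u)
  then show ?case by (cases "u = []") auto
qed auto

lemma zword_zparse [simp]: "u \<in> ywords \<Longrightarrow> zword (zparse u) = u"
  using zword_zparse_aux[of u 0] by (cases "u = []") (auto simp: zparse_def)

lemma zword_in_ywords [simp]: "zs \<in> zlists \<Longrightarrow> zword zs \<in> ywords"
proof (induction zs)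
  case (Cons p zs)
  have "replicate n X @ Y c # u \<in> ywords" if "norm c = 1" "u \<in> ywords" for n c u
    using that by (induction n) auto
  with Cons show ?case by (cases p) auto
qed simp

lemma zword_eq_Nil_iff [simp]: "zword zs = [] \<longleftrightarrow> zs = []"
  by (cases zs rule: zword.cases) auto

lemma tailx_ywords [simp]: "u \<in> ywords \<Longrightarrow> tailx u = 0"
  by (cases u rule: rev_cases) (auto simp: tailx_def ywords_def)

lemma zparse_replicate_Y: "zparse (replicate n (Y 1)) = replicate n (1, 1)"
proof -
  have "zparse_aux 0 (replicate n (Y 1)) = replicate n (1, 1)" by (induction n) auto
  then show ?thesis by (simp add: zparse_def)
qed

lemma Iz_in_zlists [simp]: "zs \<in> zlists \<Longrightarrow> norm a = 1 \<Longrightarrow> Iz a zs \<in> zlists"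
  by (induction a zs rule: Iz.induct) (auto simp: norm_mult)

lemma Iinvz_in_zlists [simp]: "zs \<in> zlists \<Longrightarrow> norm a = 1 \<Longrightarrow> Iinvz a zs \<in> zlists"
  by (induction a zs rule: Iinvz.induct) (auto simp: norm_divide)

lemma Mz_in_zlists [simp]: "zs \<in> zlists \<Longrightarrow> norm a = 1 \<Longrightarrow> Mz a zs \<in> zlists"
  by (induction a zs rule: Mz.induct) (auto simp: norm_mult)

lemma Iz_Iinvz: "zs \<in> zlists \<Longrightarrow> norm a = 1 \<Longrightarrow> Iz a (Iinvz a zs) = zs"
proof (induction a zs rule: Iinvz.induct)
  case (2 a k s r)
  then have "a \<noteq> 0" by auto
  with 2 show ?case by auto
qed simp

lemma Iz_Mz: "Iz 1 (Mz s zs) = Iz s zs"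
  by (cases zs) auto

lemma Iz_eq_Nil_iff [simp]: "Iz a zs = [] \<longleftrightarrow> zs = []"
  by (cases zs) auto

lemma replicate_1_in_zlists [simp]: "replicate n (1, 1) \<in> zlists"
  by (auto simp: zlists_def)

section \<open>Harmonic products and truncated harmonic sums\<close>

fun hsum :: "(nat \<times> complex) list \<Rightarrow> nat \<Rightarrow> complex" where
  "hsum [] m = 1"
| "hsum ((k, s) # zs) m = (\<Sum>j=1..<m. s ^ j / of_nat j ^ k * hsum zs j)"

lemma zword_Cons_append: "zword [p] @ zword zs = zword (p # zs)"
  by (cases p) auto

text \<open>Two instances of the closed set \<open>A\<close> are wanted later: all characters of
  absolute value 1, and the character 1 alone.\<close>

lemma supported_harmz_closed:
  assumes A: "\<And>k s l t. (k, s) \<in> A \<Longrightarrow> (l, t) \<in> A \<Longrightarrow> (k + l, s * t) \<in> A"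
    and "set u \<subseteq> A" "set v \<subseteq> A"
  shows "supported (zword ` {q. set q \<subseteq> A \<and> (q \<noteq> [] \<or> u = [] \<and> v = [])}) (harmz u v)"
  using assms(2,3)
proof (induction u v rule: harmz.induct)
  case (3 k s u l t v)
  have *: "supported (zword ` {q. set q \<subseteq> A \<and> q \<noteq> []}) (pmul (mon (zword [p])) Q)"
    if "supported B Q" "p \<in> A" "B \<subseteq> zword ` {q. set q \<subseteq> A}" for p Q B
  proof -
    have "supported {zword [p]} (mon (zword [p]))" by auto
    then show ?thesis
    proof (rule supported_pmul[OF _ that(1)])
      fix a b assume "a \<in> {zword [p]}" "b \<in> B"
      with that(3) obtain q where "a @ b = zword (p # q)" "set q \<subseteq> A"
        by (auto simp: zword_Cons_append simp del: zword.simps)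
      with that(2) show "a @ b \<in> zword ` {q. set q \<subseteq> A \<and> q \<noteq> []}"
        by (auto simp del: zword.simps)
    qed
  qed
  have "(k, s) \<in> A" "(l, t) \<in> A" "(k + l, s * t) \<in> A" "set u \<subseteq> A" "set v \<subseteq> A"
    using 3 A by auto
  with 3 show ?case
    by (auto simp del: zword.simps intro!: supported_padd intro: *)
qed (auto simp del: zword.simps)

lemma zlists_eq: "zlists = {zs. set zs \<subseteq> {(k, c). 1 \<le> k \<and> norm c = 1}}"
  by (auto simp: zlists_def)

lemma supported_harmz:
  assumes "u \<in> zlists" "v \<in> zlists"
  shows "supported (zword ` {q \<in> zlists. q \<noteq> [] \<or> u = [] \<and> v = []}) (harmz u v)"
  using assms supported_harmz_closed[of "{(k, c). 1 \<le> k \<and> norm c = 1}" u v]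
  by (simp add: zlists_eq norm_mult)

lemma fsupp_harmz [simp]: "u \<in> zlists \<Longrightarrow> v \<in> zlists \<Longrightarrow> fsupp (harmz u v)"
  using supported_harmz supported_imp_fsupp by blast

lemma fsupp_mon [simp]: "fsupp (mon w)"
  using supported_mon[of w UNIV] by simp

lemma fsupp_padd [simp]: "fsupp P \<Longrightarrow> fsupp Q \<Longrightarrow> fsupp (padd P Q)"
  using supported_padd[of UNIV P Q] by simp

lemma fsupp_psmult [simp]: "fsupp P \<Longrightarrow> fsupp (psmult c P)"
  using supported_psmult[of c UNIV P] by simp

lemma fsupp_pmul [simp]: "fsupp P \<Longrightarrow> fsupp Q \<Longrightarrow> fsupp (pmul P Q)"
  using supported_pmul[of UNIV P UNIV Q UNIV] by simp

lemma lext_harmz_Cons: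
  assumes "(k, s) # u \<in> zlists" "(l, t) # v \<in> zlists"
  shows "lext (\<lambda>w. f (zparse w)) (harmz ((k, s) # u) ((l, t) # v)) =
    lext (\<lambda>w. f ((k, s) # zparse w)) (harmz u ((l, t) # v)) +
    lext (\<lambda>w. f ((l, t) # zparse w)) (harmz ((k, s) # u) v) +
    lext (\<lambda>w. f ((k + l, s * t) # zparse w)) (harmz u v)"
proof -
  have *: "lext (\<lambda>w. f (zparse w)) (pmul (mon (zword [p])) (harmz u' v')) =
      lext (\<lambda>w. f (p # zparse w)) (harmz u' v')"
    if "u' \<in> zlists" "v' \<in> zlists" "[p] \<in> zlists" for u' v' p
  proof -
    have "lext (\<lambda>w. f (zparse w)) (pmul (mon (zword [p])) (harmz u' v')) =
        lext (\<lambda>b. f (zparse (zword [p] @ b))) (harmz u' v')"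
      using that by (simp add: lext_pmul)
    also have "\<dots> = lext (\<lambda>w. f (p # zparse w)) (harmz u' v')"
    proof (rule lext_cong[OF supported_harmz[OF that(1,2)]])
      fix w assume "w \<in> zword ` {q \<in> zlists. q \<noteq> [] \<or> u' = [] \<and> v' = []}"
      then obtain q where q: "w = zword q" "q \<in> zlists" by auto
      moreover from this have "p # q \<in> zlists" using that(3) by (cases p) auto
      ultimately show "f (zparse (zword [p] @ w)) = f (p # zparse w)"
        by (simp add: zword_Cons_append del: zword.simps)
    qed
    finally show ?thesis .
  qed
  have "[(k, s)] \<in> zlists" "[(l, t)] \<in> zlists" "[(k + l, s * t)] \<in> zlists"
    using assms by (auto simp: norm_mult)
  with assms show ?thesis
    by (simp add: lext_padd * del: zword.simps)
qed

text \<open>Raising the cutoff from m to m + 1 adds the terms whose largest index is m. In a product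
  of two sums this index comes from the first word, from the second, or from both, which are the
  three summands of \<open>harmz\<close>.\<close>

lemma lext_hsum_harmz:
  "u \<in> zlists \<Longrightarrow> v \<in> zlists \<Longrightarrow> lext (\<lambda>w. hsum (zparse w) m) (harmz u v) = hsum u m * hsum v m"
proof (induction m arbitrary: u v)
  case 0
  show ?case
  proof (cases "u = [] \<or> v = []")
    case True
    then show ?thesis using 0 by (cases u) (auto simp del: zword.simps)
  next
    case False
    then obtain k s u' l t v' where "u = (k, s) # u'" "v = (l, t) # v'"
      by (metis list.exhaust surj_pair)
    with 0 show ?thesis by (simp add: lext_harmz_Cons[where f = "\<lambda>q. hsum q 0"] del: harmz.simps)
  qed
next
  case (Suc m)
  show ?case
  proof (cases "u = [] \<or> v = []")
    case True
    then show ?thesis using Suc by (cases u) (auto simp del: zword.simps)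
  next
    case False
    then obtain k s u' l t v' where uv: "u = (k, s) # u'" "v = (l, t) # v'"
      by (metis list.exhaust surj_pair)
    \<comment> \<open>Summation starts at 1, so raising the cutoff from 0 to 1 adds nothing.\<close>
    have step: "hsum (p # q) (Suc m) = hsum (p # q) m +
       (if m = 0 then 0 else snd p ^ m / of_nat m ^ fst p * hsum q m)" for p q
      by (cases p) (auto simp: sum.atLeastLessThan_Suc)
    have sub: "u' \<in> zlists" "v' \<in> zlists" using Suc.prems uv by auto
    note IH = Suc.IH[OF sub(1) Suc.prems(2)] Suc.IH[OF Suc.prems(1) sub(2)] Suc.IH[OF sub]
      Suc.IH[OF Suc.prems]
    have "lext (\<lambda>w. hsum (zparse w) (Suc m)) (harmz u v) =
       lext (\<lambda>w. hsum (zparse w) m) (harmz u v) + (if m = 0 then 0 else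
       s ^ m / of_nat m ^ k * (hsum u' m * hsum v m) +
       t ^ m / of_nat m ^ l * (hsum u m * hsum v' m) +
       (s * t) ^ m / of_nat m ^ (k + l) * (hsum u' m * hsum v' m))"
      using Suc.prems IH(1-3) unfolding uv
      by (simp add: lext_harmz_Cons[where f = "\<lambda>q. hsum q (Suc m)"]
          lext_harmz_Cons[where f = "\<lambda>q. hsum q m"] step lext_add lext_cmult lext_cdivide
          del: hsum.simps harmz.simps)
    also have "\<dots> = hsum u (Suc m) * hsum v (Suc m)"
      unfolding IH(4) unfolding uv step
      by (auto simp: algebra_simps power_add power_mult_distrib simp del: hsum.simps)
    finally show ?thesis .
  qed
qed

section \<open>Taylor coefficients of iterated integrals\<close>

text \<open>The coefficient of \<open>t\<^sup>m\<close> in the iterated integral of a word from \<open>0\<close> to \<open>t\<close>, where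
  \<open>x = dt/t\<close> and \<open>y\<^sub>c = c dt/(1 - c t)\<close>. At \<open>m = 0\<close> the junk value of the division is the
  right one for nonempty words.\<close>

fun icoeff :: "letter list \<Rightarrow> nat \<Rightarrow> complex" where
  "icoeff [] m = (if m = 0 then 1 else 0)"
| "icoeff (X # u) m = icoeff u m / of_nat m"
| "icoeff (Y c # u) m = (\<Sum>j<m. c ^ (m - j) * icoeff u j) / of_nat m"

lemma icoeff_0 [simp]: "u \<noteq> [] \<Longrightarrow> icoeff u 0 = 0"
proof (cases u)
  case (Cons a v)
  then show ?thesis by (cases a) auto
qed simp

lemma icoeff_zword_Cons:
  assumes "1 \<le> k"
  shows "icoeff (zword ((k, c) # zs)) m =
    (\<Sum>j<m. c ^ (m - j) * icoeff (zword zs) j) / of_nat m ^ k"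
proof -
  have "icoeff (replicate n X @ u) m = icoeff u m / of_nat m ^ n" for n u
    by (induction n) auto
  moreover obtain k' where "k = Suc k'" using assms by (cases k) auto
  ultimately show ?thesis by simp
qed

text \<open>Along m > m_2 > m_3 > ... the iterated integral carries powers of the cumulative
  products with exponents m - m_2, m_2 - m_3, and so on. These telescope to (a s)^m times the
  individual characters raised to m_2, m_3, ..., so \<open>Iz\<close> converts harmonic type into
  shuffle type.\<close>

lemma icoeff_zword_Iz:
  assumes "(k, s) # zs \<in> zlists" "norm a = 1" "m > 0"
  shows "icoeff (zword (Iz a ((k, s) # zs))) m = (a * s) ^ m / of_nat m ^ k * hsum zs m"
  using assms
proof (induction zs arbitrary: k s a m)
  case Nil
  have "(\<Sum>j<m. (a * s) ^ (m - j) * icoeff [] j) = (\<Sum>j\<in>{0}. (a * s) ^ (m - j) * icoeff [] j)"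
    using Nil by (intro sum.mono_neutral_right) auto
  with Nil show ?case by (simp add: icoeff_zword_Cons del: zword.simps(2))
next
  case (Cons p zs)
  obtain l t where p: "p = (l, t)" by (cases p)
  have as: "norm (a * s) = 1" using Cons.prems by (simp add: norm_mult)
  have "(\<Sum>j<m. (a * s) ^ (m - j) * icoeff (zword (Iz (a * s) (p # zs))) j) =
      (\<Sum>j=1..<m. (a * s) ^ (m - j) * icoeff (zword (Iz (a * s) (p # zs))) j)"
    by (intro sum.mono_neutral_right) (auto simp: p not_less_eq_eq simp del: zword.simps)
  also have "\<dots> = (\<Sum>j=1..<m. (a * s) ^ m * (t ^ j / of_nat j ^ l * hsum zs j))"
  proof (rule sum.cong)
    fix j assume j: "j \<in> {1..<m}"
    have "icoeff (zword (Iz (a * s) (p # zs))) j = (a * s * t) ^ j / of_nat j ^ l * hsum zs j"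
      unfolding p by (rule Cons.IH) (use Cons.prems as p j in auto)
    moreover have "(a * s) ^ m = (a * s) ^ (m - j) * (a * s) ^ j"
      using j by (simp flip: power_add)
    ultimately show "(a * s) ^ (m - j) * icoeff (zword (Iz (a * s) (p # zs))) j =
        (a * s) ^ m * (t ^ j / of_nat j ^ l * hsum zs j)"
      by (simp add: power_mult_distrib)
  qed simp
  finally show ?case
    using Cons.prems by (simp add: icoeff_zword_Cons p sum_distrib_left sum_divide_distrib mult_ac del: zword.simps)
qed

lemma finite_dec_lists: "finite {ms. length ms = n \<and> sorted_wrt (>) ms \<and> (\<forall>m\<in>set ms. 0 < m \<and> m < (M::nat))}"
  by (rule finite_subset[OF _ finite_lists_length_eq[of "{..<M}" n]]) auto

text \<open>The weight \<open>g\<close> on the largest index makes the induction run: once the head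
  is split off, \<open>c ^ (m - j)\<close> is the weight for the tail. The default 0 in
  \<open>hd (ms @ [0])\<close> agrees with the last exponent being m_n itself.\<close>

lemma sum_dec_lists:
  assumes "\<forall>(k, c)\<in>set zs. 1 \<le> k" "M > 0"
  shows "(\<Sum>ms\<in>{ms. length ms = length zs \<and> sorted_wrt (>) ms \<and> (\<forall>m\<in>set ms. 0 < m \<and> m < M)}.
        g (hd (ms @ [0])) * (\<Prod>i<length zs. (snd (zs ! i)) ^ (ms ! i - (ms @ [0]) ! Suc i)
                        / of_nat (ms ! i) ^ (fst (zs ! i)))) =
     (\<Sum>j<M. g j * icoeff (zword zs) j)"
  using assms
proof (induction zs arbitrary: M g)
  case Nil
  have "(\<Sum>j<M. g j * icoeff [] j) = (\<Sum>j\<in>{0}. g j * icoeff [] j)"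
    using Nil by (intro sum.mono_neutral_right) auto
  moreover have "{ms. length ms = length [] \<and> sorted_wrt (>) ms \<and> (\<forall>m\<in>set ms. 0 < m \<and> m < M)} = {[]}"
    by auto
  ultimately show ?case by simp
next
  case (Cons p zs)
  obtain k c where p: "p = (k, c)" by (cases p)
  let ?T = "\<lambda>n M. {ms. length ms = n \<and> sorted_wrt (>) ms \<and> (\<forall>m\<in>set ms. 0 < m \<and> m < (M::nat))}"
  let ?P = "\<lambda>zs ms. \<Prod>i<length zs. (snd (zs ! i)) ^ (ms ! i - (ms @ [0]) ! Suc i)
                        / of_nat (ms ! i) ^ (fst (zs ! i)) :: complex"
  have T: "?T (length (p # zs)) M = (\<lambda>(m, ms). m # ms) ` (SIGMA m:{1..<M}. ?T (length zs) m)"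
    by (auto simp: length_Suc_conv image_iff; fastforce)
  have inj: "inj_on (\<lambda>(m, ms). m # ms) (SIGMA m:{1..<M}. ?T (length zs) m)"
    by (auto simp: inj_on_def)
  have P: "?P (p # zs) (m # ms) = c ^ (m - hd (ms @ [0])) / of_nat m ^ k * ?P zs ms" for m ms
  proof -
    have "(ms @ [0]) ! 0 = hd (ms @ [0])" by (cases ms) auto
    then show ?thesis by (simp add: prod.lessThan_Suc_shift p del: prod.lessThan_Suc)
  qed
  have "(\<Sum>ms\<in>?T (length (p # zs)) M. g (hd (ms @ [0])) * ?P (p # zs) ms) =
     (\<Sum>(m, ms)\<in>(SIGMA m:{1..<M}. ?T (length zs) m). g m * ?P (p # zs) (m # ms))"
    unfolding T sum.reindex[OF inj] by (simp add: case_prod_beta comp_def)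
  also have "\<dots> = (\<Sum>m=1..<M. \<Sum>ms\<in>?T (length zs) m. g m * ?P (p # zs) (m # ms))"
    by (subst sum.Sigma) (auto simp: finite_dec_lists)
  also have "\<dots> = (\<Sum>m=1..<M. g m / of_nat m ^ k *
      (\<Sum>ms\<in>?T (length zs) m. c ^ (m - hd (ms @ [0])) * ?P zs ms))"
    by (simp only: P sum_distrib_left) (simp add: mult_ac)
  also have "\<dots> = (\<Sum>m=1..<M. g m / of_nat m ^ k * (\<Sum>j<m. c ^ (m - j) * icoeff (zword zs) j))"
    using Cons.prems
    by (intro sum.cong refl arg_cong2[where f = "(*)"] Cons.IH[where g = "\<lambda>j. c ^ (_ - j)"]) auto
  also have "\<dots> = (\<Sum>m=1..<M. g m * icoeff (zword (p # zs)) m)"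
    using Cons.prems by (simp add: p icoeff_zword_Cons del: zword.simps)
  also have "\<dots> = (\<Sum>m<M. g m * icoeff (zword (p # zs)) m)"
    by (intro sum.mono_neutral_left) (auto simp: p not_less_eq_eq simp del: zword.simps)
  finally show ?case .
qed

lemma mlv_partial_eq_sum_icoeff:
  assumes "u \<in> ywords" "M > 0"
  shows "mlv_partial (zparse u) M = (\<Sum>m<M. icoeff u m)"
proof -
  have "\<forall>(k, c)\<in>set (zparse u). 1 \<le> k"
    using zparse_in_zlists[OF assms(1)] by (auto simp: zlists_def)
  from sum_dec_lists[OF this assms(2), of "\<lambda>_. 1"] assms(1) show ?thesis
    by (simp add: mlv_partial_def)
qed

lemma Lsh_word_tendsto:
  assumes "u \<in> ywords" "u \<noteq> []" "(\<lambda>M. \<Sum>m<M. icoeff u m) \<longlonglongrightarrow> l"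
  shows "Lsh_word u = l"
proof -
  have "mlv_partial (zparse u) \<longlonglongrightarrow> l"
    by (rule Lim_transform_eventually[OF assms(3)])
       (use assms(1) in \<open>auto intro!: eventually_mono[OF eventually_gt_at_top[of 0]]
          simp: mlv_partial_eq_sum_icoeff\<close>)
  then show ?thesis using assms by (simp add: Lsh_word_def limI)
qed

section \<open>Newton series\<close>

text \<open>Up to the sign (-1)^n this is the binomial coefficient of z - 1 over n.\<close>

definition newt :: "nat \<Rightarrow> complex \<Rightarrow> complex" where
  "newt n z = (\<Prod>k=1..n. 1 - z / of_nat k)"

text \<open>The coefficient of t^m is paired with the polynomial of degree m - 1; the constant term
  is dropped.\<close>

definition nseries :: "(nat \<Rightarrow> complex) \<Rightarrow> complex \<Rightarrow> complex" where
  "nseries a z = (\<Sum>n. a (Suc n) * newt n z)"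

lemma newt_0 [simp]: "newt 0 z = 1"
  by (simp add: newt_def)

lemma newt_Suc: "newt (Suc n) z = newt n z * (1 - z / of_nat (Suc n))"
  by (simp add: newt_def prod.nat_ivl_Suc')

lemma newt_Suc_plus_1: "newt (Suc n) (z + 1) = - z * newt n z / of_nat (Suc n)"
proof (induction n)
  case 0
  show ?case by (simp add: newt_Suc)
next
  case (Suc n)
  have nz: "of_nat (Suc n) \<noteq> (0::complex)" "of_nat (Suc (Suc n)) \<noteq> (0::complex)"
    by (simp_all del: of_nat_Suc)
  have e: "of_nat (Suc (Suc n)) = of_nat (Suc n) + (1::complex)" by simp
  show ?case
    unfolding newt_Suc[of "Suc n" "z + 1"] Suc.IH unfolding newt_Suc[of n z]
    using nz unfolding e by (simp add: divide_simps del: of_nat_Suc)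
qed

lemma newt_pascal: "newt (Suc n) (z + 1) = newt (Suc n) z - newt n z"
  unfolding newt_Suc_plus_1 newt_Suc[of n z] by (simp add: algebra_simps)

lemma newt_1: "newt n 1 = (if n = 0 then 1 else 0)"
  by (cases n) (use newt_Suc_plus_1[of _ 0] in auto)

lemma holomorphic_newt [holomorphic_intros]: "newt n holomorphic_on A"
  unfolding newt_def by (intro holomorphic_intros) auto

section \<open>Growth of the Newton polynomials\<close>

lemma sum_inverse_squares_le: "(\<Sum>k=1..n. 1 / real k ^ 2) \<le> 2 - 1 / real n"
proof (induction n)
  case (Suc n)
  show ?case
  proof (cases "n = 0")
    case False
    then have "1 / real (Suc n) ^ 2 \<le> 1 / real n - 1 / real (Suc n)"
      by (simp add: divide_simps power2_eq_square)
    with Suc show ?thesis by simp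
  qed simp
qed simp

text \<open>Use |1 - z/k|^2 = 1 - 2 Re z / k + |z|^2 / k^2 and 1 + x <= exp x. The quadratic terms
  have a bounded sum and the linear ones give a harmonic number, so the size is about n^(-Re
  z).\<close>

lemma norm_newt_le_exp: "norm (newt n z) \<le> exp ((norm z)\<^sup>2 - Re z * harm n)"
proof -
  have fac: "norm (1 - z / of_nat k) \<le> exp ((norm z)\<^sup>2 / 2 * (1 / real k ^ 2) - Re z * inverse (real k))"
    if "k \<ge> 1" for k :: nat
  proof -
    have "(norm (1 - z / of_nat k))\<^sup>2 = 1 + 2 * ((norm z)\<^sup>2 / 2 * (1 / real k ^ 2) - Re z * inverse (real k))"
      using that by (simp add: cmod_power2) (simp add: field_simps power2_eq_square)
    also have "\<dots> \<le> exp (2 * ((norm z)\<^sup>2 / 2 * (1 / real k ^ 2) - Re z * inverse (real k)))"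
      by (rule exp_ge_add_one_self)
    also have "\<dots> = (exp ((norm z)\<^sup>2 / 2 * (1 / real k ^ 2) - Re z * inverse (real k)))\<^sup>2"
      by (simp flip: exp_double)
    finally show ?thesis by (rule power2_le_imp_le) simp
  qed
  have "norm (newt n z) = (\<Prod>k=1..n. norm (1 - z / of_nat k))"
    by (simp add: newt_def prod_norm)
  also have "\<dots> \<le> (\<Prod>k=1..n. exp ((norm z)\<^sup>2 / 2 * (1 / real k ^ 2) - Re z * inverse (real k)))"
    using fac by (intro prod_mono) auto
  also have "\<dots> = exp ((norm z)\<^sup>2 / 2 * (\<Sum>k=1..n. 1 / real k ^ 2) - Re z * harm n)"
    by (simp add: exp_sum[symmetric] sum_subtractf harm_def sum_distrib_left)
  also have "\<dots> \<le> exp ((norm z)\<^sup>2 - Re z * harm n)"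
  proof -
    have "(\<Sum>k=1..n. 1 / real k ^ 2) \<le> 2"
      using sum_inverse_squares_le[of n] by (smt (verit) divide_nonneg_nonneg of_nat_0_le_iff)
    from mult_left_mono[OF this, of "(norm z)\<^sup>2 / 2"] show ?thesis by simp
  qed
  finally show ?thesis .
qed

lemma harm_le_ln: "harm n \<le> 1 + ln (real n + 1)"
proof (cases n)
  case (Suc k)
  have "harm (Suc k) - ln (real (Suc k)) \<le> harm (Suc 0) - ln (real (Suc 0))"
    using decseqD[OF decseq_harm_diff_ln, of 0 k] by simp
  moreover have "ln (real (Suc k)) \<le> ln (real (Suc k) + 1)" by simp
  moreover have "harm (Suc 0) = (1::real)" by (simp add: harm_def)
  ultimately show ?thesis unfolding Suc by (simp only: ln_one of_nat_1 One_nat_def[symmetric])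
qed (simp add: harm_def)

text \<open>The half plane extends to the left of 0, so that Taylor coefficients can be taken at an
  interior point; the price is the growth n^(1/4).\<close>

lemma norm_newt_le_powr:
  assumes "Re z \<ge> -1/4" "norm z \<le> R"
  shows "norm (newt n z) \<le> exp (R\<^sup>2 + 1/4) * (real n + 1) powr (1/4)"
proof -
  have "(norm z)\<^sup>2 \<le> R\<^sup>2" using assms(2) by (intro power_mono) auto
  moreover have "- Re z * harm n \<le> 1/4 * harm n"
    using assms(1) harm_nonneg[of n, where 'a = real] by (intro mult_right_mono) auto
  moreover have "harm n \<le> 1 + ln (real n + 1)" by (rule harm_le_ln)
  ultimately have "(norm z)\<^sup>2 - Re z * harm n \<le> (R\<^sup>2 + 1/4) + 1/4 * ln (real n + 1)"
    by linarith
  then have "norm (newt n z) \<le> exp ((R\<^sup>2 + 1/4) + 1/4 * ln (real n + 1))"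
    using norm_newt_le_exp[of n z] by (meson exp_le_cancel_iff order_trans)
  also have "\<dots> = exp (R\<^sup>2 + 1/4) * (real n + 1) powr (1/4)"
    by (subst exp_add) (simp add: powr_def)
  finally show ?thesis .
qed

lemma norm_newt_le_inverse_square:
  assumes "Re z \<ge> 2"
  shows "norm (newt n z) \<le> exp ((norm z)\<^sup>2) / (real n + 1) ^ 2"
proof -
  have "2 * ln (real n + 1) \<le> 2 * harm n" using ln_le_harm[of n] by simp
  also have "\<dots> \<le> Re z * harm n"
    using assms harm_nonneg[of n, where 'a = real] by (intro mult_right_mono) auto
  finally have "norm (newt n z) \<le> exp ((norm z)\<^sup>2 - 2 * ln (real n + 1))"
    using norm_newt_le_exp[of n z] by (smt (verit) exp_le_cancel_iff)
  also have "\<dots> = exp ((norm z)\<^sup>2) / (real n + 1) ^ 2"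
    by (simp add: exp_diff exp_double)
  finally show ?thesis .
qed

text \<open>By Euler's sine product at i y, the partial products increase to sinh(pi y) / (pi y),
  which is at most exp(pi |y|).\<close>

lemma prod_one_plus_le_exp_pi: "(\<Prod>k=1..n. 1 + y\<^sup>2 / real k ^ 2) \<le> exp (pi * \<bar>y\<bar>)"
proof (cases "y = 0")
  case False
  define t where "t = pi * \<bar>y\<bar>"
  have t: "t > 0" using False by (simp add: t_def)
  let ?f = "\<lambda>n. \<Prod>k=1..n. 1 + y\<^sup>2 / real k ^ 2"
  have "(\<lambda>n. norm (of_real pi * (\<i> * of_real y) * (\<Prod>k=1..n. 1 - (\<i> * of_real y)^2 / of_nat k^2)))
      \<longlonglongrightarrow> norm (sin (of_real pi * (\<i> * of_real y)))"
    by (intro tendsto_norm sin_product_formula_complex)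
  moreover have "norm (of_real pi * (\<i> * of_real y) * (\<Prod>k=1..n. 1 - (\<i> * of_real y)^2 / of_nat k^2))
     = t * ?f n" for n
  proof -
    have "(\<Prod>k=1..n. 1 - (\<i> * of_real y)^2 / of_nat k^2) = complex_of_real (?f n)"
      by (simp add: power_mult_distrib)
    moreover have "?f n \<ge> 0" by (intro prod_nonneg) auto
    ultimately show ?thesis by (simp add: norm_mult t_def del: of_real_prod)
  qed
  ultimately have lim: "(\<lambda>n. t * ?f n) \<longlonglongrightarrow> norm (sin (of_real pi * (\<i> * of_real y)))"
    by simp
  have "incseq (\<lambda>n. t * ?f n)"
  proof (rule incseq_SucI)
    fix n
    have "?f n * 1 \<le> ?f n * (1 + y\<^sup>2 / real (Suc n) ^ 2)"
      by (intro mult_left_mono prod_nonneg) auto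
    then show "t * ?f n \<le> t * ?f (Suc n)"
      using t by (simp add: prod.nat_ivl_Suc')
  qed
  then have "t * ?f n \<le> norm (sin (of_real pi * (\<i> * of_real y)))"
    using lim by (rule incseq_le)
  also have "\<dots> \<le> t * exp t"
  proof -
    have "sin (of_real pi * (\<i> * of_real y)) =
        (exp (complex_of_real (- (pi * y))) - exp (complex_of_real (pi * y))) / (2 * \<i>)"
      by (simp add: sin_exp_eq mult_ac)
    then have "norm (sin (of_real pi * (\<i> * of_real y))) =
       norm (complex_of_real (exp (- (pi * y)) - exp (pi * y))) / 2"
      by (simp only: norm_divide exp_of_real of_real_diff[symmetric]) (simp add: norm_mult)
    also have "norm (complex_of_real (exp (- (pi * y)) - exp (pi * y))) = exp t - exp (- t)"
    proof (cases "y \<ge> 0")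
      case False
      then have "pi * y < 0" by (simp add: mult_pos_neg)
      with False show ?thesis unfolding norm_of_real t_def by simp
    qed (auto simp: t_def simp flip: of_real_diff)
    \<comment> \<open>This is 1 - 2 t <= exp(-2 t) multiplied by exp t.\<close>
    also have "(exp t - exp (-t)) / 2 \<le> t * exp t"
    proof -
      have "1 + (- 2 * t) \<le> exp (- 2 * t)" by (rule exp_ge_add_one_self)
      then have "exp t * (1 - 2 * t) \<le> exp t * exp (- 2 * t)"
        by (intro mult_left_mono) auto
      then show ?thesis by (simp add: algebra_simps flip: exp_add)
    qed
    finally show ?thesis .
  qed
  finally show ?thesis using t by (simp only: mult_le_cancel_left_pos t_def)
qed simp

text \<open>The factor exp(|z|^2) of \<open>norm_newt_le_inverse_square\<close> is too large on
  vertical lines. For k >= 4 each factor is at most (1 - 2/k) sqrt(1 + y^2/(k - 3)^2) with y = |Im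
  z|. The first parts telescope to order n^(-2); the second form the square root of a partial Euler
  product, hence the type pi/2. The first three factors cost (2 + y)^3.\<close>

lemma norm_newt_le_strip:
  assumes "2 \<le> Re z" "Re z \<le> 3"
  shows "norm (newt n z) \<le> 16 * (2 + \<bar>Im z\<bar>) ^ 3 * exp (pi * \<bar>Im z\<bar> / 2) / (real n + 1)\<^sup>2"
proof -
  define y where "y = \<bar>Im z\<bar>"
  have y: "y \<ge> 0" by (simp add: y_def)
  have e: "exp (pi * y / 2) \<ge> 1" using y by simp
  have small: "norm (1 - z / of_nat k) \<le> 2 + y" if "k \<ge> 1" for k :: nat
  proof -
    have "norm (1 - z / of_nat k) \<le> \<bar>Re (1 - z / of_nat k)\<bar> + \<bar>Im (1 - z / of_nat k)\<bar>"
      by (rule cmod_le)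
    also have "\<bar>Im (1 - z / of_nat k)\<bar> \<le> y / 1"
    proof -
      have "y / real k \<le> y / 1" using that y by (intro divide_left_mono) auto
      then show ?thesis by (simp add: y_def)
    qed
    also have "\<bar>Re (1 - z / of_nat k)\<bar> \<le> 2"
    proof -
      have "0 \<le> Re z / real k" using assms by simp
      moreover have "Re z / real k \<le> Re z / 1"
        using assms that by (intro divide_left_mono) auto
      ultimately have "\<bar>1 - Re z / real k\<bar> \<le> 2" using assms by linarith
      then show ?thesis by simp
    qed
    finally show ?thesis by simp
  qed
  have large: "norm (1 - z / of_nat k) \<le> (1 - 2 / real k) * sqrt (1 + y\<^sup>2 / (real k - 3)\<^sup>2)"
    if "k \<ge> 4" for k :: nat
  proof -
    have k: "real k \<ge> 4" using that by simp
    have "(norm (1 - z / of_nat k))\<^sup>2 = (1 - Re z / real k)\<^sup>2 + (y / real k)\<^sup>2"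
      by (simp add: cmod_power2 y_def power_divide)
    also have "\<dots> = (1 - Re z / real k)\<^sup>2 * (1 + y\<^sup>2 / (real k - Re z)\<^sup>2)"
    proof -
      have "1 - Re z / real k = (real k - Re z) / real k" "real k - Re z \<noteq> 0"
        using k assms by (auto simp: field_simps)
      then show ?thesis using k by (simp only:) (simp add: power_divide distrib_left)
    qed
    also have "\<dots> \<le> (1 - 2 / real k)\<^sup>2 * (1 + y\<^sup>2 / (real k - 3)\<^sup>2)"
    proof -
      have "2 / real k \<le> Re z / real k" "Re z / real k \<le> 1"
        using k assms by (auto simp: divide_right_mono)
      then have "(1 - Re z / real k)\<^sup>2 \<le> (1 - 2 / real k)\<^sup>2"
        by (intro power_mono) auto
      moreover have "(real k - 3)\<^sup>2 \<le> (real k - Re z)\<^sup>2" "0 < (real k - 3)\<^sup>2"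
        using k assms by (auto intro!: power_mono)
      then have "y\<^sup>2 / (real k - Re z)\<^sup>2 \<le> y\<^sup>2 / (real k - 3)\<^sup>2"
        by (intro frac_le) auto
      ultimately show ?thesis by (intro mult_mono) auto
    qed
    also have "\<dots> = ((1 - 2 / real k) * sqrt (1 + y\<^sup>2 / (real k - 3)\<^sup>2))\<^sup>2"
      by (simp add: power_mult_distrib)
    finally show ?thesis
      by (rule power2_le_imp_le) (use k in \<open>auto intro!: mult_nonneg_nonneg\<close>)
  qed
  \<comment> \<open>The fraction with numerator 6 is the product of (k - 2)/k over k = 4, ..., n +
    3.\<close>
  have big: "norm (newt (n + 3) z) \<le> (2 + y) ^ 3 * (6 / ((real n + 3) * (real n + 2))) *
      sqrt (\<Prod>k=1..n. 1 + y\<^sup>2 / real k ^ 2)" for n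
  proof (induction n)
    case 0
    have "norm (newt 3 z) = norm (1 - z / of_nat 1) * norm (1 - z / of_nat 2) * norm (1 - z / of_nat 3)"
    proof -
      have "{1..3::nat} = {1, 2, 3}" by auto
      then show ?thesis by (simp add: newt_def norm_mult)
    qed
    also have "\<dots> \<le> (2 + y) * (2 + y) * (2 + y)"
      using y by (intro mult_mono small mult_nonneg_nonneg) auto
    finally show ?case by (simp add: power3_eq_cube)
  next
    case (Suc n)
    have "norm (newt (Suc n + 3) z) = norm (newt (n + 3) z) * norm (1 - z / of_nat (n + 4))"
      using newt_Suc[of "n + 3" z] by (simp add: norm_mult add_ac)
    also have "\<dots> \<le> ((2 + y) ^ 3 * (6 / ((real n + 3) * (real n + 2))) *
      sqrt (\<Prod>k=1..n. 1 + y\<^sup>2 / real k ^ 2)) *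
      ((1 - 2 / real (n + 4)) * sqrt (1 + y\<^sup>2 / (real (n + 4) - 3)\<^sup>2))"
      using y by (intro mult_mono Suc.IH large)
        (auto intro!: mult_nonneg_nonneg divide_nonneg_nonneg prod_nonneg)
    also have "\<dots> = (2 + y) ^ 3 * (6 / ((real n + 3) * (real n + 2)) * (1 - 2 / real (n + 4))) *
      sqrt (\<Prod>k=1..Suc n. 1 + y\<^sup>2 / real k ^ 2)"
      by (simp add: prod.nat_ivl_Suc' real_sqrt_mult mult_ac add_ac)
    also have "6 / ((real n + 3) * (real n + 2)) * (1 - 2 / real (n + 4)) =
       6 / ((real (Suc n) + 3) * (real (Suc n) + 2))"
    proof -
      have "1 - 2 / real (n + 4) = (real n + 2) / (real n + 4)" by (simp add: field_simps)
      moreover have "6 / (a * b) * (b / c) = 6 / (c * a)" if "b \<noteq> 0" for a b c :: real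
        using that by simp
      from this[of "real n + 2" "real n + 3" "real n + 4"]
      have "6 / ((real n + 3) * (real n + 2)) * ((real n + 2) / (real n + 4)) =
          6 / ((real n + 4) * (real n + 3))" by linarith
      ultimately show ?thesis by (simp only: of_nat_Suc) (simp only: add_ac, simp add: add_ac)
    qed
    finally show ?case .
  qed
  show ?thesis
  proof (cases "n \<ge> 3")
    case True
    then obtain m where m: "n = m + 3" by (metis add.commute le_Suc_ex)
    have "sqrt (\<Prod>k=1..m. 1 + y\<^sup>2 / real k ^ 2) \<le> sqrt (exp (pi * \<bar>y\<bar>))"
      by (intro real_sqrt_le_mono prod_one_plus_le_exp_pi)
    also have "\<dots> = exp (pi * y / 2)"
      using y by (intro real_sqrt_unique) (auto simp flip: exp_double)
    finally have "norm (newt n z) \<le> (2 + y) ^ 3 * (6 / ((real m + 3) * (real m + 2))) * exp (pi * y / 2)"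
      unfolding m using y by (intro order_trans[OF big] mult_left_mono) auto
    \<comment> \<open>The constant 16 makes this an equality at m = 0.\<close>
    also have "6 / ((real m + 3) * (real m + 2)) \<le> 16 / (real m + 4)\<^sup>2"
    proof -
      have "6 * (real m + 4)\<^sup>2 \<le> 16 * ((real m + 3) * (real m + 2))"
        by (simp add: power2_eq_square algebra_simps)
      moreover have "0 < (real m + 3) * (real m + 2)" "0 < (real m + 4)\<^sup>2"
        by (auto intro!: mult_pos_pos zero_less_power)
      moreover have "a / b \<le> c / d" if "a * d \<le> c * b" "0 < b" "0 < d" for a b c d :: real
        using that by (simp add: divide_simps mult.commute)
      ultimately show ?thesis by blast
    qed
    finally have "norm (newt n z) \<le> (2 + y) ^ 3 * (16 / (real m + 4)\<^sup>2) * exp (pi * y / 2)"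
      using y by (simp add: mult_left_mono mult_right_mono)
    then show ?thesis by (simp add: m y_def mult_ac add_ac)
  next
    case False
    have "norm (newt n z) = (\<Prod>k=1..n. norm (1 - z / of_nat k))"
      by (simp add: newt_def prod_norm)
    also have "\<dots> \<le> (\<Prod>k=1..n. 2 + y)"
      using small by (intro prod_mono) auto
    also have "\<dots> \<le> (2 + y) ^ 3"
      using y False by (simp add: power_increasing)
    also have "\<dots> \<le> (2 + y) ^ 3 * exp (pi * y / 2) * (16 / (real n + 1)\<^sup>2)"
    proof -
      have "(real n + 1)\<^sup>2 \<le> 4\<^sup>2" using False by (intro power_mono) auto
      then have "1 \<le> 16 / (real n + 1)\<^sup>2" by simp
      then have "(2 + y) ^ 3 * 1 * 1 \<le> (2 + y) ^ 3 * exp (pi * y / 2) * (16 / (real n + 1)\<^sup>2)"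
        using e y by (intro mult_mono) auto
      then show ?thesis by simp
    qed
    finally show ?thesis by (simp add: y_def mult_ac)
  qed
qed

section \<open>Periodic functions of small exponential type\<close>

text \<open>In the variable zeta = exp(2 pi i z), up to a constant factor, p becomes a function on
  the punctured plane bounded by K max(|zeta|, 1/|zeta|)^(7/8). As 7/8 < 1, the singularity at 0 is
  removable and the growth at infinity is sublinear, so Liouville's theorem applies.\<close>

lemma periodic_small_type_constant:
  fixes p :: "complex \<Rightarrow> complex"
  assumes hol: "p holomorphic_on {z. Re z > 1/2}"
    and per: "\<And>z. Re z \<ge> 2 \<Longrightarrow> p z = p (z - 1)"
    and growth: "\<And>z. 1 \<le> Re z \<Longrightarrow> Re z \<le> 2 \<Longrightarrow> norm (p z) \<le> K * exp (7/8 * (2 * pi * \<bar>Im z\<bar>))"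
    and z: "1 < Re z" "Re z \<le> 2"
  shows "p z = p 2"
proof -
  \<comment> \<open>With base point 3/2 the principal logarithm parametrises exactly the strip 1 <
    Re z <= 2.\<close>
  define q where "q = (\<lambda>\<zeta>. p (3/2 + Ln \<zeta> / (2 * pi * \<i>)))"
  have re: "Re (Ln \<zeta> / (2 * pi * \<i>)) = Im (Ln \<zeta>) / (2 * pi)"
    and im: "Im (Ln \<zeta> / (2 * pi * \<i>)) = - Re (Ln \<zeta>) / (2 * pi)" for \<zeta>
    by (simp_all add: Re_divide Im_divide power2_eq_square)
  have arg: "-1/2 < Re (Ln \<zeta> / (2 * pi * \<i>))" "Re (Ln \<zeta> / (2 * pi * \<i>)) \<le> 1/2" if "\<zeta> \<noteq> 0" for \<zeta>
    unfolding re using mpi_less_Im_Ln[OF that] Im_Ln_le_pi[OF that] by (auto simp: field_simps)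
  have q_hol: "q holomorphic_on (- {0})"
  proof -
    have "q holomorphic_on (- \<real>\<^sub>\<le>\<^sub>0)"
      unfolding q_def
    proof (rule holomorphic_on_compose_gen[OF _ hol, unfolded o_def])
      show "(\<lambda>\<zeta>. 3/2 + Ln \<zeta> / (2 * pi * \<i>)) holomorphic_on - \<real>\<^sub>\<le>\<^sub>0"
        by (intro holomorphic_intros) auto
      show "(\<lambda>\<zeta>. 3/2 + Ln \<zeta> / (2 * pi * \<i>)) ` (- \<real>\<^sub>\<le>\<^sub>0) \<subseteq> {z. 1 / 2 < Re z}"
      proof (clarify)
        fix \<zeta> :: complex assume "\<zeta> \<notin> \<real>\<^sub>\<le>\<^sub>0"
        then have "\<zeta> \<noteq> 0" by auto
        from arg(1)[OF this] show "1 / 2 < Re (3/2 + Ln \<zeta> / (2 * pi * \<i>))" by simp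
      qed
    qed
    moreover have "q holomorphic_on (- \<real>\<^sub>\<ge>\<^sub>0)"
    proof -
      \<comment> \<open>To cross the cut of \<open>Ln \<zeta>\<close>, use the branch
        \<open>Ln (- \<zeta>)\<close>. The two arguments of p coincide when
        \<open>Im \<zeta>\<close> is nonnegative and differ by the period 1 when it is
        negative.\<close>
      have eq: "q \<zeta> = p (2 + Ln (- \<zeta>) / (2 * pi * \<i>))" if "\<zeta> \<in> - \<real>\<^sub>\<ge>\<^sub>0" for \<zeta>
      proof (cases "Im \<zeta> < 0")
        case False
        have nz: "\<zeta> \<noteq> 0" using that by auto
        have "Ln (- \<zeta>) = Ln \<zeta> - \<i> * pi"
          using False that nz by (subst Ln_minus) (auto simp: complex_nonneg_Reals_iff)
        then have "3/2 + Ln \<zeta> / (2 * pi * \<i>) = 2 + Ln (- \<zeta>) / (2 * pi * \<i>)"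
          by (simp add: field_simps)
        then show ?thesis by (simp only: q_def)
      next
        case True
        have nz: "\<zeta> \<noteq> 0" using that by auto
        have L: "Ln (- \<zeta>) = Ln \<zeta> + \<i> * pi"
          using True nz by (subst Ln_minus) auto
        have Re1: "Re (Ln (- \<zeta>) / (2 * pi * \<i>)) = Re (Ln \<zeta> / (2 * pi * \<i>)) + 1/2"
          unfolding re by (simp add: L field_simps)
        have "2 + Ln (- \<zeta>) / (2 * pi * \<i>) - 1 = 3/2 + Ln \<zeta> / (2 * pi * \<i>)"
          unfolding L by (simp add: field_simps)
        moreover have "Re (2 + Ln (- \<zeta>) / (2 * pi * \<i>)) \<ge> 2"
          using Re1 arg(1)[OF nz] by simp
        ultimately show ?thesis using per[of "2 + Ln (- \<zeta>) / (2 * pi * \<i>)"] by (simp add: q_def)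
      qed
      have "(\<lambda>\<zeta>. p (2 + Ln (- \<zeta>) / (2 * pi * \<i>))) holomorphic_on (- \<real>\<^sub>\<ge>\<^sub>0)"
      proof (rule holomorphic_on_compose_gen[OF _ hol, unfolded o_def])
        show "(\<lambda>\<zeta>. 2 + Ln (- \<zeta>) / (2 * pi * \<i>)) holomorphic_on - \<real>\<^sub>\<ge>\<^sub>0"
          by (intro holomorphic_intros) (auto simp: complex_nonpos_Reals_iff complex_nonneg_Reals_iff)
        show "(\<lambda>\<zeta>. 2 + Ln (- \<zeta>) / (2 * pi * \<i>)) ` (- \<real>\<^sub>\<ge>\<^sub>0) \<subseteq> {z. 1 / 2 < Re z}"
        proof (clarify)
          fix \<zeta> :: complex assume "\<zeta> \<notin> \<real>\<^sub>\<ge>\<^sub>0"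
          then have "- \<zeta> \<noteq> 0" by auto
          from arg(1)[OF this] show "1 / 2 < Re (2 + Ln (- \<zeta>) / (2 * pi * \<i>))" by simp
        qed
      qed
      then show ?thesis by (rule holomorphic_transform) (simp add: eq)
    qed
    moreover have "open (- (\<real>\<^sub>\<le>\<^sub>0 :: complex set))" "open (- (\<real>\<^sub>\<ge>\<^sub>0 :: complex set))"
      by auto
    ultimately have "q holomorphic_on (- \<real>\<^sub>\<le>\<^sub>0 \<union> - \<real>\<^sub>\<ge>\<^sub>0)"
      by (intro holomorphic_on_Un)
    moreover have "- \<real>\<^sub>\<le>\<^sub>0 \<union> - \<real>\<^sub>\<ge>\<^sub>0 = - {0 :: complex}"
      by (auto simp: complex_nonpos_Reals_iff complex_nonneg_Reals_iff complex_eq_iff)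
    ultimately show ?thesis by simp
  qed
  have K: "K \<ge> 0" using order_trans[OF norm_ge_zero growth[of 1]] by simp
  have q_bound: "norm (q \<zeta>) \<le> K * exp (7/8 * \<bar>ln (norm \<zeta>)\<bar>)" if "\<zeta> \<noteq> 0" for \<zeta>
  proof -
    have "norm (q \<zeta>) \<le> K * exp (7/8 * (2 * pi * \<bar>Im (3/2 + Ln \<zeta> / (2 * pi * \<i>))\<bar>))"
      unfolding q_def using arg[OF that] by (intro growth) auto
    also have "2 * pi * \<bar>Im (3/2 + Ln \<zeta> / (2 * pi * \<i>))\<bar> = \<bar>ln (norm \<zeta>)\<bar>"
      using that im[of \<zeta>] by (simp add: Re_Ln)
    finally show ?thesis .
  qed
  have "((\<lambda>\<zeta>. (\<zeta> - 0) * q \<zeta>) \<longlongrightarrow> 0) (at 0)"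
  proof (rule Lim_null_comparison)
    have "eventually (\<lambda>\<zeta>. \<zeta> \<noteq> 0 \<and> norm \<zeta> < 1) (at (0::complex))"
      by (auto simp: eventually_at intro!: exI[of _ 1])
    then show "eventually (\<lambda>\<zeta>. norm ((\<zeta> - 0) * q \<zeta>) \<le> K * norm \<zeta> powr (1/8)) (at 0)"
    proof (eventually_elim)
      case (elim \<zeta>)
      then have l: "norm \<zeta> > 0" "ln (norm \<zeta>) < 0" by auto
      have "norm ((\<zeta> - 0) * q \<zeta>) \<le> norm \<zeta> * (K * exp (7/8 * \<bar>ln (norm \<zeta>)\<bar>))"
        using q_bound[of \<zeta>] elim by (simp add: norm_mult mult_left_mono)
      also have "\<dots> = K * (exp (ln (norm \<zeta>)) * exp (7/8 * \<bar>ln (norm \<zeta>)\<bar>))"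
        using l by simp
      also have "exp (ln (norm \<zeta>)) * exp (7/8 * \<bar>ln (norm \<zeta>)\<bar>) = exp (1/8 * ln (norm \<zeta>))"
        unfolding exp_add[symmetric] using l by simp
      also have "K * exp (1/8 * ln (norm \<zeta>)) = K * norm \<zeta> powr (1/8)" using l by (simp add: powr_def)
      finally show ?case by simp
    qed
    show "((\<lambda>\<zeta>. K * norm \<zeta> powr (1/8)) \<longlongrightarrow> 0) (at (0::complex))"
      by (intro tendsto_mult_right_zero tendsto_zero_powrI[where b = "1/8"] tendsto_norm_zero
          tendsto_ident_at tendsto_const) auto
  qed
  then have "\<exists>g. g holomorphic_on UNIV \<and> (\<forall>z\<in>UNIV - {0}. g z = q z)"
    using q_hol by (subst holomorphic_on_extend_lim) (auto simp: Compl_eq_Diff_UNIV)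
  then obtain g where g: "g holomorphic_on UNIV" "\<And>\<zeta>. \<zeta> \<noteq> 0 \<Longrightarrow> g \<zeta> = q \<zeta>" by auto
  have g_bound: "norm (g \<zeta>) \<le> K * norm \<zeta> powr (7/8)" if "1 \<le> norm \<zeta>" for \<zeta>
  proof -
    have nz: "\<zeta> \<noteq> 0" using that by auto
    have "ln (norm \<zeta>) \<ge> 0" using that by simp
    with q_bound[OF nz] g(2)[OF nz] nz show ?thesis by (simp add: powr_def)
  qed
  \<comment> \<open>At most linear growth makes g affine; the slope then vanishes because r^(7/8) /
    r tends to 0.\<close>
  have g_lin: "g \<zeta> = g 0 + deriv g 0 * \<zeta>" for \<zeta>
  proof -
    have "norm (g \<zeta>) \<le> K * norm \<zeta> ^ 1" if "1 \<le> norm \<zeta>" for \<zeta>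
    proof -
      have "norm \<zeta> powr (7/8) \<le> norm \<zeta> powr 1" using that by (intro powr_mono) auto
      then show ?thesis using order_trans[OF g_bound[OF that] mult_left_mono[OF _ K]] that by auto
    qed
    from Liouville_polynomial[OF g(1) this, where \<xi> = \<zeta>] show ?thesis by simp
  qed
  have "deriv g 0 = 0"
  proof -
    have "norm (deriv g 0) \<le> norm (g 0) / r + K * r powr (-1/8)" if "r \<ge> 1" for r :: real
    proof -
      have "norm (deriv g 0) * r = norm (g (of_real r) - g 0)"
        using that by (subst g_lin) (simp add: norm_mult)
      also have "\<dots> \<le> norm (g (of_real r)) + norm (g 0)" by (rule norm_triangle_ineq4)
      also have "\<dots> \<le> K * r powr (7/8) + norm (g 0)"
        using g_bound[of "of_real r"] that by simp
      finally have "norm (deriv g 0) \<le> (K * r powr (7/8) + norm (g 0)) / r"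
        using that by (simp add: field_simps)
      also have "\<dots> = norm (g 0) / r + K * (r powr (7/8) / r powr 1)"
        using that by (simp add: add_divide_distrib)
      also have "r powr (7/8) / r powr 1 = r powr (-1/8)"
        by (subst powr_diff[symmetric]) simp
      finally show ?thesis .
    qed
    then have "eventually (\<lambda>r. norm (deriv g 0) \<le> norm (g 0) / r + K * r powr (-1/8)) at_top"
      by (intro eventually_mono[OF eventually_ge_at_top[of 1]]) auto
    moreover have "((\<lambda>r::real. norm (g 0) / r + K * r powr (-1/8)) \<longlongrightarrow> 0 + K * 0) at_top"
      by (intro tendsto_intros tendsto_divide_0[OF tendsto_const] tendsto_neg_powr
          filterlim_ident filterlim_at_top_imp_at_infinity) auto
    ultimately have "norm (deriv g 0) \<le> 0 + K * 0"
      by (intro tendsto_lowerbound) auto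
    then show ?thesis by simp
  qed
  then have const: "q \<zeta> = g 0" if "\<zeta> \<noteq> 0" for \<zeta>
    using g(2)[OF that] g_lin[of \<zeta>] by simp
  have "p z = g 0" if "1 < Re z" "Re z \<le> 2" for z
  proof -
    define w where "w = 2 * pi * \<i> * (z - 3/2)"
    have "Im w = 2 * pi * (Re z - 3/2)" by (simp add: w_def)
    moreover have "- pi < 2 * pi * (Re z - 3/2)" "2 * pi * (Re z - 3/2) \<le> pi"
      using that by (auto simp: field_simps)
    ultimately have "Ln (exp w) = w" by (intro Ln_exp) auto
    then have "q (exp w) = p z" by (simp add: q_def w_def)
    with const[of "exp w"] show ?thesis by simp
  qed
  from this[OF z] this[of 2] show ?thesis by simp
qed

section \<open>Sequences with square-root decay\<close>

text \<open>Square-root decay absorbs the logarithms produced by repeated averaging and is itself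
  stable under averaging. The value at 0 is left free, to admit constant terms.\<close>

definition sqbd :: "(nat \<Rightarrow> complex) \<Rightarrow> bool" where
  "sqbd f \<longleftrightarrow> (\<exists>K\<ge>0. \<forall>m\<ge>1. norm (f m) \<le> K / sqrt (real m))"

lemma sum_inverse_sqrt_le: "(\<Sum>j=1..m. 1 / sqrt (real j)) \<le> 2 * sqrt (real m)"
proof (induction m)
  case (Suc m)
  let ?a = "sqrt (real m)" and ?b = "sqrt (real (Suc m))"
  have b: "?b > 0" "0 \<le> ?a" "?a \<le> ?b" by simp_all
  have "?b * ?b - ?a * ?a = 1" by simp
  then have "1 = (?b - ?a) * (?b + ?a)" by (simp add: algebra_simps)
  also have "\<dots> \<le> (?b - ?a) * (2 * ?b)" using b by (intro mult_left_mono) auto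
  finally have "1 / ?b \<le> 2 * (?b - ?a)" using b by (simp add: field_simps)
  with Suc show ?case by simp
qed simp

lemma sqbd_sum_norm:
  assumes "sqbd f"
  obtains K where "K \<ge> 0" "\<And>m. (\<Sum>j\<le>m. norm (f j)) \<le> K * sqrt (real m + 1)"
    "\<And>m. m \<ge> 1 \<Longrightarrow> (\<Sum>j\<le>m. norm (f j)) \<le> K * sqrt (real m)"
proof -
  obtain K where K: "K \<ge> 0" "\<And>m. m \<ge> 1 \<Longrightarrow> norm (f m) \<le> K / sqrt (real m)"
    using assms by (auto simp: sqbd_def)
  define L where "L = norm (f 0) + 2 * K"
  have main: "(\<Sum>j\<le>m. norm (f j)) \<le> norm (f 0) + 2 * K * sqrt (real m)" for m
  proof -
    have "(\<Sum>j\<le>m. norm (f j)) = norm (f 0) + (\<Sum>j=1..m. norm (f j))"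
      by (simp add: atMost_atLeast0 sum.atLeast_Suc_atMost)
    also have "(\<Sum>j=1..m. norm (f j)) \<le> (\<Sum>j=1..m. K * (1 / sqrt (real j)))"
      using K by (intro sum_mono) auto
    also have "\<dots> \<le> K * (2 * sqrt (real m))"
      unfolding sum_distrib_left[symmetric] using K by (intro mult_left_mono sum_inverse_sqrt_le)
    finally show ?thesis by simp
  qed
  have 1: "(\<Sum>j\<le>m. norm (f j)) \<le> L * r" if "r \<ge> 1" "sqrt (real m) \<le> r" for m r
  proof -
    have "norm (f 0) * 1 + 2 * K * sqrt (real m) \<le> norm (f 0) * r + 2 * K * r"
      using K that by (intro add_mono mult_left_mono) auto
    with main[of m] show ?thesis by (simp add: L_def distrib_right)
  qed
  show ?thesis
    by (rule that[of L]) (use K 1 in \<open>auto simp: L_def\<close>)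
qed

lemma sqbd_average:
  assumes "sqbd f" "\<And>m. m \<ge> 1 \<Longrightarrow> norm (g m) \<le> C * (\<Sum>j\<le>m. norm (f j)) / real m" "C \<ge> 0"
  shows "sqbd g"
proof -
  obtain K where K: "K \<ge> 0" "\<And>m. m \<ge> 1 \<Longrightarrow> (\<Sum>j\<le>m. norm (f j)) \<le> K * sqrt (real m)"
    using sqbd_sum_norm[OF assms(1)] by metis
  have "norm (g m) \<le> C * K / sqrt (real m)" if "m \<ge> 1" for m
  proof -
    have "norm (g m) \<le> C * (K * sqrt (real m)) / real m"
      using assms(3) K(2)[OF that]
      by (intro order_trans[OF assms(2)[OF that]] divide_right_mono mult_left_mono) auto
    also have "\<dots> = C * K / sqrt (real m)"
      using that by (simp add: field_simps)
    finally show ?thesis .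
  qed
  then show ?thesis using K(1) assms(3) by (auto simp: sqbd_def intro!: exI[of _ "C * K"])
qed

text \<open>The coefficients of \<open>f(t) / (1 - \<beta> t)\<close>.\<close>

definition geom :: "complex \<Rightarrow> (nat \<Rightarrow> complex) \<Rightarrow> nat \<Rightarrow> complex" where
  "geom \<beta> f m = (\<Sum>j\<le>m. \<beta> ^ (m - j) * f j)"

lemma geom_0 [simp]: "geom \<beta> f 0 = f 0"
  by (simp add: geom_def)

lemma geom_Suc: "geom \<beta> f (Suc m) = \<beta> * geom \<beta> f m + f (Suc m)"
  by (simp add: geom_def sum_distrib_left Suc_diff_le mult.assoc)

lemma norm_geom_le:
  assumes "norm \<beta> \<le> 1"
  shows "norm (geom \<beta> f m) \<le> (\<Sum>j\<le>m. norm (f j))"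
  unfolding geom_def
proof (rule order_trans[OF norm_sum], rule sum_mono)
  fix j
  have "norm \<beta> ^ (m - j) * norm (f j) \<le> 1 * norm (f j)"
    using assms by (intro mult_right_mono power_le_one) auto
  then show "norm (\<beta> ^ (m - j) * f j) \<le> norm (f j)"
    by (simp add: norm_mult norm_power)
qed

lemma sqbd_geom_divide:
  assumes "sqbd f" "norm \<beta> \<le> 1"
  shows "sqbd (\<lambda>m. geom \<beta> f m / of_nat m)"
  by (rule sqbd_average[OF assms(1), of _ 1])
     (auto simp: norm_divide intro!: divide_right_mono norm_geom_le assms)

lemma geom_bound:
  assumes "sqbd f" "norm \<beta> \<le> 1"
  obtains K where "K \<ge> 0" "\<And>m. norm (geom \<beta> f m) \<le> K * sqrt (real m + 1)"
  using sqbd_sum_norm[OF assms(1)] norm_geom_le[OF assms(2), of f] by (metis order_trans)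

section \<open>Convergence of Newton series\<close>

lemma summable_powr_Suc: "a < -1 \<Longrightarrow> summable (\<lambda>n. (real n + 1) powr a)"
  using summable_Suc_iff[of "\<lambda>n. real n powr a"] by (simp add: summable_real_powr_iff add.commute)

text \<open>From the recursion of \<open>geom\<close>, (1 - beta) b_n = v_n - beta (b_n - b_{n-1}).
  Summation by parts moves the difference onto \<open>newt n z / (n + 1)\<close>, whose decrement is
  \<open>newt n z\<close> times (1 + z)/((n + 1)(n + 2)); this gains a factor of order 1/n.\<close>

lemma newt_abel_summation:
  assumes "\<beta> \<noteq> 1"
  shows "(\<Sum>n<M. geom \<beta> v (Suc n) / of_nat (Suc n) * newt n z) =
    ((\<Sum>n<M. v (Suc n) * newt n z / of_nat (Suc n) -
        \<beta> * geom \<beta> v (Suc n) * newt n z * (1 + z) / (of_nat (Suc n) * of_nat (Suc (Suc n)))) +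
     (\<beta> * v 0 - \<beta> * geom \<beta> v M * newt M z / of_nat (Suc M))) / (1 - \<beta>)"
    (is "?L M = (?S M + ?E M) / _")
proof -
  have "(1 - \<beta>) * ?L M = ?S M + ?E M"
  proof (induction M)
    case (Suc M)
    define a where "a = (of_nat (Suc M) :: complex)"
    have a: "a \<noteq> 0" "a + 1 \<noteq> 0"
      unfolding a_def by (simp_all del: of_nat_Suc) (metis of_nat_Suc of_nat_eq_0_iff nat.distinct(1) add.commute)
    have a1: "of_nat (Suc (Suc M)) = a + 1" by (simp add: a_def)
    let ?p = "newt M z" and ?b = "geom \<beta> v M" and ?v = "v (Suc M)"
    have n: "newt (Suc M) z = ?p * (1 - z / a)" by (simp add: newt_Suc a_def)
    have split: "(1 + z) / (a * (a + 1)) + (1 - z / a) / (a + 1) = 1 / a"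
      using a by (simp add: divide_simps)
    have "(1 - \<beta>) * ((\<beta> * ?b + ?v) / a * ?p) = ?v * ?p / a - \<beta> * (\<beta> * ?b + ?v) * ?p * (1 / a) + \<beta> * ?b * ?p / a"
      by (simp add: algebra_simps add_divide_distrib diff_divide_distrib)
    also have "\<beta> * (\<beta> * ?b + ?v) * ?p * (1 / a) = \<beta> * (\<beta> * ?b + ?v) * ?p * (1 + z) / (a * (a + 1)) +
        \<beta> * (\<beta> * ?b + ?v) * (?p * (1 - z / a)) / (a + 1)"
      unfolding split[symmetric] by (simp only: distrib_left times_divide_eq_right mult.assoc)
    finally show ?case
      using Suc.IH unfolding sum.lessThan_Suc distrib_left
      by (simp only: a1 n geom_Suc a_def[symmetric]) (simp add: algebra_simps)
  qed simp
  then show ?thesis using assms by (simp add: field_simps)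
qed

text \<open>For \<open>\<beta> \<noteq> 1\<close> the series converges only conditionally near \<open>z = 0\<close>; one Abel summation
  makes it absolutely convergent.\<close>

lemma nseries_uniform_limit:
  assumes v: "sqbd v" and \<beta>: "norm \<beta> \<le> 1" "\<beta> \<noteq> 1"
  shows "uniform_limit {z. Re z \<ge> -1/4 \<and> norm z \<le> R}
    (\<lambda>M z. \<Sum>n<M. geom \<beta> v (Suc n) / of_nat (Suc n) * newt n z)
    (nseries (\<lambda>m. geom \<beta> v m / of_nat m)) sequentially"
proof -
  let ?B = "{z. Re z \<ge> -1/4 \<and> norm z \<le> R}"
  define t where "t = (\<lambda>n z. v (Suc n) * newt n z / of_nat (Suc n) -
        \<beta> * geom \<beta> v (Suc n) * newt n z * (1 + z) / (of_nat (Suc n) * of_nat (Suc (Suc n))))"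
  define r where "r = (\<lambda>M z. \<beta> * geom \<beta> v M * newt M z / of_nat (Suc M))"
  obtain K where K: "K \<ge> 0" "\<And>m. norm (geom \<beta> v m) \<le> K * sqrt (real m + 1)"
    using geom_bound[OF v \<beta>(1)] by blast
  obtain L where L: "L \<ge> 0" "\<And>m. m \<ge> 1 \<Longrightarrow> norm (v m) \<le> L / sqrt (real m)"
    using v by (auto simp: sqbd_def)
  define C where "C = exp (R\<^sup>2 + 1/4)"
  have C: "C \<ge> 0" by (simp add: C_def)
  have newt_le: "norm (newt n z) \<le> C * (real n + 1) powr (1/4)" if "z \<in> ?B" for n z
    unfolding C_def using that by (intro norm_newt_le_powr) auto
  \<comment> \<open>Both parts of \<open>t\<close> have order n^(-5/4): the exponents are -1/2 + 1/4
    - 1 and 1/2 + 1/4 - 2. The boundary term \<open>r\<close> has only 1/2 + 1/4 - 1, which still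
    tends to 0.\<close>
  have "uniform_limit ?B (\<lambda>M z. \<Sum>n<M. t n z) (\<lambda>z. \<Sum>n. t n z) sequentially"
  proof (rule Weierstrass_m_test)
    fix n z assume z: "z \<in> ?B"
    define x where "x = real n + 1"
    have x: "x \<ge> 1" by (simp add: x_def)
    have p: "norm (newt n z) \<le> C * x powr (1/4)" using newt_le[OF z] by (simp add: x_def)
    have "norm (v (Suc n) * newt n z / of_nat (Suc n)) \<le> (L / sqrt x) * (C * x powr (1/4)) / x"
    proof -
      have "norm (v (Suc n)) * norm (newt n z) / x \<le> (L / sqrt x) * (C * x powr (1/4)) / x"
        using L(2)[of "Suc n"] p x L(1) C
        by (intro divide_right_mono mult_mono) (auto simp: x_def add.commute)
      then show ?thesis by (simp add: norm_mult norm_divide x_def add.commute flip: of_nat_Suc)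
    qed
    also have "\<dots> = L * C * x powr (-5/4)"
    proof -
      have "x powr (1/4) / (sqrt x * x) = x powr (1/4) / (x powr (1/2) * x powr 1)"
        using x by (simp add: powr_half_sqrt)
      also have "\<dots> = x powr (-5/4)"
        unfolding powr_add[symmetric] powr_diff[symmetric] by simp
      finally show ?thesis
        by (metis divide_divide_eq_left mult.assoc mult.left_commute times_divide_eq_left times_divide_eq_right)
    qed
    finally have 1: "norm (v (Suc n) * newt n z / of_nat (Suc n)) \<le> L * C * x powr (-5/4)" .
    have "norm (\<beta> * geom \<beta> v (Suc n) * newt n z * (1 + z) / (of_nat (Suc n) * of_nat (Suc (Suc n))))
       = norm \<beta> * norm (geom \<beta> v (Suc n)) * norm (newt n z) * norm (1 + z) / (x * (x + 1))"
    proof -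
      have "norm (of_nat (Suc n) :: complex) = x" "norm (of_nat (Suc (Suc n)) :: complex) = x + 1"
        unfolding norm_of_nat by (simp_all add: x_def)
      then show ?thesis by (simp only: norm_divide norm_mult)
    qed
    also have "\<dots> \<le> 1 * (K * sqrt (x + 1)) * (C * x powr (1/4)) * (1 + R) / (x * (x + 1))"
    proof -
      have "norm (1 + z) \<le> 1 + R" using norm_triangle_ineq[of 1 z] z by simp
      then show ?thesis
        using K(2)[of "Suc n"] \<beta>(1) p x K(1) C
        by (intro divide_right_mono mult_mono) (auto simp: x_def add_ac)
    qed
    also have "\<dots> = K * C * (1 + R) * (x powr (1/4) / (x * sqrt (x + 1)))"
    proof -
      have "1 * (K * y) * (C * p) * r / (x * (y * y)) = K * C * r * (p / (x * y))"
        if "y \<noteq> 0" for y p r :: real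
        using that by simp
      from this[of "sqrt (x + 1)" "x powr (1/4)" "1 + R"] show ?thesis using x by simp
    qed
    also have "\<dots> \<le> K * C * (1 + R) * x powr (-5/4)"
    proof (rule mult_left_mono)
      have "x powr (1/4) / (x * sqrt (x + 1)) \<le> x powr (1/4) / (x powr 1 * x powr (1/2))"
        using x by (intro frac_le) (auto simp: powr_half_sqrt)
      also have "\<dots> = x powr (-5/4)" unfolding powr_add[symmetric] powr_diff[symmetric] by simp
      finally show "x powr (1/4) / (x * sqrt (x + 1)) \<le> x powr (-5/4)" .
      have "R \<ge> 0" using z order_trans[OF norm_ge_zero, of z R] by simp
      then show "0 \<le> K * C * (1 + R)" using K C by simp
    qed
    finally have 2: "norm (\<beta> * geom \<beta> v (Suc n) * newt n z * (1 + z) / (of_nat (Suc n) * of_nat (Suc (Suc n))))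
       \<le> K * C * (1 + R) * x powr (-5/4)" .
    show "norm (t n z) \<le> (L * C + K * C * (1 + R)) * (real n + 1) powr (-5/4)"
      unfolding t_def using order_trans[OF norm_triangle_ineq4 add_mono[OF 1 2]]
      by (simp add: x_def distrib_right)
  next
    show "summable (\<lambda>n. (L * C + K * C * (1 + R)) * (real n + 1) powr (-5/4))"
      by (intro summable_mult summable_powr_Suc) simp
  qed
  moreover have "uniform_limit ?B r (\<lambda>_. 0) sequentially"
  proof (rule uniform_limit_null_comparison)
    show "\<forall>\<^sub>F M in sequentially. \<forall>z\<in>?B. norm (r M z) \<le> K * C * (real M + 1) powr (-1/4)"
    proof (intro always_eventually allI ballI)
      fix M z assume z: "z \<in> ?B"
      define x where "x = real M + 1"
      have x: "x \<ge> 1" by (simp add: x_def)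
      have "norm (r M z) = norm \<beta> * norm (geom \<beta> v M) * norm (newt M z) / x"
      proof -
        have "norm (of_nat (Suc M) :: complex) = x" unfolding norm_of_nat by (simp add: x_def)
        then show ?thesis by (simp only: r_def norm_divide norm_mult)
      qed
      also have "\<dots> \<le> 1 * (K * sqrt x) * (C * x powr (1/4)) / x"
        using K \<beta>(1) C x newt_le[OF z, of M]
        by (intro divide_right_mono mult_mono) (auto simp: x_def)
      also have "\<dots> = K * C * (x powr (1/2) * x powr (1/4) / x powr 1)"
        using x by (simp add: powr_half_sqrt)
      also have "x powr (1/2) * x powr (1/4) / x powr 1 = x powr (-1/4)"
        unfolding powr_add[symmetric] powr_diff[symmetric] by simp
      finally show "norm (r M z) \<le> K * C * (real M + 1) powr (-1/4)" by (simp add: x_def)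
    qed
    have "filterlim (\<lambda>M. 1 + real M) at_top sequentially"
      by (rule filterlim_tendsto_add_at_top[OF tendsto_const filterlim_real_sequentially])
    then have "(\<lambda>M. K * C * (1 + real M) powr (-1/4)) \<longlonglongrightarrow> K * C * 0"
      by (intro tendsto_intros tendsto_neg_powr) auto
    then show "uniform_limit ?B (\<lambda>M z. K * C * (real M + 1) powr (-1/4)) (\<lambda>_. 0) sequentially"
      unfolding uniform_limit_iff tendsto_iff by (auto simp: add.commute elim: eventually_mono)
  qed
  ultimately have "uniform_limit ?B (\<lambda>M z. (1 / (1 - \<beta>)) * ((\<Sum>n<M. t n z) + (\<beta> * v 0 - r M z)))
     (\<lambda>z. (1 / (1 - \<beta>)) * ((\<Sum>n. t n z) + (\<beta> * v 0 - 0))) sequentially"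
    by (intro uniform_limit_intros)
  also have "(\<lambda>M z. (1 / (1 - \<beta>)) * ((\<Sum>n<M. t n z) + (\<beta> * v 0 - r M z))) =
     (\<lambda>M z. \<Sum>n<M. geom \<beta> v (Suc n) / of_nat (Suc n) * newt n z)"
    unfolding newt_abel_summation[OF \<beta>(2)] by (simp add: t_def r_def)
  finally have lim: "uniform_limit ?B (\<lambda>M z. \<Sum>n<M. geom \<beta> v (Suc n) / of_nat (Suc n) * newt n z)
     (\<lambda>z. (1 / (1 - \<beta>)) * ((\<Sum>n. t n z) + (\<beta> * v 0 - 0))) sequentially" (is "uniform_limit _ ?S ?T _") .
  have eq: "?T z = nseries (\<lambda>m. geom \<beta> v m / of_nat m) z" if "z \<in> ?B" for z
  proof -
    have "(\<lambda>M. ?S M z) \<longlonglongrightarrow> ?T z" using tendsto_uniform_limitI[OF lim that] .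
    then have "(\<lambda>n. geom \<beta> v (Suc n) / of_nat (Suc n) * newt n z) sums ?T z"
      by (simp only: sums_def)
    then show ?thesis by (simp only: nseries_def sums_unique)
  qed
  show ?thesis by (rule uniform_limit_cong'[THEN iffD1, rotated 2, OF lim]) (rule refl, rule eq)
qed

lemma nseries_holomorphic:
  assumes "sqbd v" "norm \<beta> \<le> 1" "\<beta> \<noteq> 1"
  shows "nseries (\<lambda>m. geom \<beta> v m / of_nat m) holomorphic_on {z. Re z > -1/4}"
proof (rule holomorphic_uniform_sequence)
  show "open {z. Re z > -1/4}" by (simp add: open_halfspace_Re_gt)
  show "(\<lambda>z. \<Sum>n<M. geom \<beta> v (Suc n) / of_nat (Suc n) * newt n z) holomorphic_on {z. Re z > -1/4}" for M
    by (intro holomorphic_intros)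
  fix x assume "x \<in> {z. Re z > -1/4}"
  then obtain d where d: "d > 0" "cball x d \<subseteq> {z. Re z > -1/4}"
    using open_halfspace_Re_gt[of "-1/4"] by (meson open_contains_cball)
  have "cball x d \<subseteq> {z. Re z \<ge> -1/4 \<and> norm z \<le> norm x + d}"
  proof
    fix z assume z: "z \<in> cball x d"
    then have "norm z \<le> norm x + d" using norm_triangle_sub[of z x] by (auto simp: dist_norm norm_minus_commute)
    with z d(2) show "z \<in> {z. Re z \<ge> -1/4 \<and> norm z \<le> norm x + d}" by (auto dest!: subsetD)
  qed
  then show "\<exists>d>0. cball x d \<subseteq> {z. Re z > -1/4} \<and> uniform_limit (cball x d)
      (\<lambda>M z. \<Sum>n<M. geom \<beta> v (Suc n) / of_nat (Suc n) * newt n z)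
      (nseries (\<lambda>m. geom \<beta> v m / of_nat m)) sequentially"
    using d uniform_limit_on_subset[OF nseries_uniform_limit[OF assms]] by blast
qed

text \<open>Convergence is uniform on a ball around 0, so the derivatives of the holomorphic partial
  sums converge as well.\<close>

lemma nseries_deriv_tendsto:
  assumes "sqbd v" "norm \<beta> \<le> 1" "\<beta> \<noteq> 1"
  shows "(\<lambda>M. \<Sum>n<M. geom \<beta> v (Suc n) / of_nat (Suc n) * (deriv ^^ k) (newt n) 0) \<longlonglongrightarrow>
    (deriv ^^ k) (nseries (\<lambda>m. geom \<beta> v m / of_nat m)) 0"
proof -
  let ?A = "ball 0 (1/4) :: complex set"
  have "?A \<subseteq> {z. Re z \<ge> -1/4 \<and> norm z \<le> 1/4}"
  proof
    fix z :: complex assume "z \<in> ?A"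
    then have "norm z < 1/4" by simp
    moreover have "\<bar>Re z\<bar> \<le> norm z" by (rule abs_Re_le_cmod)
    ultimately show "z \<in> {z. Re z \<ge> -1/4 \<and> norm z \<le> 1/4}" by simp
  qed
  then have ul: "uniform_limit ?A (\<lambda>M z. \<Sum>n<M. geom \<beta> v (Suc n) / of_nat (Suc n) * newt n z)
     (nseries (\<lambda>m. geom \<beta> v m / of_nat m)) sequentially"
    using uniform_limit_on_subset[OF nseries_uniform_limit[OF assms]] by blast
  have "(\<lambda>M. (deriv ^^ k) (\<lambda>z. \<Sum>n<M. geom \<beta> v (Suc n) / of_nat (Suc n) * newt n z) 0) \<longlonglongrightarrow>
    (deriv ^^ k) (nseries (\<lambda>m. geom \<beta> v m / of_nat m)) 0"
    by (rule higher_deriv_complex_uniform_limit[OF ul])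
       (auto intro!: always_eventually holomorphic_intros)
  moreover have "(deriv ^^ k) (\<lambda>z. \<Sum>n<M. geom \<beta> v (Suc n) / of_nat (Suc n) * newt n z) 0 =
      (\<Sum>n<M. geom \<beta> v (Suc n) / of_nat (Suc n) * (deriv ^^ k) (newt n) 0)" for M
  proof (induction M)
    case 0
    show ?case by (simp add: higher_deriv_const)
  next
    case (Suc M)
    have "(deriv ^^ k) (\<lambda>z. \<Sum>n<Suc M. geom \<beta> v (Suc n) / of_nat (Suc n) * newt n z) 0 =
      (deriv ^^ k) (\<lambda>z. \<Sum>n<M. geom \<beta> v (Suc n) / of_nat (Suc n) * newt n z) 0 +
      (deriv ^^ k) (\<lambda>z. geom \<beta> v (Suc M) / of_nat (Suc M) * newt M z) 0"
      unfolding sum.lessThan_Suc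
      by (intro higher_deriv_add[of _ UNIV]) (auto intro!: holomorphic_intros)
    also have "(deriv ^^ k) (\<lambda>z. geom \<beta> v (Suc M) / of_nat (Suc M) * newt M z) 0 =
        geom \<beta> v (Suc M) / of_nat (Suc M) * (deriv ^^ k) (newt M) 0"
      by (intro higher_deriv_cmult[of _ UNIV]) (auto intro!: holomorphic_intros)
    finally show ?case using Suc.IH by simp
  qed
  ultimately show ?thesis by simp
qed

section \<open>Difference equations for Newton series\<close>

text \<open>Here Newton series with coefficients of order \<open>\<surd>n\<close> converge: absolutely in the half plane, and as finite sums
  at \<open>z = 1\<close>.\<close>

definition reg :: "complex \<Rightarrow> bool" where
  "reg z \<longleftrightarrow> Re z \<ge> 2 \<or> z = 1"

lemma reg_nonzero: "reg z \<Longrightarrow> z \<noteq> 0"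
  by (auto simp: reg_def)

lemma sqrt_times_inverse_square: "sqrt (real n + 1) / (real n + 1)\<^sup>2 = (real n + 1) powr (-3/2)"
proof -
  have "sqrt (real n + 1) / (real n + 1)\<^sup>2 = (real n + 1) powr (1/2) / (real n + 1) powr 2"
    by (simp add: powr_half_sqrt powr_numeral)
  also have "\<dots> = (real n + 1) powr (-3/2)"
    unfolding powr_diff[symmetric] by simp
  finally show ?thesis .
qed

lemma summable_newt:
  assumes "\<And>n. norm (f n) \<le> K * sqrt (real n + 1)" "reg z"
  shows "summable (\<lambda>n. f n * newt n z)"
proof (cases "z = 1")
  case True
  then show ?thesis by (intro summable_finite[of "{0}"]) (auto simp: newt_1)
next
  case False
  then have z: "Re z \<ge> 2" using assms(2) by (simp add: reg_def)
  have K: "K \<ge> 0" using order_trans[OF norm_ge_zero assms(1)[of 0]] by simp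
  show ?thesis
  proof (rule summable_comparison_test')
    show "summable (\<lambda>n. K * exp ((norm z)\<^sup>2) * (real n + 1) powr (-3/2))"
      by (intro summable_mult summable_powr_Suc) simp
    fix n :: nat
    have "norm (f n) * norm (newt n z) \<le> (K * sqrt (real n + 1)) * (exp ((norm z)\<^sup>2) / (real n + 1)\<^sup>2)"
      using K by (intro mult_mono assms(1) norm_newt_le_inverse_square z) auto
    also have "\<dots> = K * exp ((norm z)\<^sup>2) * (sqrt (real n + 1) / (real n + 1)\<^sup>2)"
      by simp
    also have "sqrt (real n + 1) / (real n + 1)\<^sup>2 = (real n + 1) powr (-3/2)"
      by (rule sqrt_times_inverse_square)
    finally show "norm (f n * newt n z) \<le> K * exp ((norm z)\<^sup>2) * (real n + 1) powr (-3/2)"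
      by (simp add: norm_mult)
  qed
qed

lemma shift_bound:
  assumes "\<And>n. norm (f n) \<le> K * sqrt (real n + 1)"
  shows "norm (f (Suc n)) \<le> (2 * K) * sqrt (real n + 1)"
proof -
  have K: "K \<ge> 0" using order_trans[OF norm_ge_zero assms(1)[of 0]] by simp
  have "norm (f (Suc n)) \<le> K * sqrt (real (Suc n) + 1)" by (rule assms)
  also have "\<dots> \<le> K * sqrt (4 * (real n + 1))"
    by (intro mult_left_mono[OF _ K] real_sqrt_le_mono) simp
  also have "sqrt (4 * (real n + 1)) = 2 * sqrt (real n + 1)" by (simp only: real_sqrt_mult) simp
  finally show ?thesis by simp
qed

text \<open>Since z newt_n(z) / (n + 1) = newt_n(z) - newt_{n+1}(z), multiplication by z becomes
  differencing of \<open>h\<close>, and \<open>h 0 = 0\<close> removes the boundary term.\<close>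

lemma mult_nseries:
  assumes h: "\<And>n. norm (h n) \<le> K * sqrt (real n + 1)" "h 0 = 0" and z: "reg z"
  shows "z * nseries (\<lambda>m. h m / of_nat m) z = (\<Sum>n. (h (Suc n) - h n) * newt n z)"
proof -
  have A: "summable (\<lambda>n. h n * newt n z)" by (rule summable_newt[OF h(1) z])
  have B: "summable (\<lambda>n. h (Suc n) * newt n z)" by (rule summable_newt[OF shift_bound[of h K] z]) (rule h)
  have A': "summable (\<lambda>n. h (Suc n) * newt (Suc n) z)" using A by (subst summable_Suc_iff)
  have eq: "z * (h (Suc n) / of_nat (Suc n) * newt n z) = h (Suc n) * newt n z - h (Suc n) * newt (Suc n) z" for n
    by (simp add: newt_Suc algebra_simps del: of_nat_Suc)
  have "summable (\<lambda>n. z * (h (Suc n) / of_nat (Suc n) * newt n z))"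
    unfolding eq by (rule summable_diff[OF B A'])
  then have "summable (\<lambda>n. h (Suc n) / of_nat (Suc n) * newt n z)"
    using reg_nonzero[OF z] by (simp only: summable_cmult_iff simp_thms)
  then have "z * nseries (\<lambda>m. h m / of_nat m) z = (\<Sum>n. z * (h (Suc n) / of_nat (Suc n) * newt n z))"
    unfolding nseries_def by (intro suminf_mult[symmetric])
  also have "\<dots> = (\<Sum>n. h (Suc n) * newt n z) - (\<Sum>n. h (Suc n) * newt (Suc n) z)"
    unfolding eq by (rule suminf_diff[symmetric, OF B A'])
  also have "(\<Sum>n. h (Suc n) * newt (Suc n) z) = (\<Sum>n. h n * newt n z)"
    using suminf_split_head[OF A] h(2) by simp
  also have "(\<Sum>n. h (Suc n) * newt n z) - (\<Sum>n. h n * newt n z) = (\<Sum>n. (h (Suc n) - h n) * newt n z)"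
    unfolding left_diff_distrib by (rule suminf_diff[OF B A])
  finally show ?thesis .
qed

text \<open>The shifted argument gives absolute convergence for \<open>Re z \<ge> 1\<close> even
  with coefficients of order sqrt n. In this form Pascal's rule yields a difference equation, and
  \<open>cseries_eq_nseries\<close> links it to a Newton series that continues past 0.\<close>

definition cseries :: "complex \<Rightarrow> (nat \<Rightarrow> complex) \<Rightarrow> complex \<Rightarrow> complex" where
  "cseries \<beta> v z = (\<Sum>n. geom \<beta> v n * newt n (z + 1))"

lemma cseries_0: "cseries \<beta> v 0 = v 0"
proof -
  have "cseries \<beta> v 0 = (\<Sum>n\<in>{0}. geom \<beta> v n * newt n (0 + 1))"
    unfolding cseries_def by (intro suminf_finite) (auto simp: newt_1)
  then show ?thesis by simp
qed

text \<open>Let A and B be the Newton series at z with coefficients b_n and b_{n+1}, where b is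
  \<open>geom \<beta> v\<close>. Then \<open>cseries\<close> is A - B at z by Pascal's rule and A at
  z - 1, while the recursion of \<open>geom\<close> gives \<open>nseries v z\<close> = B - beta
  A.\<close>

lemma cseries_step:
  assumes v: "sqbd v" and \<beta>: "norm \<beta> \<le> 1" and z: "reg z"
  shows "cseries \<beta> v z - (1 - \<beta>) * cseries \<beta> v (z - 1) = - nseries v z"
proof -
  let ?b = "geom \<beta> v"
  obtain K where K: "\<And>m. norm (?b m) \<le> K * sqrt (real m + 1)"
    using geom_bound[OF v \<beta>] by blast
  obtain A where A: "(\<lambda>n. ?b n * newt n z) sums A"
    using summable_newt[OF K z] by (auto simp: summable_def)
  obtain B where B: "(\<lambda>n. ?b (Suc n) * newt n z) sums B"
    using summable_newt[OF shift_bound[of ?b K] z] K by (auto simp: summable_def)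
  have "(\<lambda>n. ?b (Suc n) * newt (Suc n) z) sums (A - ?b 0)"
    using A by (subst sums_Suc_iff) simp
  from sums_diff[OF this B] have "(\<lambda>n. ?b (Suc n) * newt (Suc n) (z + 1)) sums (A - ?b 0 - B)"
    by (simp add: newt_pascal right_diff_distrib)
  then have "(\<lambda>n. ?b n * newt n (z + 1)) sums (A - B)"
    by (subst (asm) sums_Suc_iff) (simp add: algebra_simps)
  then have 1: "cseries \<beta> v z = A - B" by (simp add: cseries_def sums_iff)
  have 2: "cseries \<beta> v (z - 1) = A" using A by (simp add: cseries_def sums_iff)
  have "(\<lambda>n. v (Suc n) * newt n z) sums (B - \<beta> * A)"
    using sums_diff[OF B sums_mult[OF A, of \<beta>]] by (simp add: geom_Suc algebra_simps)
  then have 3: "nseries v z = B - \<beta> * A" by (simp add: nseries_def sums_iff)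
  show ?thesis unfolding 1 2 3 by (simp add: algebra_simps)
qed

lemma cseries_eq_nseries:
  assumes v: "sqbd v" and \<beta>: "norm \<beta> \<le> 1" and z: "Re z \<ge> 1"
  shows "cseries \<beta> v z = v 0 - z * nseries (\<lambda>m. geom \<beta> v m / of_nat m) z"
proof -
  let ?b = "geom \<beta> v"
  obtain K where K: "\<And>m. norm (?b m) \<le> K * sqrt (real m + 1)"
    using geom_bound[OF v \<beta>] by blast
  have "reg (z + 1)" using z by (simp add: reg_def)
  then have S: "summable (\<lambda>n. ?b n * newt n (z + 1))" by (rule summable_newt[OF K])
  have eq: "?b (Suc n) * newt (Suc n) (z + 1) = (- z) * (?b (Suc n) / of_nat (Suc n) * newt n z)" for n
    by (simp add: newt_Suc_plus_1 del: of_nat_Suc)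
  have "summable (\<lambda>n. (- z) * (?b (Suc n) / of_nat (Suc n) * newt n z))"
    using S unfolding eq[symmetric] by (subst summable_Suc_iff)
  moreover have "- z \<noteq> 0" using z by auto
  ultimately have "summable (\<lambda>n. ?b (Suc n) / of_nat (Suc n) * newt n z)"
    by (subst (asm) summable_cmult_iff) auto
  from suminf_mult[OF this, of "- z"] suminf_split_head[OF S] show ?thesis
    unfolding eq by (simp add: cseries_def nseries_def algebra_simps)
qed

lemma cseries_strip_bound:
  assumes v: "sqbd v" and \<beta>: "norm \<beta> \<le> 1"
  obtains K where "K \<ge> 0" "\<And>z. 1 \<le> Re z \<Longrightarrow> Re z \<le> 2 \<Longrightarrow>
    norm (cseries \<beta> v z) \<le> K * ((2 + \<bar>Im z\<bar>) ^ 3 * exp (pi * \<bar>Im z\<bar> / 2))"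
proof -
  obtain K where K: "K \<ge> 0" "\<And>m. norm (geom \<beta> v m) \<le> K * sqrt (real m + 1)"
    using geom_bound[OF v \<beta>] by blast
  let ?s = "\<lambda>n. (real n + 1) powr (-3/2)"
  have s: "summable ?s" by (rule summable_powr_Suc) simp
  show ?thesis
  proof (rule that[of "16 * K * suminf ?s"])
    show "16 * K * suminf ?s \<ge> 0" using K(1) by (intro mult_nonneg_nonneg suminf_nonneg[OF s]) auto
    fix z assume z: "1 \<le> Re z" "Re z \<le> 2"
    let ?E = "(2 + \<bar>Im z\<bar>) ^ 3 * exp (pi * \<bar>Im z\<bar> / 2)"
    have le: "norm (geom \<beta> v n * newt n (z + 1)) \<le> 16 * K * ?E * ?s n" for n
    proof -
      have "norm (geom \<beta> v n) * norm (newt n (z + 1)) \<le> (K * sqrt (real n + 1)) *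
         (16 * (2 + \<bar>Im (z + 1)\<bar>) ^ 3 * exp (pi * \<bar>Im (z + 1)\<bar> / 2) / (real n + 1)\<^sup>2)"
        using K z by (intro mult_mono K norm_newt_le_strip) auto
      also have "\<dots> = 16 * K * ?E * (sqrt (real n + 1) / (real n + 1)\<^sup>2)" by simp
      finally show ?thesis unfolding sqrt_times_inverse_square by (simp add: norm_mult)
    qed
    have "norm (cseries \<beta> v z) \<le> (\<Sum>n. 16 * K * ?E * ?s n)"
      unfolding cseries_def by (intro norm_suminf_le le summable_mult s)
    also have "\<dots> = 16 * K * ?E * suminf ?s" by (rule suminf_mult[OF s])
    finally show "norm (cseries \<beta> v z) \<le> 16 * K * suminf ?s * ?E" by (simp add: mult_ac)
  qed
qed

text \<open>Dividing D by alpha^z gives a function p of period 1. As |arg alpha| < pi/2, the type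
  rises from pi to at most 3 pi/2, below 2 pi, so p is constant on a strip with value p(0) = 0. The
  identity theorem spreads the vanishing of D to the half plane.\<close>

lemma twisted_periodic_eq_0:
  fixes D :: "complex \<Rightarrow> complex"
  assumes hol: "D holomorphic_on {z. Re z > -1/4}"
    and rec: "\<And>z. reg z \<Longrightarrow> D z = \<alpha> * D (z - 1)" and D0: "D 0 = 0"
    and growth: "\<And>z. 1 \<le> Re z \<Longrightarrow> Re z \<le> 2 \<Longrightarrow>
       norm (D z) \<le> K * ((2 + \<bar>Im z\<bar>) ^ 6 * exp (pi * \<bar>Im z\<bar>))"
    and \<alpha>: "Re \<alpha> > 0" and z: "Re z > -1/4"
  shows "D z = 0"
proof -
  define p where "p = (\<lambda>z. D z * exp (- z * Ln \<alpha>))"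
  have nz: "\<alpha> \<noteq> 0" using \<alpha> by auto
  have K: "K \<ge> 0"
    using order_trans[OF norm_ge_zero growth[of 1]] by (simp add: zero_le_mult_iff)
  have per: "p w = p (w - 1)" if "reg w" for w
  proof -
    have "p w = D (w - 1) * (exp (Ln \<alpha>) * exp (- w * Ln \<alpha>))"
      using rec[OF that] nz by (simp add: p_def)
    also have "exp (Ln \<alpha>) * exp (- w * Ln \<alpha>) = exp (- (w - 1) * Ln \<alpha>)"
      by (simp flip: exp_add add: algebra_simps)
    finally show ?thesis by (simp only: p_def)
  qed
  define M where "M = exp (2 * \<bar>ln (norm \<alpha>)\<bar>)"
  \<comment> \<open>The sixth power of (2 + y)/24 <= exp(y/24): since 24 = 6 * 4, the polynomial
    costs only 1/4 in the exponent.\<close>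
  have poly: "(2 + y) ^ 6 \<le> 24 ^ 6 * exp (y / 4)" if "y \<ge> 0" for y :: real
  proof -
    have "(2 + y) / 24 \<le> 1 + y / 24" by (simp add: add_divide_distrib)
    also have "\<dots> \<le> exp (y / 24)" by (rule exp_ge_add_one_self)
    finally have "(2 + y) / 24 \<le> exp (y / 24)" .
    then have "((2 + y) / 24) ^ 6 \<le> exp (y / 24) ^ 6" using that by (intro power_mono) auto
    then show ?thesis by (simp add: power_divide exp_of_nat_mult[symmetric] field_simps)
  qed
  have p_growth: "norm (p w) \<le> (K * 24 ^ 6 * M) * exp (7/8 * (2 * pi * \<bar>Im w\<bar>))"
    if w: "1 \<le> Re w" "Re w \<le> 2" for w
  proof -
    define y where "y = \<bar>Im w\<bar>"
    have y: "y \<ge> 0" by (simp add: y_def)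
    have "norm (exp (- w * Ln \<alpha>)) = exp (Im w * Im (Ln \<alpha>) - Re w * ln (norm \<alpha>))"
      using nz by (simp add: norm_exp_eq_Re)
    also have "\<dots> \<le> exp (pi / 2 * y + 2 * \<bar>ln (norm \<alpha>)\<bar>)"
    proof -
      have "\<bar>Im (Ln \<alpha>)\<bar> \<le> pi / 2" using Re_Ln_pos_lt[OF nz] \<alpha> by simp
      then have "\<bar>Im w\<bar> * \<bar>Im (Ln \<alpha>)\<bar> \<le> \<bar>Im w\<bar> * (pi / 2)" by (intro mult_left_mono) auto
      then have "Im w * Im (Ln \<alpha>) \<le> pi / 2 * y"
        using abs_ge_self[of "Im w * Im (Ln \<alpha>)"] by (simp add: abs_mult y_def mult_ac)
      moreover have "- (Re w * ln (norm \<alpha>)) \<le> 2 * \<bar>ln (norm \<alpha>)\<bar>"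
      proof -
        have "- (Re w * ln (norm \<alpha>)) \<le> \<bar>Re w\<bar> * \<bar>ln (norm \<alpha>)\<bar>"
          using abs_ge_minus_self[of "Re w * ln (norm \<alpha>)"] by (simp add: abs_mult)
        also have "\<dots> \<le> 2 * \<bar>ln (norm \<alpha>)\<bar>" using w by (intro mult_right_mono) auto
        finally show ?thesis .
      qed
      ultimately show ?thesis by simp
    qed
    finally have e: "norm (exp (- w * Ln \<alpha>)) \<le> M * exp (pi / 2 * y)"
      by (simp add: exp_add M_def mult.commute)
    have "norm (p w) \<le> (K * ((24 ^ 6 * exp (y / 4)) * exp (pi * y))) * (M * exp (pi / 2 * y))"
      unfolding p_def norm_mult using K poly[OF y] growth[OF w]
      by (intro mult_mono e) (auto intro!: order_trans[OF growth[OF w]] mult_left_mono mult_right_mono simp: y_def)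
    also have "\<dots> = (K * 24 ^ 6 * M) * exp ((1/4 + pi + pi / 2) * y)"
    proof -
      have e: "exp (y / 4) * exp (pi * y) * exp (pi / 2 * y) = exp ((1/4 + pi + pi / 2) * y)"
        unfolding exp_add[symmetric] by (simp add: algebra_simps)
      show ?thesis unfolding e[symmetric] by (simp only: mult_ac)
    qed
    also have "\<dots> \<le> (K * 24 ^ 6 * M) * exp (7/8 * (2 * pi * y))"
    proof -
      \<comment> \<open>The summands come from the polynomial factor, from the growth of D and from
        arg alpha; the inequality amounts to 1/4 <= pi/4.\<close>
      have "1/4 + pi + pi / 2 \<le> 7/8 * (2 * pi)" using pi_gt3 by simp
      from mult_right_mono[OF this y] show ?thesis
        using K by (intro mult_left_mono) (auto simp: M_def mult_ac)
    qed
    finally show ?thesis by (simp add: y_def)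
  qed
  have p_hol: "p holomorphic_on {z. Re z > 1/2}"
    unfolding p_def by (intro holomorphic_intros holomorphic_on_subset[OF hol]) auto
  \<comment> \<open>Periodicity at 2 and then at 1 leads down to \<open>D 0\<close>; this is where
    the isolated point 1 of \<open>reg\<close> enters.\<close>
  have "p 2 = 0"
    using per[of 2] per[of 1] D0 by (simp add: reg_def p_def)
  have zero: "D w = 0" if "1 < Re w" "Re w < 2" for w
  proof -
    have "p w = p 2"
      by (rule periodic_small_type_constant[OF p_hol _ p_growth]) (use that per in \<open>auto simp: reg_def\<close>)
    with \<open>p 2 = 0\<close> show ?thesis by (simp add: p_def)
  qed
  let ?S = "{z. Re z > -1/4}" and ?T = "{z. 1 < Re z} \<inter> {z. Re z < 2}"
  show ?thesis
  proof (rule analytic_continuation_open[of ?T ?S D "\<lambda>_. 0"])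
    show "open ?T" by (intro open_Int open_halfspace_Re_gt open_halfspace_Re_lt)
    show "open ?S" by (rule open_halfspace_Re_gt)
    have "3/2 \<in> ?T" by simp
    then show "?T \<noteq> {}" by blast
    show "connected ?S" by (intro convex_connected convex_halfspace_Re_gt)
  qed (use zero z hol in auto)
qed

section \<open>The interpolating functions of a word\<close>

text \<open>This absorbs \<open>delta\<close>: for n > 0 and |c| = 1, delta(c) c^n is the n-th power
  of \<open>beta c\<close>. So the character 1 needs no separate case, and 1 - beta never
  vanishes.\<close>

definition beta :: "complex \<Rightarrow> complex" where
  "beta c = (if c = 1 then 0 else c)"

lemma beta_1 [simp]: "beta 1 = 0"
  by (simp add: beta_def)

lemma norm_beta: "norm c = 1 \<Longrightarrow> norm (beta c) \<le> 1"
  by (simp add: beta_def)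

lemma beta_neq_1: "beta c \<noteq> 1"
  by (simp add: beta_def)

lemma Re_one_minus_beta: "norm c = 1 \<Longrightarrow> Re (1 - beta c) > 0"
proof (cases "c = 1")
  case False
  assume c: "norm c = 1"
  have "Re c \<noteq> 1"
  proof
    assume R: "Re c = 1"
    have "(Re c)\<^sup>2 + (Im c)\<^sup>2 = 1" using c by (simp add: cmod_def)
    with R have "Im c = 0" by simp
    with R False show False by (simp add: complex_eq_iff)
  qed
  then show ?thesis using complex_Re_le_cmod[of c] c False by (simp add: beta_def)
qed simp

text \<open>On Taylor coefficients, \<open>avg\<close> is integration against x + y_1 = dt/(t (1 -
  t)), and \<open>ydiff\<close> below is integration against y_beta - y_1.\<close>

definition avg :: "(nat \<Rightarrow> complex) \<Rightarrow> nat \<Rightarrow> complex" where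
  "avg f m = geom 1 f m / of_nat m"

definition ydiff :: "complex \<Rightarrow> (nat \<Rightarrow> complex) \<Rightarrow> nat \<Rightarrow> complex" where
  "ydiff \<beta> f m = (\<Sum>j<m. (\<beta> ^ (m - j) - 1) * f j) / of_nat m"

lemma sqbd_ydiff:
  assumes "sqbd f" "norm \<beta> \<le> 1"
  shows "sqbd (ydiff \<beta> f)"
    and "norm (\<Sum>j<m. (\<beta> ^ (m - j) - 1) * f j) \<le> 2 * (\<Sum>j\<le>m. norm (f j))"
proof -
  show *: "norm (\<Sum>j<m. (\<beta> ^ (m - j) - 1) * f j) \<le> 2 * (\<Sum>j\<le>m. norm (f j))" for m
  proof -
    have "norm (\<Sum>j<m. (\<beta> ^ (m - j) - 1) * f j) \<le> (\<Sum>j<m. 2 * norm (f j))"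
    proof (rule order_trans[OF norm_sum], rule sum_mono)
      fix j
      have "norm (\<beta> ^ (m - j) - 1) \<le> norm \<beta> ^ (m - j) + 1"
        using norm_triangle_ineq4[of "\<beta> ^ (m - j)" 1] by (simp add: norm_power)
      also have "\<dots> \<le> 2" using power_le_one[of "norm \<beta>" "m - j"] assms by simp
      finally show "norm ((\<beta> ^ (m - j) - 1) * f j) \<le> 2 * norm (f j)"
        by (simp add: norm_mult mult_right_mono)
    qed
    also have "\<dots> \<le> (\<Sum>j\<le>m. 2 * norm (f j))" by (intro sum_mono2) auto
    finally show ?thesis by (simp add: sum_distrib_left)
  qed
  show "sqbd (ydiff \<beta> f)"
    by (rule sqbd_average[OF assms(1), of _ 2])
       (auto simp: ydiff_def norm_divide intro!: divide_right_mono *)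
qed

text \<open>Each application of \<open>avg\<close> divides the Newton series by z: by
  \<open>mult_nseries\<close>, multiplication by z takes differences of the partial sums
  \<open>geom 1 f\<close>, which are the values of f.\<close>

lemma avg_funpow:
  assumes "sqbd f" "f 0 = 0"
  shows "sqbd ((avg ^^ k) f)" and "(avg ^^ k) f 0 = 0"
    and "reg z \<Longrightarrow> z ^ k * nseries ((avg ^^ k) f) z = nseries f z"
proof -
  have *: "sqbd ((avg ^^ k) f) \<and> (avg ^^ k) f 0 = 0" for k
  proof (induction k)
    case (Suc k)
    then show ?case using sqbd_geom_divide[of "(avg ^^ k) f" 1] by (simp add: avg_def[abs_def])
  qed (use assms in auto)
  then show "sqbd ((avg ^^ k) f)" "(avg ^^ k) f 0 = 0" by auto
  show "z ^ k * nseries ((avg ^^ k) f) z = nseries f z" if z: "reg z"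
  proof (induction k)
    case (Suc k)
    let ?g = "(avg ^^ k) f"
    obtain K where "\<And>m. norm (geom 1 ?g m) \<le> K * sqrt (real m + 1)"
      using geom_bound[OF conjunct1[OF *] eq_refl[OF norm_one]] by blast
    then have "z * nseries (\<lambda>m. geom 1 ?g m / of_nat m) z = nseries ?g z"
      using * z by (subst mult_nseries) (auto simp: geom_Suc nseries_def)
    moreover have "avg ?g = (\<lambda>m. geom 1 ?g m / of_nat m)" by (simp add: avg_def fun_eq_iff)
    ultimately have "z * nseries (avg ?g) z = nseries ?g z" by simp
    moreover have "z ^ Suc k * nseries ((avg ^^ Suc k) f) z = z ^ k * (z * nseries (avg ?g) z)"
      by simp
    ultimately show ?case using Suc by simp
  qed simp
qed

text \<open>The numerators of \<open>ydiff\<close> have increments (beta - 1) times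
  \<open>geom\<close>, so \<open>mult_nseries\<close> produces a \<open>cseries\<close> at the
  shifted point z - 1.\<close>

lemma mult_nseries_ydiff:
  assumes f: "sqbd f" and \<beta>: "norm \<beta> \<le> 1" and z: "reg z"
  shows "z * nseries (ydiff \<beta> f) z = - (1 - \<beta>) * cseries \<beta> f (z - 1)"
proof -
  define h where "h = (\<lambda>m. \<Sum>j<m. (\<beta> ^ (m - j) - 1) * f j)"
  obtain K where K: "K \<ge> 0" "\<And>m. (\<Sum>j\<le>m. norm (f j)) \<le> K * sqrt (real m + 1)"
    using sqbd_sum_norm[OF f] by metis
  have bd: "norm (h m) \<le> (2 * K) * sqrt (real m + 1)" for m
    using sqbd_ydiff(2)[OF f \<beta>, of m] K(2)[of m] by (simp add: h_def)
  have h_Suc: "h (Suc n) - h n = (\<beta> - 1) * geom \<beta> f n" for n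
  proof -
    have "h (Suc n) - h n = (\<beta> - 1) * f n +
       (\<Sum>j<n. (\<beta> ^ (Suc n - j) - 1) * f j - (\<beta> ^ (n - j) - 1) * f j)"
      by (simp add: h_def sum_subtractf)
    also have "(\<Sum>j<n. (\<beta> ^ (Suc n - j) - 1) * f j - (\<beta> ^ (n - j) - 1) * f j) =
        (\<Sum>j<n. (\<beta> - 1) * (\<beta> ^ (n - j) * f j))"
      by (intro sum.cong) (auto simp: Suc_diff_le algebra_simps)
    also have "(\<beta> - 1) * f n + \<dots> = (\<beta> - 1) * geom \<beta> f n"
      by (simp add: geom_def sum_distrib_left distrib_left lessThan_Suc_atMost[symmetric])
    finally show ?thesis .
  qed
  obtain L where L: "\<And>m. norm (geom \<beta> f m) \<le> L * sqrt (real m + 1)"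
    using geom_bound[OF f \<beta>] by blast
  have "z * nseries (ydiff \<beta> f) z = (\<Sum>n. (h (Suc n) - h n) * newt n z)"
    using mult_nseries[OF bd _ z] by (simp add: h_def ydiff_def[abs_def])
  also have "\<dots> = (\<Sum>n. (\<beta> - 1) * (geom \<beta> f n * newt n z))"
    by (simp add: h_Suc mult.assoc)
  also have "\<dots> = (\<beta> - 1) * (\<Sum>n. geom \<beta> f n * newt n z)"
    by (rule suminf_mult[OF summable_newt[OF L z]])
  finally show ?thesis by (simp add: cseries_def)
qed

text \<open>The coefficients of the iterated integral of \<open>\<phi>(I(M\<^sub>s(w)))\<close>, where \<open>w\<close> is the word of \<open>zs\<close>.\<close>

fun vcoeff :: "complex \<Rightarrow> (nat \<times> complex) list \<Rightarrow> nat \<Rightarrow> complex" where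
  "vcoeff s [] = (\<lambda>m. if m = 0 then 1 else 0)"
| "vcoeff s ((k, t) # zs) = (avg ^^ (k - 1)) (ydiff (beta (s * t)) (vcoeff (s * t) zs))"

lemma sqbd_vcoeff: "zs \<in> zlists \<Longrightarrow> norm s = 1 \<Longrightarrow> sqbd (vcoeff s zs)"
proof (induction s zs rule: vcoeff.induct)
  case (1 s)
  show ?case by (auto simp: sqbd_def intro!: exI[of _ 0])
next
  case (2 s k t zs)
  then have st: "norm (s * t) = 1" and "zs \<in> zlists" by (auto simp: norm_mult)
  then have "sqbd (vcoeff (s * t) zs)" by (rule 2(1)[rotated])
  then have "sqbd (ydiff (beta (s * t)) (vcoeff (s * t) zs))"
    by (rule sqbd_ydiff(1)[OF _ norm_beta[OF st]])
  then show ?case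
    unfolding vcoeff.simps by (rule avg_funpow(1)) (simp add: ydiff_def)
qed

lemma vcoeff_0: "zs \<noteq> [] \<Longrightarrow> zs \<in> zlists \<Longrightarrow> norm s = 1 \<Longrightarrow> vcoeff s zs 0 = 0"
proof (cases zs)
  case (Cons p zs')
  assume *: "zs \<in> zlists" "norm s = 1"
  obtain k t where p: "p = (k, t)" by (cases p)
  have st: "norm (s * t) = 1" and zs': "zs' \<in> zlists" using * Cons p by (auto simp: norm_mult)
  show ?thesis unfolding Cons p vcoeff.simps
    by (rule avg_funpow(2)[OF sqbd_ydiff(1)[OF sqbd_vcoeff[OF zs' st] norm_beta[OF st]]])
       (simp add: ydiff_def)
qed simp

definition gfun :: "complex \<Rightarrow> (nat \<times> complex) list \<Rightarrow> complex \<Rightarrow> complex" where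
  "gfun s zs = nseries (\<lambda>m. geom (beta s) (vcoeff s zs) m / of_nat m)"

text \<open>For a nonempty list the constant term vanishes and -z \<open>gfun\<close> remains; for
  the empty list it supplies the value 1 at 0. The function agrees with \<open>cseries\<close> for
  \<open>Re z \<ge> 1\<close> and at 0, and so continues it to a half plane containing 0.\<close>

definition cfun :: "complex \<Rightarrow> (nat \<times> complex) list \<Rightarrow> complex \<Rightarrow> complex" where
  "cfun s zs z = vcoeff s zs 0 - z * gfun s zs z"

lemma gfun_holomorphic:
  "zs \<in> zlists \<Longrightarrow> norm s = 1 \<Longrightarrow> gfun s zs holomorphic_on {z. Re z > -1/4}"
  unfolding gfun_def by (intro nseries_holomorphic sqbd_vcoeff norm_beta beta_neq_1)

lemma cfun_holomorphic:
  "zs \<in> zlists \<Longrightarrow> norm s = 1 \<Longrightarrow> cfun s zs holomorphic_on {z. Re z > -1/4}"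
  unfolding cfun_def[abs_def] by (intro holomorphic_intros gfun_holomorphic)

lemma cfun_eq_cseries:
  assumes "zs \<in> zlists" "norm s = 1" "Re z \<ge> 1 \<or> z = 0"
  shows "cfun s zs z = cseries (beta s) (vcoeff s zs) z"
  using assms cseries_eq_nseries[of "vcoeff s zs" "beta s" z]
  by (auto simp: cfun_def gfun_def cseries_0 sqbd_vcoeff norm_beta)

lemma cfun_0: "zs \<in> zlists \<Longrightarrow> norm s = 1 \<Longrightarrow> cfun s zs 0 = (if zs = [] then 1 else 0)"
  by (simp add: cfun_def vcoeff_0)

lemma reg_cases: "reg z \<Longrightarrow> (Re z \<ge> 1 \<or> z = 0) \<and> (Re (z - 1) \<ge> 1 \<or> z - 1 = 0)"
  by (auto simp: reg_def)

lemma cfun_step: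
  assumes "zs \<in> zlists" "norm s = 1" "reg z"
  shows "cfun s zs z = (1 - beta s) * cfun s zs (z - 1) - nseries (vcoeff s zs) z"
  using cseries_step[of "vcoeff s zs" "beta s" z] assms reg_cases[OF assms(3)]
  by (simp add: cfun_eq_cseries sqbd_vcoeff norm_beta algebra_simps)

lemma cfun_Nil_step:
  assumes "norm s = 1" "reg z"
  shows "cfun s [] z = (1 - beta s) * cfun s [] (z - 1)"
  using cfun_step[of "[]" s z] assms by (simp add: nseries_def)

text \<open>At an integer z = N the two summands are the parts of the interpolated sum with m_1 < N
  and with m_1 = N. For general z, powers of z are removed by \<open>avg_funpow\<close> and the
  remaining integration by \<open>mult_nseries_ydiff\<close>.\<close>

lemma cfun_Cons_step:
  assumes "(k, t) # zs \<in> zlists" "norm s = 1" "reg z"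
  shows "cfun s ((k, t) # zs) z = (1 - beta s) * cfun s ((k, t) # zs) (z - 1) +
    (1 - beta (s * t)) / z ^ k * cfun (s * t) zs (z - 1)"
proof -
  have st: "norm (s * t) = 1" and zs: "zs \<in> zlists" and k: "k \<ge> 1"
    using assms by (auto simp: norm_mult)
  let ?y = "ydiff (beta (s * t)) (vcoeff (s * t) zs)"
  have y: "sqbd ?y" "?y 0 = 0"
    by (rule sqbd_ydiff(1)[OF sqbd_vcoeff[OF zs st] norm_beta[OF st]]) (simp add: ydiff_def)
  have "z ^ k * nseries (vcoeff s ((k, t) # zs)) z = z * (z ^ (k - 1) * nseries ((avg ^^ (k - 1)) ?y) z)"
    using k by (cases k) auto
  also have "\<dots> = z * nseries ?y z"
    using avg_funpow(3)[OF y assms(3)] by simp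
  also have "\<dots> = - (1 - beta (s * t)) * cseries (beta (s * t)) (vcoeff (s * t) zs) (z - 1)"
    using st zs assms(3) by (intro mult_nseries_ydiff sqbd_vcoeff norm_beta)
  also have "cseries (beta (s * t)) (vcoeff (s * t) zs) (z - 1) = cfun (s * t) zs (z - 1)"
    using cfun_eq_cseries[OF zs st] reg_cases[OF assms(3)] by simp
  finally have N: "nseries (vcoeff s ((k, t) # zs)) z =
      - ((1 - beta (s * t)) / z ^ k * cfun (s * t) zs (z - 1))"
    using reg_nonzero[OF assms(3)] by (simp add: field_simps)
  show ?thesis unfolding cfun_step[OF assms] N by simp
qed

lemma cfun_one_Nil: "cfun 1 [] z = 1"
proof -
  have "geom 0 (\<lambda>m. if m = 0 then 1 else 0) (Suc n) = 0" for n
    by (simp add: geom_Suc)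
  then show ?thesis by (simp add: cfun_def gfun_def nseries_def)
qed

lemma cfun_strip_bound:
  assumes "zs \<in> zlists" "norm s = 1"
  obtains K where "K \<ge> 0" "\<And>z. 1 \<le> Re z \<Longrightarrow> Re z \<le> 2 \<Longrightarrow>
    norm (cfun s zs z) \<le> K * ((2 + \<bar>Im z\<bar>) ^ 3 * exp (pi * \<bar>Im z\<bar> / 2))"
  using cseries_strip_bound[OF sqbd_vcoeff[OF assms] norm_beta[OF assms(2)]] cfun_eq_cseries[OF assms]
  by metis

text \<open>Induction on the total length. The quasi-shuffle recursion and
  \<open>cfun_Cons_step\<close> express the difference D of the two sides at z through z - 1; the
  inhomogeneous terms involve shorter pairs of words and cancel by induction. What is left is the
  situation of \<open>twisted_periodic_eq_0\<close>.\<close>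

lemma cfun_mult:
  assumes "u \<in> zlists" "v \<in> zlists" "\<forall>(k, c)\<in>set v. c = 1" "norm s = 1" "Re z > -1/4"
  shows "lext (\<lambda>w. cfun s (zparse w) z) (harmz u v) = cfun s u z * cfun 1 v z"
  using assms
proof (induction "length u + length v" arbitrary: u v s z rule: less_induct)
  case less
  note u = less.prems(1) and v = less.prems(2) and v1 = less.prems(3) and s = less.prems(4)
  have one: "norm (1::complex) = 1" by simp
  show ?case
  proof (cases "v = []")
    case True
    then show ?thesis using u by (cases u) (auto simp: cfun_one_Nil simp del: zword.simps)
  next
    case False
    then obtain l v' where v_eq: "v = (l, 1) # v'" using v1 by (cases v) auto
    have v': "v' \<in> zlists" "\<forall>(k, c)\<in>set v'. c = 1" using v v1 v_eq by auto
    let ?W = "zword ` {q \<in> zlists. q \<noteq> [] \<or> u = [] \<and> v = []}"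
    have supp: "supported ?W (harmz u v)" by (rule supported_harmz[OF u v])
    define D where "D = (\<lambda>z. lext (\<lambda>w. cfun s (zparse w) z) (harmz u v) - cfun s u z * cfun 1 v z)"
    have IH: "lext (\<lambda>w. cfun s' (zparse w) (z - 1)) (harmz u1 v1) = cfun s' u1 (z - 1) * cfun 1 v1 (z - 1)"
      if "length u1 + length v1 < length u + length v" "u1 \<in> zlists" "v1 \<in> zlists"
        "\<forall>(k, c)\<in>set v1. c = 1" "norm s' = 1" "reg z" for s' u1 v1 z
      using that reg_cases[OF that(6)] by (intro less.hyps) auto
    have step_v: "cfun 1 v z = cfun 1 v (z - 1) + 1 / z ^ l * cfun 1 v' (z - 1)" if "reg z" for z
      using cfun_Cons_step[of l 1 v' 1 z] v v_eq that by simp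
    have step: "lext (\<lambda>w. cfun s ((k, t) # zparse w) z) (harmz u1 v1) =
        (1 - beta s) * lext (\<lambda>w. cfun s ((k, t) # zparse w) (z - 1)) (harmz u1 v1) +
        (1 - beta (s * t)) / z ^ k * lext (\<lambda>w. cfun (s * t) (zparse w) (z - 1)) (harmz u1 v1)"
      if "u1 \<in> zlists" "v1 \<in> zlists" "[(k, t)] \<in> zlists" "reg z" for k t u1 v1 z
    proof -
      have "lext (\<lambda>w. cfun s ((k, t) # zparse w) z) (harmz u1 v1) =
         lext (\<lambda>w. (1 - beta s) * cfun s ((k, t) # zparse w) (z - 1) +
           (1 - beta (s * t)) / z ^ k * cfun (s * t) (zparse w) (z - 1)) (harmz u1 v1)"
        using that s by (intro lext_cong[OF supported_harmz[OF that(1,2)]] cfun_Cons_step) auto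
      then show ?thesis by (simp only: lext_add lext_cmult)
    qed
    have rec: "D z = (1 - beta s) * D (z - 1)" if z: "reg z" for z
    proof (cases u)
      case Nil
      \<comment> \<open>An empty \<open>u\<close> is not a trivial case: \<open>cfun s []\<close>
        acquires the factor 1 - beta(s) at each step and need not be 1.\<close>
      have e: "lext (\<lambda>w. cfun s (zparse w) z) (harmz u v) = cfun s v z" for z
        using v by (simp add: Nil)
      have "cfun s v' (z - 1) = cfun s [] (z - 1) * cfun 1 v' (z - 1)"
        using IH[of "[]" v' s z] v' s z v_eq Nil by simp
      then have sv: "cfun s v z = (1 - beta s) * cfun s v (z - 1) +
          (1 - beta s) / z ^ l * (cfun s [] (z - 1) * cfun 1 v' (z - 1))"
        using cfun_Cons_step[of l 1 v' s z] v v_eq s z by simp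
      show ?thesis
        unfolding D_def e unfolding Nil sv cfun_Nil_step[OF s z] step_v[OF z]
        by (simp add: algebra_simps add_divide_distrib diff_divide_distrib)
    next
      case (Cons p u')
      obtain k t where p: "p = (k, t)" by (cases p)
      have u': "u' \<in> zlists" and t: "norm t = 1" and kl: "[(k, t)] \<in> zlists" "[(l, 1)] \<in> zlists"
          "[(k + l, t * 1)] \<in> zlists"
        using u v Cons p v_eq by auto
      have st: "norm (s * t) = 1" using s t by (simp add: norm_mult)
      have split: "lext (\<lambda>w. cfun s (zparse w) z) (harmz u v) =
          lext (\<lambda>w. cfun s ((k, t) # zparse w) z) (harmz u' v) +
          lext (\<lambda>w. cfun s ((l, 1) # zparse w) z) (harmz u v') +
          lext (\<lambda>w. cfun s ((k + l, t * 1) # zparse w) z) (harmz u' v')" for z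
        using u v unfolding Cons p v_eq by (rule lext_harmz_Cons)
      have su: "cfun s u z = (1 - beta s) * cfun s u (z - 1) +
          (1 - beta (s * t)) / z ^ k * cfun (s * t) u' (z - 1)"
        using cfun_Cons_step[of k t u' s z] u s z Cons p by simp
      have I1: "lext (\<lambda>w. cfun (s * t) (zparse w) (z - 1)) (harmz u' v) = cfun (s * t) u' (z - 1) * cfun 1 v (z - 1)"
        by (rule IH) (use Cons u' v v1 st z in auto)
      have I2: "lext (\<lambda>w. cfun (s * 1) (zparse w) (z - 1)) (harmz u v') = cfun (s * 1) u (z - 1) * cfun 1 v' (z - 1)"
        by (rule IH) (use v_eq u v' s z in auto)
      have I3: "lext (\<lambda>w. cfun (s * (t * 1)) (zparse w) (z - 1)) (harmz u' v') =
          cfun (s * (t * 1)) u' (z - 1) * cfun 1 v' (z - 1)"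
        by (rule IH) (use v_eq u' Cons v' st z in auto)
      \<comment> \<open>Here \<alpha> and a are 1 - beta at s and at s t, p and q are z^k and z^l,
        primes mark words without their heads, and A1, A2, A3 are the three quasi-shuffle parts at z
        - 1. The head of \<open>v\<close> has character 1 and leaves s unchanged, so \<alpha> also
        stands over q.\<close>
      have alg: "(\<alpha> * A1 + a / p * (x' * y)) + (\<alpha> * A2 + \<alpha> / q * (x * y')) + (\<alpha> * A3 + a / (p * q) * (x' * y'))
          - (\<alpha> * x + a / p * x') * (y + 1 / q * y') = \<alpha> * ((A1 + A2 + A3) - x * y)"
        for \<alpha> a p q x x' y y' A1 A2 A3 :: complex
        by (simp add: algebra_simps add_divide_distrib)
      show ?thesis
        unfolding D_def split step[OF u' v kl(1) z] step[OF u v'(1) kl(2) z] step[OF u' v'(1) kl(3) z]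
          I1 I2 I3 su step_v[OF z]
        unfolding mult_1_right power_add by (rule alg)
    qed
    have hol: "D holomorphic_on {z. Re z > -1/4}"
      unfolding D_def lext_def
      by (intro holomorphic_intros cfun_holomorphic u v s one) (use supp in \<open>auto simp: supported_def\<close>)
    have D0: "D 0 = 0"
    proof -
      have "lext (\<lambda>w. cfun s (zparse w) 0) (harmz u v) = lext (\<lambda>w. 0) (harmz u v)"
        by (rule lext_cong[OF supp]) (use s False in \<open>auto simp: cfun_0\<close>)
      then show ?thesis using u v s False by (simp add: D_def cfun_0)
    qed
    have "D z = 0"
    proof -
      obtain K1 where K1: "K1 \<ge> 0" "\<And>z. 1 \<le> Re z \<Longrightarrow> Re z \<le> 2 \<Longrightarrow>
          norm (cfun s u z) \<le> K1 * ((2 + \<bar>Im z\<bar>) ^ 3 * exp (pi * \<bar>Im z\<bar> / 2))"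
        using cfun_strip_bound[OF u s] by blast
      obtain K2 where K2: "K2 \<ge> 0" "\<And>z. 1 \<le> Re z \<Longrightarrow> Re z \<le> 2 \<Longrightarrow>
          norm (cfun 1 v z) \<le> K2 * ((2 + \<bar>Im z\<bar>) ^ 3 * exp (pi * \<bar>Im z\<bar> / 2))"
        using cfun_strip_bound[OF v one] by blast
      have "\<forall>w\<in>?W. \<exists>K\<ge>0. \<forall>z. 1 \<le> Re z \<longrightarrow> Re z \<le> 2 \<longrightarrow>
          norm (cfun s (zparse w) z) \<le> K * ((2 + \<bar>Im z\<bar>) ^ 3 * exp (pi * \<bar>Im z\<bar> / 2))"
      proof
        fix w assume "w \<in> ?W"
        then have "zparse w \<in> zlists" by auto
        then show "\<exists>K\<ge>0. \<forall>z. 1 \<le> Re z \<longrightarrow> Re z \<le> 2 \<longrightarrow>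
          norm (cfun s (zparse w) z) \<le> K * ((2 + \<bar>Im z\<bar>) ^ 3 * exp (pi * \<bar>Im z\<bar> / 2))"
          using cfun_strip_bound[OF _ s] by metis
      qed
      from bchoice[OF this] obtain K where K': "\<forall>w\<in>?W. K w \<ge> 0 \<and> (\<forall>z. 1 \<le> Re z \<longrightarrow> Re z \<le> 2 \<longrightarrow>
          norm (cfun s (zparse w) z) \<le> K w * ((2 + \<bar>Im z\<bar>) ^ 3 * exp (pi * \<bar>Im z\<bar> / 2)))"
        by blast
      have K: "K w \<ge> 0" "1 \<le> Re z \<Longrightarrow> Re z \<le> 2 \<Longrightarrow>
          norm (cfun s (zparse w) z) \<le> K w * ((2 + \<bar>Im z\<bar>) ^ 3 * exp (pi * \<bar>Im z\<bar> / 2))"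
        if "w \<in> ?W" for w z
        using bspec[OF K' that] by auto
      let ?P = "harmz u v"
      define C where "C = (\<Sum>w\<in>{w. ?P w \<noteq> 0}. norm (of_rat (?P w) :: complex) * K w)"
      have C: "C \<ge> 0" unfolding C_def using supp K(1)
        by (intro sum_nonneg mult_nonneg_nonneg) (auto simp: supported_def)
      have growth: "norm (D z) \<le> (C + K1 * K2) * ((2 + \<bar>Im z\<bar>) ^ 6 * exp (pi * \<bar>Im z\<bar>))"
        if z: "1 \<le> Re z" "Re z \<le> 2" for z
      proof -
        define E where "E = (2 + \<bar>Im z\<bar>) ^ 3 * exp (pi * \<bar>Im z\<bar> / 2)"
        \<comment> \<open>Each function is bounded by a multiple of E, of type pi/2. The product
          needs E * E, of type pi, and E >= 1 brings the linear combination under the same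
          bound.\<close>
        have "1 ^ 3 * 1 \<le> E" unfolding E_def by (intro mult_mono power_mono) auto
        then have E: "1 \<le> E" by simp
        have EE: "(2 + \<bar>Im z\<bar>) ^ 6 * exp (pi * \<bar>Im z\<bar>) = E * E"
        proof -
          have "exp (pi * \<bar>Im z\<bar>) = exp (pi * \<bar>Im z\<bar> / 2) * exp (pi * \<bar>Im z\<bar> / 2)"
            by (simp flip: exp_add)
          moreover have "(2 + \<bar>Im z\<bar>) ^ 6 = (2 + \<bar>Im z\<bar>) ^ 3 * (2 + \<bar>Im z\<bar>) ^ 3"
            by (simp flip: power_add)
          ultimately show ?thesis by (simp add: E_def mult_ac)
        qed
        have "norm (lext (\<lambda>w. cfun s (zparse w) z) ?P) \<le>
            (\<Sum>w\<in>{w. ?P w \<noteq> 0}. norm (of_rat (?P w) :: complex) * (K w * E))"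
          unfolding lext_def
        proof (rule order_trans[OF norm_sum], rule sum_mono)
          fix w assume "w \<in> {w. ?P w \<noteq> 0}"
          then have "w \<in> ?W" using supp unfolding supported_def by blast
          from K(2)[OF this z]
          show "norm (of_rat (?P w) * cfun s (zparse w) z) \<le> norm (of_rat (?P w) :: complex) * (K w * E)"
            unfolding norm_mult E_def by (intro mult_left_mono) auto
        qed
        also have "\<dots> = C * E" by (simp add: C_def sum_distrib_right mult.assoc)
        also have "\<dots> \<le> C * (E * E)" using C E by (intro mult_left_mono) auto
        finally have 1: "norm (lext (\<lambda>w. cfun s (zparse w) z) ?P) \<le> C * (E * E)" .
        have "norm (cfun s u z * cfun 1 v z) \<le> (K1 * E) * (K2 * E)"
          unfolding norm_mult using K1 K2 z E by (intro mult_mono) (auto simp: E_def)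
        then have "norm (D z) \<le> C * (E * E) + (K1 * E) * (K2 * E)"
          unfolding D_def by (intro order_trans[OF norm_triangle_ineq4] add_mono 1)
        then show ?thesis unfolding EE by (simp add: algebra_simps)
      qed
      show ?thesis
        by (rule twisted_periodic_eq_0[OF hol rec D0 growth Re_one_minus_beta[OF s] less.prems(5)])
    qed
    then show ?thesis by (simp add: D_def)
  qed
qed

section \<open>Taylor coefficients of the interpolating functions\<close>

text \<open>The sign cancels the one in \<open>deriv_newt_0\<close>, so that
  \<open>tcoeff_tendsto\<close> shows a plain sum of coefficients weighted by truncated harmonic
  sums.\<close>

definition tcoeff :: "complex \<Rightarrow> (nat \<times> complex) list \<Rightarrow> nat \<Rightarrow> complex" where
  "tcoeff s zs k = (-1) ^ k * ((deriv ^^ k) (gfun s zs) 0 / fact k)"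

lemma newt_fps_expansion:
  "newt n has_fps_expansion (\<Prod>k=1..n. 1 - fps_X * fps_const (1 / of_nat k))"
proof -
  have "(\<lambda>z. \<Prod>k=1..n. 1 - z * (1 / of_nat k)) has_fps_expansion
      (\<Prod>k=1..n. 1 - fps_X * fps_const (1 / of_nat k) :: complex fps)"
    by (intro fps_expansion_intros)
  then show ?thesis by (simp add: newt_def[abs_def])
qed

text \<open>The coefficients of the product of the 1 - z/j, j = 1, ..., n, are up to sign the
  elementary symmetric functions of 1, 1/2, ..., 1/n, that is, harmonic sums with all indices and
  characters 1.\<close>

lemma deriv_newt_0:
  "(deriv ^^ k) (newt n) 0 / fact k = (-1) ^ k * hsum (replicate k (1, 1)) (Suc n)"
proof -
  have "fps_nth (\<Prod>k=1..n. 1 - fps_X * fps_const (1 / of_nat k)) k =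
      (-1) ^ k * hsum (replicate k (1, 1)) (Suc n)"
  proof (induction n arbitrary: k)
    case 0
    then show ?case by (cases k) auto
  next
    case (Suc n)
    let ?F = "\<Prod>k=1..n. 1 - fps_X * fps_const (1 / of_nat k) :: complex fps"
    have "(\<Prod>k=1..Suc n. 1 - fps_X * fps_const (1 / of_nat k) :: complex fps) =
        ?F - fps_X * (fps_const (1 / of_nat (Suc n)) * ?F)"
      by (simp add: prod.nat_ivl_Suc' algebra_simps)
    then show ?case
      using Suc.IH[of k] Suc.IH[of "k - 1"]
      by (cases k) (simp_all add: sum.atLeastLessThan_Suc algebra_simps)
  qed
  with fps_nth_fps_expansion[OF newt_fps_expansion, of n k] show ?thesis by simp
qed

lemma tcoeff_tendsto:
  assumes "zs \<in> zlists" "norm s = 1"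
  shows "(\<lambda>M. \<Sum>m<M. geom (beta s) (vcoeff s zs) m / of_nat m * hsum (replicate k (1, 1)) m)
    \<longlonglongrightarrow> tcoeff s zs k"
proof -
  let ?a = "\<lambda>m. geom (beta s) (vcoeff s zs) m / of_nat m"
  have "(\<lambda>M. (-1) ^ k / fact k * (\<Sum>n<M. ?a (Suc n) * (deriv ^^ k) (newt n) 0)) \<longlonglongrightarrow>
      (-1) ^ k / fact k * (deriv ^^ k) (nseries ?a) 0"
    by (intro tendsto_mult tendsto_const nseries_deriv_tendsto sqbd_vcoeff norm_beta beta_neq_1 assms)
  moreover have "(-1) ^ k / fact k * (\<Sum>n<M. ?a (Suc n) * (deriv ^^ k) (newt n) 0) =
      (\<Sum>n<M. ?a (Suc n) * hsum (replicate k (1, 1)) (Suc n))" for M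
  proof -
    have "(-1) ^ k / fact k * (c * (deriv ^^ k) (newt n) 0) = c * hsum (replicate k (1, 1)) (Suc n)"
      for c n
    proof -
      have "(-1) ^ k / fact k * (c * (deriv ^^ k) (newt n) 0) =
          c * ((-1) ^ k * ((deriv ^^ k) (newt n) 0 / fact k))" by simp
      also have "\<dots> = c * (((-1) ^ k * (-1) ^ k) * hsum (replicate k (1, 1)) (Suc n))"
        unfolding deriv_newt_0 by (simp only: mult.assoc)
      also have "(-1) ^ k * (-1) ^ k = (1::complex)" by (simp flip: power_mult_distrib)
      finally show ?thesis by simp
    qed
    then show ?thesis by (simp only: sum_distrib_left)
  qed
  ultimately have "(\<lambda>n. ?a (Suc n) * hsum (replicate k (1, 1)) (Suc n)) sums tcoeff s zs k"
    by (simp add: sums_def tcoeff_def gfun_def)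
  then have "(\<lambda>n. ?a n * hsum (replicate k (1, 1)) n) sums tcoeff s zs k"
    by (subst (asm) sums_Suc_iff) simp
  then show ?thesis by (simp add: sums_def)
qed

text \<open>For nonempty words \<open>cfun\<close> is -z \<open>gfun\<close>, so
  \<open>cfun_mult\<close> equates -z times a combination of \<open>gfun\<close> with z^2 times a
  product of two. The coefficient of z^(m+1) pairs degree m on one side with total degree m - 1 on
  the other; hence the sum is empty for m = 0.\<close>

lemma tcoeff_mult:
  assumes u: "u \<in> zlists" "u \<noteq> []" and v: "v \<in> zlists" "v \<noteq> []" "\<forall>(k, c)\<in>set v. c = 1"
    and s: "norm s = 1"
  shows "(\<Sum>l\<in>{1..m}. tcoeff s u (m - l) * tcoeff 1 v (l - 1)) =
    lext (\<lambda>w. tcoeff s (zparse w) m) (harmz u v)"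
proof -
  let ?H = "{z. Re z > -1/4}" and ?P = "harmz u v"
  let ?W = "zword ` {q \<in> zlists. q \<noteq> [] \<or> u = [] \<and> v = []}"
  have one: "norm (1::complex) = 1" by simp
  have H: "open ?H" "0 \<in> ?H" by (auto simp: open_halfspace_Re_gt)
  have supp: "supported ?W ?P" by (rule supported_harmz[OF u(1) v(1)])
  define F where "F = (\<lambda>s zs. fps_expansion (gfun s zs) 0)"
  have F: "gfun s zs has_fps_expansion F s zs" if "zs \<in> zlists" "norm s = 1" for s zs
    unfolding F_def by (rule has_fps_expansion_fps_expansion[OF H gfun_holomorphic[OF that]])
  have F_nth: "fps_nth (F s zs) k = (-1) ^ k * tcoeff s zs k" if "zs \<in> zlists" "norm s = 1" for s zs k
  proof -
    have "(-1) ^ k * (-1) ^ k = (1::complex)" by (simp flip: power_mult_distrib)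
    then show ?thesis
      unfolding fps_nth_fps_expansion[OF F[OF that]] tcoeff_def by (simp flip: mult.assoc)
  qed
  let ?L = "\<lambda>z. \<Sum>w\<in>{w. ?P w \<noteq> 0}. of_rat (?P w) * gfun s (zparse w) z"
  have eq: "- (z * ?L z) = z * (z * (gfun s u z * gfun 1 v z))" if "z \<in> ?H" for z
  proof -
    have "lext (\<lambda>w. cfun s (zparse w) z) ?P = lext (\<lambda>w. (- z) * gfun s (zparse w) z) ?P"
      by (rule lext_cong[OF supp]) (use u v s in \<open>auto simp: cfun_def vcoeff_0\<close>)
    then have "(- z) * lext (\<lambda>w. gfun s (zparse w) z) ?P = cfun s u z * cfun 1 v z"
      using cfun_mult[OF u(1) v(1,3) s, of z] that by (simp only: lext_cmult) simp
    also have "\<dots> = z * (z * (gfun s u z * gfun 1 v z))"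
      using u v s by (simp add: cfun_def vcoeff_0)
    finally show ?thesis by (simp add: lext_def)
  qed
  let ?G = "\<Sum>w\<in>{w. ?P w \<noteq> 0}. fps_const (of_rat (?P w)) * F s (zparse w)"
  have e1: "(\<lambda>z. - (z * ?L z)) has_fps_expansion - (fps_X * ?G)"
    using supp s by (intro fps_expansion_intros F) (auto simp: supported_def)
  have e2: "(\<lambda>z. z * (z * (gfun s u z * gfun 1 v z))) has_fps_expansion
      fps_X * (fps_X * (F s u * F 1 v))"
    by (intro fps_expansion_intros F u v s one)
  have e3: "eventually (\<lambda>z. - (z * ?L z) = z * (z * (gfun s u z * gfun 1 v z))) (nhds 0)"
    by (rule eventually_mono[OF eventually_nhds_in_open[OF H]]) (rule eq)
  have fps_eq: "- (fps_X * ?G) = fps_X * (fps_X * (F s u * F 1 v))"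
    by (rule fps_expansion_unique_complex[OF has_fps_expansion_cong[THEN iffD1, OF e3 refl e1] e2])
  have "fps_nth (- (fps_X * ?G)) (Suc m) = - (\<Sum>w\<in>{w. ?P w \<noteq> 0}. of_rat (?P w) * fps_nth (F s (zparse w)) m)"
    by (simp add: fps_sum_nth)
  also have "\<dots> = - (\<Sum>w\<in>{w. ?P w \<noteq> 0}. of_rat (?P w) * ((-1) ^ m * tcoeff s (zparse w) m))"
    using supp s by (intro arg_cong[where f = uminus] sum.cong refl) (auto simp: supported_def F_nth)
  also have "\<dots> = - ((-1) ^ m) * lext (\<lambda>w. tcoeff s (zparse w) m) ?P"
    by (simp add: lext_def sum_distrib_left mult_ac sum_negf)
  finally have L: "fps_nth (- (fps_X * ?G)) (Suc m) = - ((-1) ^ m) * lext (\<lambda>w. tcoeff s (zparse w) m) ?P" .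
  have "fps_nth (fps_X * (fps_X * (F s u * F 1 v))) (Suc m) =
      - ((-1) ^ m) * (\<Sum>l\<in>{1..m}. tcoeff s u (m - l) * tcoeff 1 v (l - 1))"
  proof (cases m)
    case (Suc n)
    have "fps_nth (fps_X * (fps_X * (F s u * F 1 v))) (Suc m) = fps_nth (F 1 v * F s u) n"
      by (simp add: Suc mult.commute)
    also have "\<dots> = (\<Sum>i=0..n. fps_nth (F 1 v) i * fps_nth (F s u) (n - i))"
      by (simp add: fps_mult_nth)
    also have "\<dots> = (\<Sum>i=0..n. (-1) ^ n * (tcoeff s u (n - i) * tcoeff 1 v i))"
    proof (rule sum.cong)
      fix i assume i: "i \<in> {0..n}"
      have "fps_nth (F 1 v) i * fps_nth (F s u) (n - i) =
          ((-1) ^ i * (-1) ^ (n - i)) * (tcoeff s u (n - i) * tcoeff 1 v i)"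
        by (simp add: F_nth u v s)
      also have "(-1) ^ i * (-1) ^ (n - i) = ((-1) ^ n :: complex)"
        using i by (simp flip: power_add)
      finally show "fps_nth (F 1 v) i * fps_nth (F s u) (n - i) =
          (-1) ^ n * (tcoeff s u (n - i) * tcoeff 1 v i)" .
    qed simp
    also have "\<dots> = (-1) ^ n * (\<Sum>i=0..n. tcoeff s u (n - i) * tcoeff 1 v i)"
      by (simp only: sum_distrib_left)
    \<comment> \<open>Reindexing by l = i + 1, with m = n + 1.\<close>
    also have "(\<Sum>i=0..n. tcoeff s u (n - i) * tcoeff 1 v i) =
        (\<Sum>l=Suc 0..Suc n. tcoeff s u (m - l) * tcoeff 1 v (l - 1))"
      unfolding Suc by (subst sum.shift_bounds_cl_Suc_ivl) simp
    finally show ?thesis by (simp add: Suc)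
  qed simp
  with L fps_eq show ?thesis by simp
qed

section \<open>Evaluation of the two sides on words\<close>

lemma fsupp_phi_letter [simp]: "fsupp (phi_letter c)"
  by (cases c) auto

lemma fsupp_phi_word [simp]: "fsupp (phi_word u)"
  by (induction u) auto

lemma lext_icoeff_phi_X:
  assumes "fsupp P"
  shows "lext (\<lambda>u. icoeff u m) (pmul (phi_letter X) P) = avg (\<lambda>m. lext (\<lambda>u. icoeff u m) P) m"
  using assms
  by (simp add: lext_pmul lext_padd lext_sum lext_cdivide avg_def geom_def add_divide_distrib
      lessThan_Suc_atMost[symmetric])

lemma delta_times_power:
  assumes "norm c = 1" "0 < n"
  shows "of_rat (delta c) * c ^ n = beta c ^ n"
  using assms by (auto simp: delta_def beta_def)

lemma lext_icoeff_phi_Y: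
  assumes "fsupp P" "norm c = 1"
  shows "lext (\<lambda>u. icoeff u m) (pmul (phi_letter (Y c)) P) =
    ydiff (beta c) (\<lambda>m. lext (\<lambda>u. icoeff u m) P) m"
proof -
  let ?E = "\<lambda>m. lext (\<lambda>u. icoeff u m) P"
  have "lext (\<lambda>u. icoeff u m) (pmul (phi_letter (Y c)) P) =
      of_rat (delta c) * ((\<Sum>j<m. c ^ (m - j) * ?E j) / of_nat m) - (\<Sum>j<m. ?E j) / of_nat m"
    using assms(1) by (simp add: lext_pmul lext_padd lext_sum lext_cdivide lext_cmult of_rat_minus)
  also have "of_rat (delta c) * ((\<Sum>j<m. c ^ (m - j) * ?E j) / of_nat m) =
      (\<Sum>j<m. beta c ^ (m - j) * ?E j) / of_nat m"
    by (simp add: sum_distrib_left delta_times_power[OF assms(2), symmetric] mult.assoc)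
  finally show ?thesis
    by (simp add: ydiff_def left_diff_distrib sum_subtractf diff_divide_distrib)
qed

lemma lext_icoeff_phi_word:
  assumes "zs \<in> zlists" "norm s = 1"
  shows "lext (\<lambda>u. icoeff u m) (phi_word (zword (Iz s zs))) = vcoeff s zs m"
  using assms
proof (induction zs arbitrary: s m)
  case (Cons p zs)
  obtain k t where p: "p = (k, t)" by (cases p)
  have st: "norm (s * t) = 1" and zs: "zs \<in> zlists" using Cons.prems p by (auto simp: norm_mult)
  let ?E = "\<lambda>P m. lext (\<lambda>u. icoeff u m) P"
  have X: "?E (phi_word (replicate n X @ u)) = (avg ^^ n) (?E (phi_word u))" for n u
  proof (induction n)
    case (Suc n)
    have "?E (phi_word (replicate (Suc n) X @ u)) = (\<lambda>m. avg (?E (phi_word (replicate n X @ u))) m)"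
      by (simp add: lext_icoeff_phi_X fun_eq_iff del: phi_letter.simps)
    with Suc show ?case by simp
  qed simp
  have Y: "?E (phi_word (Y (s * t) # u)) = ydiff (beta (s * t)) (?E (phi_word u))" for u
    using st by (simp add: fun_eq_iff lext_icoeff_phi_Y del: phi_letter.simps)
  have "?E (phi_word (zword (Iz (s * t) zs))) = vcoeff (s * t) zs"
    using Cons.IH[OF zs st] by (simp add: fun_eq_iff)
  then have "?E (phi_word (zword (Iz s (p # zs)))) = vcoeff s (p # zs)"
    unfolding p Iz.simps zword.simps append_Cons append_Nil X Y vcoeff.simps by simp
  then show ?case by (rule fun_cong)
qed simp

text \<open>The letter x supplies the diagonal term j = m and delta(s) y_s the terms j < m; together
  they form \<open>geom\<close>.\<close>

lemma lext_icoeff_head: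
  assumes "fsupp P" "norm s = 1"
  shows "lext (\<lambda>u. icoeff u m) (pmul (padd (mon [X]) (psmult (delta s) (mon [Y s]))) P) =
    geom (beta s) (\<lambda>m. lext (\<lambda>u. icoeff u m) P) m / of_nat m"
proof -
  let ?E = "\<lambda>m. lext (\<lambda>u. icoeff u m) P"
  have "lext (\<lambda>u. icoeff u m) (pmul (padd (mon [X]) (psmult (delta s) (mon [Y s]))) P) =
      ?E m / of_nat m + of_rat (delta s) * ((\<Sum>j<m. s ^ (m - j) * ?E j) / of_nat m)"
    using assms(1) by (simp add: lext_pmul lext_padd lext_sum lext_cdivide lext_cmult)
  also have "of_rat (delta s) * ((\<Sum>j<m. s ^ (m - j) * ?E j) / of_nat m) =
      (\<Sum>j<m. beta s ^ (m - j) * ?E j) / of_nat m"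
    by (simp add: sum_distrib_left delta_times_power[OF assms(2), symmetric] mult.assoc)
  finally show ?thesis
    by (simp add: geom_def lessThan_Suc_atMost[symmetric] add_divide_distrib)
qed

section \<open>Convergence of the values of nonconstant words of A^0\<close>

definition adm :: "letter list set" where
  "adm = {u \<in> ywords. \<exists>v. u = X # v \<or> (\<exists>c. c \<noteq> 1 \<and> u = Y c # v)}"

lemma sqbd_icoeff: "u \<in> ywords \<Longrightarrow> sqbd (icoeff u)"
proof (induction rule: ywords_induct)
  case Nil
  show ?case by (auto simp: sqbd_def intro!: exI[of _ 0])
next
  case (X u)
  show ?case
  proof (rule sqbd_average[OF X.IH, of _ 1])
    fix m :: nat
    have "norm (icoeff u m) \<le> (\<Sum>j\<le>m. norm (icoeff u j))" by (rule member_le_sum) auto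
    then show "norm (icoeff (X # u) m) \<le> 1 * (\<Sum>j\<le>m. norm (icoeff u j)) / real m"
      by (simp add: norm_divide divide_right_mono)
  qed simp
next
  case (Y c u)
  have "norm (\<Sum>j<m. c ^ (m - j) * icoeff u j) \<le> (\<Sum>j\<le>m. norm (icoeff u j))" for m
  proof -
    have "norm (\<Sum>j<m. c ^ (m - j) * icoeff u j) \<le> (\<Sum>j<m. norm (icoeff u j))"
      using Y by (intro order_trans[OF norm_sum] sum_mono) (simp add: norm_mult norm_power)
    also have "\<dots> \<le> (\<Sum>j\<le>m. norm (icoeff u j))" by (intro sum_mono2) auto
    finally show ?thesis .
  qed
  then show ?case
    by (intro sqbd_average[OF Y.IH, of _ 1]) (simp_all add: norm_divide divide_right_mono)
qed

text \<open>At z = 0 every Newton polynomial equals 1, so this is the convergence of the Newton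
  series at that point.\<close>

lemma summable_geom_divide:
  assumes "sqbd v" "norm \<beta> \<le> 1" "\<beta> \<noteq> 1"
  shows "summable (\<lambda>m. geom \<beta> v m / of_nat m)"
proof -
  have "(\<lambda>M. \<Sum>n<M. geom \<beta> v (Suc n) / of_nat (Suc n) * newt n 0) \<longlonglongrightarrow>
      nseries (\<lambda>m. geom \<beta> v m / of_nat m) 0"
    using tendsto_uniform_limitI[OF nseries_uniform_limit[OF assms, of 0], of 0] by simp
  then have "summable (\<lambda>n. geom \<beta> v (Suc n) / of_nat (Suc n))"
    unfolding summable_def sums_def by (auto simp: newt_def)
  then show ?thesis by (subst (asm) summable_Suc_iff)
qed

text \<open>A leading x is the case beta = 0, where \<open>geom 0 f\<close> is f. A leading y_c
  gives \<open>geom c\<close> without its diagonal term, and that term is again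
  \<open>geom 0\<close>.\<close>

lemma adm_summable:
  assumes "u \<in> adm"
  shows "summable (icoeff u)"
proof -
  have zero: "geom 0 f = f" for f
  proof
    fix m show "geom 0 f m = f m" by (cases m) (auto simp: geom_Suc)
  qed
  consider v where "u = X # v" "v \<in> ywords" | c v where "u = Y c # v" "v \<in> ywords" "c \<noteq> 1" "norm c = 1"
    using assms by (auto simp: adm_def)
  then show ?thesis
  proof cases
    case (1 v)
    then have "icoeff u = (\<lambda>m. geom 0 (icoeff v) m / of_nat m)"
      by (simp add: zero fun_eq_iff)
    then show ?thesis
      using 1 summable_geom_divide[OF sqbd_icoeff, of v 0] by simp
  next
    case (2 c v)
    have "summable (\<lambda>m. geom c (icoeff v) m / of_nat m - geom 0 (icoeff v) m / of_nat m)"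
      using 2 by (intro summable_diff summable_geom_divide sqbd_icoeff) auto
    moreover have "geom c (icoeff v) m / of_nat m - geom 0 (icoeff v) m / of_nat m = icoeff u m" for m
      unfolding zero 2(1)
      by (simp add: geom_def lessThan_Suc_atMost[symmetric] diff_divide_distrib[symmetric])
    ultimately show ?thesis by simp
  qed
qed

lemma adm_zword_Cons:
  assumes "(k, c) # zs \<in> zlists" "k \<ge> 2 \<or> c \<noteq> 1"
  shows "zword ((k, c) # zs) \<in> adm"
proof -
  have "zword ((k, c) # zs) \<in> ywords" using assms(1) by (rule zword_in_ywords)
  then show ?thesis using assms by (cases "k - 1") (auto simp: adm_def)
qed

lemma adm_zparse:
  assumes "u \<in> adm"
  obtains k c zs where "zparse u = (k, c) # zs" "(k, c) # zs \<in> zlists" "u = zword ((k, c) # zs)"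
    "k \<ge> 2 \<or> c \<noteq> 1"
proof -
  have u: "u \<in> ywords" "u \<noteq> []" using assms by (auto simp: adm_def)
  then obtain k c zs where z: "zparse u = (k, c) # zs"
    by (metis zword_zparse zword.simps(1) list.exhaust surj_pair)
  have zl: "(k, c) # zs \<in> zlists" and uz: "u = zword ((k, c) # zs)"
    using u z zparse_in_zlists[of u] zword_zparse[of u] by auto
  have "k \<ge> 2 \<or> c \<noteq> 1"
  proof (rule ccontr)
    assume "\<not> (k \<ge> 2 \<or> c \<noteq> 1)"
    then have "k = 1" "c = 1" using zl by auto
    with uz assms show False by (auto simp: adm_def)
  qed
  with z zl uz show ?thesis by (rule that)
qed

lemma Lsh_word_adm:
  assumes "u \<in> adm"
  shows "(\<lambda>M. \<Sum>m<M. icoeff u m) \<longlonglongrightarrow> Lsh_word u"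
proof -
  have "(\<lambda>M. \<Sum>m<M. icoeff u m) \<longlonglongrightarrow> suminf (icoeff u)"
    by (rule summable_LIMSEQ[OF adm_summable[OF assms]])
  moreover from this have "Lsh_word u = suminf (icoeff u)"
    by (intro Lsh_word_tendsto) (use assms in \<open>auto simp: adm_def\<close>)
  ultimately show ?thesis by simp
qed

text \<open>By \<open>icoeff_zword_Iz\<close>, the m-th coefficient of z_{k,c} followed by
  \<open>Iz c q\<close> is c^m / m^k times the truncated sum of q. Multiplying by the truncated sum
  of y_1^n affects only the last factor, where \<open>lext_hsum_harmz\<close> applies.\<close>

lemma lext_harmz_Lsh:
  assumes "(k, c) # zs \<in> zlists" "k \<ge> 2 \<or> c \<noteq> 1"
  shows "(\<lambda>M. \<Sum>m<M. icoeff (zword ((k, c) # zs)) m * hsum (replicate n (1, 1)) m) \<longlonglongrightarrow>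
    lext (\<lambda>b. Lsh_word (zword ((k, c) # Iz c (zparse b)))) (harmz (Iinvz c zs) (replicate n (1, 1)))"
proof -
  let ?P = "harmz (Iinvz c zs) (replicate n (1, 1))"
  have c: "norm c = 1" "zs \<in> zlists" "k \<ge> 1" using assms by auto
  have inv: "Iinvz c zs \<in> zlists" using c by simp
  have supp: "supported (zword ` zlists) ?P"
    using supported_harmz[OF inv replicate_1_in_zlists] by (rule supported_mono) auto
  have lim: "(\<lambda>M. lext (\<lambda>b. \<Sum>m<M. icoeff (zword ((k, c) # Iz c (zparse b))) m) ?P) \<longlonglongrightarrow>
      lext (\<lambda>b. Lsh_word (zword ((k, c) # Iz c (zparse b)))) ?P"
  proof (rule tendsto_lext[OF supp])
    fix b assume "b \<in> zword ` zlists"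
    then have "(k, c) # Iz c (zparse b) \<in> zlists" using assms c by auto
    then show "(\<lambda>M. \<Sum>m<M. icoeff (zword ((k, c) # Iz c (zparse b))) m) \<longlonglongrightarrow>
        Lsh_word (zword ((k, c) # Iz c (zparse b)))"
      using assms(2) by (intro Lsh_word_adm adm_zword_Cons)
  qed
  have Iz1: "(k, c) # Iz c q = Iz 1 ((k, c) # q)" for q by simp
  have "lext (\<lambda>b. icoeff (zword ((k, c) # Iz c (zparse b))) m) ?P =
      icoeff (zword ((k, c) # zs)) m * hsum (replicate n (1, 1)) m" for m
  proof (cases "m = 0")
    case False
    have "lext (\<lambda>b. icoeff (zword ((k, c) # Iz c (zparse b))) m) ?P =
        lext (\<lambda>b. (1 * c) ^ m / of_nat m ^ k * hsum (zparse b) m) ?P"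
      unfolding Iz1
      by (rule lext_cong[OF supp], rule icoeff_zword_Iz) (use assms False in auto)
    also have "\<dots> = (1 * c) ^ m / of_nat m ^ k * (hsum (Iinvz c zs) m * hsum (replicate n (1, 1)) m)"
      by (simp only: lext_cmult lext_hsum_harmz[OF inv replicate_1_in_zlists])
    also have "\<dots> = icoeff (zword (Iz 1 ((k, c) # Iinvz c zs))) m * hsum (replicate n (1, 1)) m"
      using assms False inv by (subst icoeff_zword_Iz) auto
    also have "Iz 1 ((k, c) # Iinvz c zs) = (k, c) # zs"
      using c by (simp add: Iz_Iinvz)
    finally show ?thesis .
  qed simp
  with lim show ?thesis by (simp only: lext_sum)
qed

section \<open>Values of the operator expressions as weighted sums of Taylor coefficients\<close>

lemma lin_mon: "lin g (mon b) = g b"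
proof
  fix u
  have "{w. mon b w \<noteq> 0} = {b}" by (auto simp: mon_def)
  then show "lin g (mon b) u = g b u" by (simp add: lin_def mon_def)
qed

lemma dotstar_ypow: "dotstar P (ypow n) = lin (\<lambda>a. dstz (zparse a) (replicate n (1, 1))) P"
  unfolding dotstar_def ypow_def lin_mon zparse_replicate_Y ..

text \<open>The dotted product merges one y_1 with the leading letter, raising its index by 1, and
  \<open>Lxinv\<close> undoes this. The other n letters y_1 multiply the m-th Taylor coefficient of
  U by their truncated harmonic sum.\<close>

lemma Lsh_of_supported:
  assumes U: "supported adm U"
    and lim: "(\<lambda>M. \<Sum>m<M. lext (\<lambda>u. icoeff u m) U * hsum (replicate n (1, 1)) m) \<longlonglongrightarrow> l"
  shows "Lsh (Lxinv (Iop (dotstar (Iinv U) (ypow (Suc n))))) = l"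
proof -
  \<comment> \<open>These are \<open>Lsh_word\<close> pulled back through \<open>Lxinv\<close>, then
    \<open>Iop\<close>, then the dotted product.\<close>
  define f1 where "f1 = (\<lambda>w. case w of X # v \<Rightarrow> Lsh_word v | _ \<Rightarrow> 0)"
  define f2 where "f2 = (\<lambda>w. f1 (zword (Iz 1 (zparse w)) @ replicate (tailx w) X))"
  define f3 where "f3 = (\<lambda>a. lext f2 (dstz (zparse a) (replicate (Suc n) (1, 1))))"
  have adm: "adm \<subseteq> ywords" by (auto simp: adm_def)
  have inv: "zword (Iinvz 1 (zparse u)) @ replicate (tailx u) X \<in> ywords" if "u \<in> ywords" for u
    using that by simp
  have I: "supported ywords (Iinv U)"
    unfolding Iinv_def using adm inv by (intro supported_lin[OF U] supported_mon) auto
  have fd: "fsupp (dstz (zparse a) (replicate (Suc n) (1, 1)))" if "a \<in> ywords" for a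
  proof -
    have "zparse a \<in> zlists" using that by simp
    moreover have "replicate n (Suc 0, 1) \<in> zlists"
      using replicate_1_in_zlists[of n] by simp
    ultimately show ?thesis by (cases "zparse a" rule: zword.cases) auto
  qed
  have D: "dotstar (Iinv U) (ypow (Suc n)) = lin (\<lambda>a. dstz (zparse a) (replicate (Suc n) (1, 1))) (Iinv U)"
    by (rule dotstar_ypow)
  have fD: "fsupp (dotstar (Iinv U) (ypow (Suc n)))"
    unfolding D using supported_lin[OF I, of UNIV] fd by simp
  have fI: "fsupp (Iop P)" if "fsupp P" for P
    unfolding Iop_def using supported_lin[of UNIV P UNIV] that by simp
  have "Lsh (Lxinv (Iop (dotstar (Iinv U) (ypow (Suc n))))) = lext f1 (Iop (dotstar (Iinv U) (ypow (Suc n))))"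
  proof -
    have z: "fsupp (\<lambda>_. 0)" by (simp add: fsupp_def)
    have "lext Lsh_word (case w of X # v \<Rightarrow> mon v | _ \<Rightarrow> (\<lambda>_. 0)) = f1 w \<and>
        fsupp (case w of X # v \<Rightarrow> mon v | _ \<Rightarrow> (\<lambda>_. 0))" for w
    proof (cases w)
      case (Cons a v)
      then show ?thesis using z by (cases a) (simp_all add: f1_def)
    qed (simp add: z f1_def)
    then show ?thesis
      unfolding Lsh_eq_lext Lxinv_def using fI[OF fD] by (subst lext_lin[of UNIV]) auto
  qed
  also have "\<dots> = lext f2 (dotstar (Iinv U) (ypow (Suc n)))"
    unfolding Iop_def f2_def using fD by (subst lext_lin[of UNIV]) auto
  also have "\<dots> = lext f3 (Iinv U)"
    unfolding D f3_def using fd by (intro lext_lin[OF I]) auto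
  also have "\<dots> = lext (\<lambda>u. f3 (zword (Iinvz 1 (zparse u)) @ replicate (tailx u) X)) U"
    unfolding Iinv_def using U by (subst lext_lin[OF U]) auto
  also have "\<dots> = l"
  proof (rule LIMSEQ_unique[OF _ lim])
    have "(\<lambda>M. lext (\<lambda>u. \<Sum>m<M. icoeff u m * hsum (replicate n (1, 1)) m) U) \<longlonglongrightarrow>
        lext (\<lambda>u. f3 (zword (Iinvz 1 (zparse u)) @ replicate (tailx u) X)) U"
    proof (rule tendsto_lext[OF U])
      fix u assume u: "u \<in> adm"
      then obtain k c zs where z: "zparse u = (k, c) # zs" "(k, c) # zs \<in> zlists" "u = zword ((k, c) # zs)"
          "k \<ge> 2 \<or> c \<noteq> 1"
        by (rule adm_zparse)
      have c: "norm c = 1" "zs \<in> zlists" "k \<ge> 1" using z by auto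
      let ?H = "harmz (Iinvz c zs) (replicate n (1, 1))"
      have supp: "supported (zword ` zlists) ?H"
        by (rule supported_mono[OF supported_harmz[OF Iinvz_in_zlists[OF c(2,1)] replicate_1_in_zlists]]) auto
      have ul: "zword (Iinvz 1 (zparse u)) @ replicate (tailx u) X = zword ((k, c) # Iinvz c zs)"
        using u adm z(1) by auto
      have zp: "zparse (zword ((k, c) # Iinvz c zs)) = (k, c) # Iinvz c zs"
        using c by (intro zparse_zword) auto
      have "f3 (zword (Iinvz 1 (zparse u)) @ replicate (tailx u) X) =
          lext f2 (pmul (mon (zword [(Suc k, c)])) ?H)"
        unfolding ul f3_def zp by simp
      also have "\<dots> = lext (\<lambda>b. f2 (zword [(Suc k, c)] @ b)) ?H"
        by (subst lext_pmul[OF fsupp_mon supported_imp_fsupp[OF supp]]) (simp only: lext_mon)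
      also have "\<dots> = lext (\<lambda>b. Lsh_word (zword ((k, c) # Iz c (zparse b)))) ?H"
      proof (rule lext_cong[OF supp])
        fix b assume "b \<in> zword ` zlists"
        then obtain q where q: "b = zword q" "q \<in> zlists" by auto
        have l: "(Suc k, c) # q \<in> zlists" using q c by auto
        have "f2 (zword [(Suc k, c)] @ b) = f1 (zword (Iz 1 ((Suc k, c) # q)))"
          unfolding q(1) zword_Cons_append f2_def zparse_zword[OF l] using l by (simp del: zword.simps Iz.simps)
        also have "Iz 1 ((Suc k, c) # q) = (Suc k, c) # Iz c q" by simp
        also have "zword ((Suc k, c) # Iz c q) = X # zword ((k, c) # Iz c q)"
          using c(3) by (cases k) auto
        finally show "f2 (zword [(Suc k, c)] @ b) = Lsh_word (zword ((k, c) # Iz c (zparse b)))"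
          using q by (simp add: f1_def)
      qed
      finally show "(\<lambda>M. \<Sum>m<M. icoeff u m * hsum (replicate n (1, 1)) m) \<longlonglongrightarrow>
          f3 (zword (Iinvz 1 (zparse u)) @ replicate (tailx u) X)"
        using lext_harmz_Lsh[OF z(2,4), of n] unfolding z(3) by simp
    qed
    then show "(\<lambda>M. \<Sum>m<M. lext (\<lambda>u. icoeff u m) U * hsum (replicate n (1, 1)) m) \<longlonglongrightarrow>
        lext (\<lambda>u. f3 (zword (Iinvz 1 (zparse u)) @ replicate (tailx u) X)) U"
      by (simp only: lext_sum lext_cmult_right)
  qed
  finally show ?thesis .
qed

text \<open>A final letter y_c is sent to a combination of y_c and y_1, so no word ending in x
  arises. The set \<open>\<Lambda>\<close> serves to show later that the character 1 alone is
  preserved.\<close>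

lemma supported_phi_word:
  assumes "u \<in> ywords" "\<And>c. Y c \<in> set u \<Longrightarrow> c \<in> \<Lambda>" "1 \<in> \<Lambda>"
  shows "supported {v \<in> ywords. (v = [] \<longrightarrow> u = []) \<and> (\<forall>c. Y c \<in> set v \<longrightarrow> c \<in> \<Lambda>)} (phi_word u)"
  using assms(1,2)
proof (induction rule: ywords_induct)
  case Nil
  show ?case by auto
next
  case (X u)
  then have IH: "supported {v \<in> ywords. (v = [] \<longrightarrow> u = []) \<and> (\<forall>c. Y c \<in> set v \<longrightarrow> c \<in> \<Lambda>)} (phi_word u)"
    by simp
  have "supported {[X], [Y 1]} (phi_letter X)" by auto
  then show ?case unfolding phi_word.simps
    by (rule supported_pmul[OF _ IH]) (use X.hyps assms(3) in auto)
next
  case (Y c u)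
  then have IH: "supported {v \<in> ywords. (v = [] \<longrightarrow> u = []) \<and> (\<forall>c. Y c \<in> set v \<longrightarrow> c \<in> \<Lambda>)} (phi_word u)"
    by simp
  have c: "c \<in> \<Lambda>" using Y.prems by simp
  have "supported {[Y c], [Y 1]} (phi_letter (Y c))" by auto
  then show ?case unfolding phi_word.simps
    by (rule supported_pmul[OF _ IH]) (use Y.hyps c assms(3) in auto)
qed

definition zwords :: "letter list set" where
  "zwords = {w \<in> ywords. w \<noteq> []}"

text \<open>The argument has Taylor coefficients \<open>geom (beta s) (vcoeff s _) m / m\<close>, by
  \<open>lext_icoeff_phi_word\<close> and \<open>lext_icoeff_head\<close>. Weighted by the truncated
  sums of y_1^n, they add up to \<open>tcoeff\<close> by \<open>tcoeff_tendsto\<close>.\<close>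

lemma Lsh_eq_lext_tcoeff:
  assumes w: "supported zwords w" and s: "norm s = 1"
  shows "Lsh (Lxinv (Iop (dotstar (Iinv (pmul (padd (mon [X]) (psmult (delta s) (mon [Y s])))
      (phi (Iop (Mop s w))))) (ypow (Suc n))))) = lext (\<lambda>a. tcoeff s (zparse a) n) w"
proof -
  let ?R = "phi (Iop (Mop s w))"
  let ?U = "pmul (padd (mon [X]) (psmult (delta s) (mon [Y s]))) ?R"
  have M: "supported zwords (Mop s w)"
    unfolding Mop_def
  proof (rule supported_lin[OF w], rule supported_mon)
    fix a assume "a \<in> zwords"
    then have a: "a \<in> ywords" "zparse a \<noteq> []" by (auto simp: zwords_def dest: arg_cong[where f = zword])
    then have "Mz s (zparse a) \<noteq> []" by (cases "zparse a" rule: zword.cases) auto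
    with a s show "zword (Mz s (zparse a)) @ replicate (tailx a) X \<in> zwords"
      by (auto simp: zwords_def)
  qed
  have IM: "supported zwords (Iop (Mop s w))"
    unfolding Iop_def
  proof (rule supported_lin[OF M], rule supported_mon)
    fix a assume "a \<in> zwords"
    then have a: "a \<in> ywords" "zparse a \<noteq> []" by (auto simp: zwords_def dest: arg_cong[where f = zword])
    then show "zword (Iz 1 (zparse a)) @ replicate (tailx a) X \<in> zwords"
      by (auto simp: zwords_def)
  qed
  have R: "supported zwords ?R"
    unfolding phi_def
  proof (rule supported_lin[OF IM])
    fix a assume "a \<in> zwords"
    then show "supported zwords (phi_word a)"
      by (intro supported_mono[OF supported_phi_word[where \<Lambda> = UNIV]]) (auto simp: zwords_def)
  qed
  \<comment> \<open>For s = 1 the coefficient delta(s) is 0, so no word with the divergent leading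
    letter y_1 arises.\<close>
  have "supported ({[X]} \<union> (if s = 1 then {} else {[Y s]})) (padd (mon [X]) (psmult (delta s) (mon [Y s])))"
    by (auto simp: delta_def)
  then have U: "supported adm ?U"
    by (rule supported_pmul[OF _ R]) (use s in \<open>auto simp: zwords_def adm_def split: if_splits\<close>)
  have E: "lext (\<lambda>u. icoeff u m) ?R = lext (\<lambda>a. vcoeff s (zparse a) m) w" for m
  proof -
    have "lext (\<lambda>u. icoeff u m) ?R = lext (\<lambda>a. lext (\<lambda>u. icoeff u m) (phi_word a)) (Iop (Mop s w))"
      unfolding phi_def by (rule lext_lin[OF IM]) simp
    also have "\<dots> = lext (\<lambda>a. lext (\<lambda>u. icoeff u m)
        (phi_word (zword (Iz 1 (zparse a)) @ replicate (tailx a) X))) (Mop s w)"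
      unfolding Iop_def by (subst lext_lin[OF M]) auto
    also have "\<dots> = lext (\<lambda>a. lext (\<lambda>u. icoeff u m) (phi_word (zword (Iz 1 (zparse
        (zword (Mz s (zparse a)) @ replicate (tailx a) X))) @
        replicate (tailx (zword (Mz s (zparse a)) @ replicate (tailx a) X)) X))) w"
      unfolding Mop_def by (subst lext_lin[OF w]) auto
    also have "\<dots> = lext (\<lambda>a. vcoeff s (zparse a) m) w"
    proof (rule lext_cong[OF w])
      fix a assume "a \<in> zwords"
      then have "a \<in> ywords" by (simp add: zwords_def)
      then show "lext (\<lambda>u. icoeff u m) (phi_word (zword (Iz 1 (zparse
          (zword (Mz s (zparse a)) @ replicate (tailx a) X))) @
          replicate (tailx (zword (Mz s (zparse a)) @ replicate (tailx a) X)) X)) = vcoeff s (zparse a) m"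
        using s by (simp add: Iz_Mz lext_icoeff_phi_word)
    qed
    finally show ?thesis .
  qed
  have EU: "lext (\<lambda>u. icoeff u m) ?U = lext (\<lambda>a. geom (beta s) (vcoeff s (zparse a)) m / of_nat m) w" for m
    unfolding lext_icoeff_head[OF supported_imp_fsupp[OF R] s] E
    by (simp add: geom_def lext_sum lext_cmult lext_cdivide)
  have "(\<lambda>M. lext (\<lambda>a. \<Sum>m<M. geom (beta s) (vcoeff s (zparse a)) m / of_nat m * hsum (replicate n (1, 1)) m) w)
      \<longlonglongrightarrow> lext (\<lambda>a. tcoeff s (zparse a) n) w"
    using s by (intro tendsto_lext[OF w] tcoeff_tendsto) (auto simp: zwords_def)
  then have "(\<lambda>M. \<Sum>m<M. lext (\<lambda>u. icoeff u m) ?U * hsum (replicate n (1, 1)) m) \<longlonglongrightarrow>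
      lext (\<lambda>a. tcoeff s (zparse a) n) w"
    unfolding EU by (simp only: lext_sum lext_cmult_right)
  then show ?thesis
    by (rule Lsh_of_supported[OF U])
qed

section \<open>Words without characters\<close>

definition trivial_zlists :: "(nat \<times> complex) list set" where
  "trivial_zlists = {zs. set zs \<subseteq> {(k, c). 1 \<le> k \<and> c = 1}}"

lemma trivial_subset_zlists: "trivial_zlists \<subseteq> zlists"
  by (auto simp: trivial_zlists_def zlists_def)

lemma trivial_zlists_Cons [simp]:
  "(k, c) # zs \<in> trivial_zlists \<longleftrightarrow> 1 \<le> k \<and> c = 1 \<and> zs \<in> trivial_zlists"
  by (auto simp: trivial_zlists_def)

lemma Y_in_set_zword: "Y c \<in> set (zword zs) \<longleftrightarrow> c \<in> snd ` set zs"
  by (induction zs rule: zword.induct) (auto simp: image_iff)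

lemma trivial_word_iff:
  "u \<in> zword ` trivial_zlists \<longleftrightarrow> u \<in> ywords \<and> (\<forall>c. Y c \<in> set u \<longrightarrow> c \<in> {1})"
proof
  assume "u \<in> zword ` trivial_zlists"
  then obtain zs where "u = zword zs" "zs \<in> trivial_zlists" by auto
  then show "u \<in> ywords \<and> (\<forall>c. Y c \<in> set u \<longrightarrow> c \<in> {1})"
    using trivial_subset_zlists by (auto simp: Y_in_set_zword trivial_zlists_def)
next
  assume u: "u \<in> ywords \<and> (\<forall>c. Y c \<in> set u \<longrightarrow> c \<in> {1})"
  then have "u = zword (zparse u)" "zparse u \<in> zlists" by auto
  moreover from this u have "c = 1" if "(k, c) \<in> set (zparse u)" for k c
    using that Y_in_set_zword[of c "zparse u"] by (force simp: image_iff)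
  ultimately have "zparse u \<in> trivial_zlists"
    by (auto simp: trivial_zlists_def zlists_def)
  with \<open>u = zword (zparse u)\<close> show "u \<in> zword ` trivial_zlists" by blast
qed

lemma trivial_zlists_ops:
  assumes "zs \<in> trivial_zlists"
  shows "Iz 1 zs = zs" "Iinvz 1 zs = zs" "Mz 1 zs = zs"
proof -
  show "Iz 1 zs = zs" using assms by (induction zs) auto
  show "Iinvz 1 zs = zs" using assms by (induction zs) auto
  show "Mz 1 zs = zs" by (cases zs) auto
qed

lemma lin_mon_id:
  assumes "supported A P" "\<And>w. w \<in> A \<Longrightarrow> h w = w"
  shows "lin (\<lambda>w. mon (h w)) P = P"
proof
  fix u
  have fin: "finite {w. P w \<noteq> 0}" using assms(1) by (simp add: supported_def fsupp_def)
  have "lin (\<lambda>w. mon (h w)) P u = (\<Sum>w\<in>{w. P w \<noteq> 0}. if u = w then P w else 0)"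
    unfolding lin_def using assms by (intro sum.cong) (auto simp: supported_def mon_def)
  also have "\<dots> = P u" using fin by simp
  finally show "lin (\<lambda>w. mon (h w)) P u = P u" .
qed

lemma trivial_operators:
  assumes "supported (zword ` trivial_zlists) P"
  shows "Iop P = P" "Iinv P = P" "Mop 1 P = P"
proof -
  have *: "zparse w \<in> trivial_zlists \<and> zword (zparse w) = w \<and> tailx w = 0" if "w \<in> zword ` trivial_zlists" for w
    using that trivial_subset_zlists by auto
  show "Iop P = P" "Iinv P = P" "Mop 1 P = P"
    unfolding Iop_def Iinv_def Mop_def
    by (rule lin_mon_id[OF assms]; use * in \<open>simp add: trivial_zlists_ops\<close>)+
qed

text \<open>This is the case s = 1 of \<open>Lsh_eq_lext_tcoeff\<close>: on words with all
  characters 1 the operators \<open>Iop\<close>, \<open>Iinv\<close> and \<open>Mop 1\<close> are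
  the identity, and delta(1) = 0.\<close>

lemma Lsh_trivial:
  assumes w: "supported (zword ` (trivial_zlists - {[]})) w"
  shows "Lsh (Lxinv (dotstar (pmul (mon [X]) (phi w)) (ypow (Suc n)))) =
    lext (\<lambda>a. tcoeff 1 (zparse a) n) w"
proof -
  let ?T = "zword ` trivial_zlists"
  have w1: "supported ?T w" by (rule supported_mono[OF w]) auto
  have w2: "supported zwords w"
    by (rule supported_mono[OF w]) (use trivial_subset_zlists in \<open>auto simp: zwords_def\<close>)
  have R: "supported {v \<in> ?T. v \<noteq> []} (phi w)"
    unfolding phi_def
  proof (rule supported_lin[OF w])
    fix a assume a: "a \<in> zword ` (trivial_zlists - {[]})"
    then have "a \<in> ?T" "a \<noteq> []" by auto
    then show "supported {v \<in> ?T. v \<noteq> []} (phi_word a)"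
      using trivial_word_iff[of a]
      by (intro supported_mono[OF supported_phi_word[where \<Lambda> = "{1}"]]) (auto simp: trivial_word_iff)
  qed
  have U: "supported {v \<in> ?T. v \<noteq> []} (pmul (mon [X]) (phi w))"
    by (rule supported_pmul[OF supported_mon[of "[X]" "{[X]}"] R]) (auto simp: trivial_word_iff)
  have D: "supported ?T (dotstar (pmul (mon [X]) (phi w)) (ypow (Suc n)))"
    unfolding dotstar_ypow
  proof (rule supported_lin[OF U])
    fix a assume "a \<in> {v \<in> ?T. v \<noteq> []}"
    then obtain zs where "zparse a = zs" "zs \<in> trivial_zlists" "zs \<noteq> []"
      using trivial_subset_zlists by auto
    then obtain k zs where z: "zparse a = (k, 1) # zs" "1 \<le> k" "zs \<in> trivial_zlists"
      by (cases zs) auto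
    let ?H = "harmz zs (replicate n (1, 1))"
    have H: "supported ?T ?H"
      by (rule supported_mono[OF supported_harmz_closed[where A = "{(k, c). 1 \<le> k \<and> c = 1}"]])
         (use z in \<open>auto simp: trivial_zlists_def\<close>)
    have "supported ?T (pmul (mon (zword [(Suc k, 1)])) ?H)"
    proof (rule supported_pmul[OF supported_mon[of _ "{zword [(Suc k, 1)]}"] H])
      fix a b assume "a \<in> {zword [(Suc k, 1)]}" "b \<in> ?T"
      then obtain q where "a @ b = zword ((Suc k, 1) # q)" "q \<in> trivial_zlists"
        by (auto simp: zword_Cons_append simp del: zword.simps)
      then show "a @ b \<in> ?T" by (auto simp del: zword.simps)
    qed simp
    then show "supported ?T (dstz (zparse a) (replicate (Suc n) (1, 1)))"
      by (simp add: z)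
  qed
  have U': "pmul (padd (mon [X]) (psmult (delta 1) (mon [Y 1]))) (phi (Iop (Mop 1 w))) =
      pmul (mon [X]) (phi w)"
    by (simp add: trivial_operators[OF w1] delta_def padd_def psmult_def)
  have "supported ?T (pmul (mon [X]) (phi w))" by (rule supported_mono[OF U]) auto
  then have "Iop (dotstar (Iinv (pmul (mon [X]) (phi w))) (ypow (Suc n))) =
      dotstar (pmul (mon [X]) (phi w)) (ypow (Suc n))"
    by (simp add: trivial_operators[OF D] trivial_operators(2))
  with Lsh_eq_lext_tcoeff[OF w2, of 1 n] show ?thesis unfolding U' by simp
qed

section \<open>The theorem, by linearity from single words\<close>

lemma norm_mu: "r > 0 \<Longrightarrow> c \<in> mu r \<Longrightarrow> norm c = 1"
  using power_eq_1_iff[of c r] by (auto simp: mu_def)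

lemma supported_A1pos:
  assumes "A1pos \<Lambda> w" "\<And>c. c \<in> \<Lambda> \<Longrightarrow> norm c = 1"
  shows "supported {a \<in> zwords. \<forall>c. Y c \<in> set a \<longrightarrow> c \<in> \<Lambda>} w"
  using assms by (auto simp: A1pos_def supported_def zwords_def ywords_def)

theorem theorem3p20:
  fixes r :: nat and s :: complex and w w' :: qpoly and m :: nat
  assumes "r > 0" and "s \<in> mu r"
    and "A1pos (mu r) w" and "A1pos {1} w'"
  shows "(\<Sum>l\<in>{1..m}.
            Lsh (Lxinv (Iop (dotstar
                 (Iinv (pmul (padd (mon [X]) (psmult (delta s) (mon [Y s])))
                              (phi (Iop (Mop s w)))))
                 (ypow (m - l + 1)))))
          * Lsh (Lxinv (dotstar (pmul (mon [X]) (phi w')) (ypow l))))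
       = Lsh (Lxinv (Iop (dotstar
                 (Iinv (pmul (padd (mon [X]) (psmult (delta s) (mon [Y s])))
                              (phi (Iop (Mop s (star w w'))))))
                 (ypow (m + 1)))))"
proof -
  let ?T = "zword ` (trivial_zlists - {[]})"
  have s: "norm s = 1" using assms(1,2) by (rule norm_mu)
  have w: "supported zwords w"
    by (rule supported_mono[OF supported_A1pos[OF assms(3)]]) (use assms(1) norm_mu in auto)
  have w': "supported ?T w'"
  proof (rule supported_mono[OF supported_A1pos[OF assms(4)]])
    show "{a \<in> zwords. \<forall>c. Y c \<in> set a \<longrightarrow> c \<in> {1}} \<subseteq> ?T"
    proof
      fix a assume a: "a \<in> {a \<in> zwords. \<forall>c. Y c \<in> set a \<longrightarrow> c \<in> {1}}"
      then have "a \<in> zword ` trivial_zlists" "a \<noteq> []"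
        unfolding trivial_word_iff by (auto simp: zwords_def)
      then show "a \<in> ?T" by auto
    qed
  qed simp
  have zl: "zparse a \<in> zlists" "zparse a \<noteq> []" if "a \<in> zwords" for a
    using that by (auto simp: zwords_def dest: arg_cong[where f = zword])
  have tl: "zparse b \<in> zlists" "zparse b \<noteq> []" "\<forall>(k, c)\<in>set (zparse b). c = 1" if b: "b \<in> ?T" for b
  proof -
    obtain zs where zs: "b = zword zs" "zs \<in> trivial_zlists" "zs \<noteq> []" using b by auto
    then have "zparse b = zs" using trivial_subset_zlists by auto
    with zs show "zparse b \<in> zlists" "zparse b \<noteq> []" "\<forall>(k, c)\<in>set (zparse b). c = 1"
      using trivial_subset_zlists by (auto simp: trivial_zlists_def)
  qed
  have inner: "supported zwords (lin (\<lambda>b. harmz (zparse a) (zparse b)) w')" if "a \<in> zwords" for a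
  proof (rule supported_lin[OF w'])
    fix b assume b: "b \<in> ?T"
    show "supported zwords (harmz (zparse a) (zparse b))"
      by (rule supported_mono[OF supported_harmz]) (use zl[OF that] tl[OF b] in \<open>auto simp: zwords_def\<close>)
  qed
  then have star: "supported zwords (star w w')"
    unfolding star_def by (intro supported_lin[OF w])
  have "(\<Sum>l\<in>{1..m}.
            Lsh (Lxinv (Iop (dotstar
                 (Iinv (pmul (padd (mon [X]) (psmult (delta s) (mon [Y s])))
                              (phi (Iop (Mop s w)))))
                 (ypow (m - l + 1)))))
          * Lsh (Lxinv (dotstar (pmul (mon [X]) (phi w')) (ypow l)))) =
      (\<Sum>l\<in>{1..m}. lext (\<lambda>a. tcoeff s (zparse a) (m - l)) w * lext (\<lambda>b. tcoeff 1 (zparse b) (l - 1)) w')"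
  proof (rule sum.cong)
    fix l assume "l \<in> {1..m}"
    \<comment> \<open>The powers y_1^(k+1) with k = m - l and y_1^l correspond to Taylor
      coefficients of orders m - l and l - 1, each one less than the power.\<close>
    then have l: "l = Suc (l - 1)" "m - l + 1 = Suc (m - l)" by auto
    have "Lsh (Lxinv (dotstar (pmul (mon [X]) (phi w')) (ypow l))) = lext (\<lambda>b. tcoeff 1 (zparse b) (l - 1)) w'"
      by (subst l(1)) (rule Lsh_trivial[OF w'])
    then show "Lsh (Lxinv (Iop (dotstar (Iinv (pmul (padd (mon [X]) (psmult (delta s) (mon [Y s])))
          (phi (Iop (Mop s w))))) (ypow (m - l + 1)))))
        * Lsh (Lxinv (dotstar (pmul (mon [X]) (phi w')) (ypow l))) =
        lext (\<lambda>a. tcoeff s (zparse a) (m - l)) w * lext (\<lambda>b. tcoeff 1 (zparse b) (l - 1)) w'"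
      unfolding l(2) Lsh_eq_lext_tcoeff[OF w s] by simp
  qed simp
  also have "\<dots> = lext (\<lambda>a. lext (\<lambda>b. \<Sum>l\<in>{1..m}.
      tcoeff s (zparse a) (m - l) * tcoeff 1 (zparse b) (l - 1)) w') w"
    by (simp only: lext_sum lext_cmult lext_cmult_right)
  \<comment> \<open>This is the product formula for Taylor coefficients; the remaining equalities
    collect the words of \<open>star w w'\<close> and translate back.\<close>
  also have "\<dots> = lext (\<lambda>a. lext (\<lambda>b. lext (\<lambda>c. tcoeff s (zparse c) m) (harmz (zparse a) (zparse b))) w') w"
    by (rule lext_cong[OF w], rule lext_cong[OF w'], rule tcoeff_mult) (use zl tl s in auto)
  also have "\<dots> = lext (\<lambda>a. lext (\<lambda>c. tcoeff s (zparse c) m) (lin (\<lambda>b. harmz (zparse a) (zparse b)) w')) w"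
    by (rule lext_cong[OF w], rule lext_lin[OF w', symmetric]) (use zl tl in auto)
  also have "\<dots> = lext (\<lambda>c. tcoeff s (zparse c) m) (star w w')"
    unfolding star_def by (rule lext_lin[OF w, symmetric]) (rule supported_imp_fsupp[OF inner])
  also have "\<dots> = Lsh (Lxinv (Iop (dotstar
                 (Iinv (pmul (padd (mon [X]) (psmult (delta s) (mon [Y s])))
                              (phi (Iop (Mop s (star w w'))))))
                 (ypow (m + 1)))))"
    using Lsh_eq_lext_tcoeff[OF star s, of m] by simp
  finally show ?thesis .
qed

end
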